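(* Let $d\ge 1$, let $Q\in\mathcal{M}^+(d)$ and $x_0\in\mathbb{R}^d\setminus\{0\}$, and let $\gamma,\ell,m,\theta_1,\dots,\theta_m,v_1,\dots,v_m$ be asymptotic data of $(Q,x_0)$. Let $\xi$ be a Lévy process in $\mathbb{R}^d$ with triplet $(a,\Sigma,\nu)$ such that $\mathbb{E}[\log(1\vee|\xi_1|)]<\infty$, and assume that the laws $\mu^\natural_t$ of $I^\natural_t$ satisfy condition (H). For $\epsilon>0$ small enough that the following quantities are defined and positive, set $$t_\epsilon:=\frac{1}{2\gamma}\ln\left(\frac1\epsilon\right)+\frac{\ell-1}{\gamma}\ln\left(\ln\left(\frac1\epsilon\right)\right),\qquad w_\epsilon:=\gamma^{-1}+o_\epsilon(1),$$ where $o_\epsilon(1)$ is any function of $\epsilon$ with $\lim_{\epsilon\to0}o_\epsilon(1)=0$. Then: (i) If $\theta_k=0$ for every $k\in\{1,\dots,m\}$, the family $(X^{(\epsilon)},\epsilon>0)$ has profile cut-off with cut-off time $t_\epsilon$, time window $w_\epsilon$ and profile function $G_{x_0}:\mathbb{R}\to[0,1]$ given, for every $c\in\mathbb{R}$, by $$G_{x_0}(c):=\lim_{\epsilon\to0}d^{(\epsilon)}(t_\epsilon+cw_\epsilon)=d_{\mathrm{TV}}\left((2\gamma)^{1-\ell}e^{-c}v(x_0)+I^\natural_\infty,\ I^\natural_\infty\right),\qquad v(x_0):=\sum_{k=1}^m v_k .$$ In addition, $\lim_{c\to-\infty}G_{x_0}(c)=1$ and $\lim_{c\to\infty}G_{x_0}(c)=0$.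 (ii) If $\theta_k\neq0$ for some $k\in\{1,\dots,m\}$, the family $(X^{(\epsilon)},\epsilon>0)$ has window cut-off with cut-off time $t_\epsilon$ and time window $w_\epsilon$.
   Context: $\mathcal{M}^+(d)$ is the set of real $d\times d$ matrices all of whose eigenvalues have positive real part. $d_{\mathrm{TV}}(X,Y)=\sup_{A\in\mathcal{B}(\mathbb{R}^d)}|\mathbb{P}(X\in A)-\mathbb{P}(Y\in A)|$ is the total variation distance between the laws of the random vectors $X$ and $Y$. Lévy process. $\xi=(\xi_t,t\ge0)$ is a càdlàg process in $\mathbb{R}^d$ with $\xi_0=0$ and stationary independent increments, and $\mathbb{E}[e^{i\langle z,\xi_t\rangle}]=e^{t\psi(z)}$ with $$\psi(z)=-\tfrac12\langle z,\Sigma z\rangle+i\langle a,z\rangle+\int_{\mathbb{R}^d}\left(e^{i\langle z,x\rangle}-1-i\langle z,x\rangle\mathbf{1}_{\{|x|\le1\}}\right)\nu(\mathrm{d}x),$$ where $a\in\mathbb{R}^d$, $\Sigma$ is symmetric non-negative definite and $\nu$ is a measure on $\mathbb{R}^d\setminus\{0\}$ with $\int(1\wedge|x|^2)\nu(\mathrm{d}x)<\infty$. Ornstein-Uhlenbeck process. For $\epsilon>0$, $X^{(\epsilon)}$ is the unique strong solution of $\mathrm{d}X^{(\epsilon)}_t=-QX^{(\epsilon)}_t\,\mathrm{d}t+\sqrt{\epsilon}\,\mathrm{d}\xi_t$, $X^{(\epsilon)}_0=x_0$, i.e. $X^{(\epsilon)}_t=e^{-tQ}x_0+\sqrt\epsilon\int_0^te^{-(t-s)Q}\mathrm{d}\xi_s$.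 Under the log-moment condition $\mathbb{E}[\log(1\vee|\xi_1|)]<\infty$, $X^{(\epsilon)}_t$ converges in law as $t\to\infty$ to a random vector $X^{(\epsilon)}_\infty$ whose law has characteristic function $\lambda\mapsto\exp\{\int_0^\infty\psi(\sqrt\epsilon e^{-sQ^T}\lambda)\mathrm{d}s\}$. Put $d^{(\epsilon)}(t):=d_{\mathrm{TV}}(X^{(\epsilon)}_t,X^{(\epsilon)}_\infty)$. Driftless functional. $\xi^\natural_t:=\xi_t-at$, $I^\natural_t:=\int_0^te^{-(t-s)Q}\mathrm{d}\xi^\natural_s$, $\mu^\natural_t$ is the law of $I^\natural_t$, $\widehat{\mu^\natural}_t$ its characteristic function, and $I^\natural_\infty$ denotes a random vector distributed as the limit in law of $I^\natural_t$ as $t\to\infty$ (which exists under the log-moment condition). Condition (H): for every $t>0$ the function $\widehat{\mu^\natural}_t$ is Lebesgue integrable on $\mathbb{R}^d$, and $$\lim_{R\to\infty}\ \sup_{s>t_0(R)}\int_{\{|\lambda|>R\}}|\widehat{\mu^\natural}_s(\lambda)|\,\mathrm{d}\lambda=0$$ for some positive function $R\mapsto t_0(R)$ with $t_0(R)\to\infty$ as $R\to\infty$. Asymptotic data of $(Q,x_0)$: numbers $\gamma>0$, $\ell,m\in\{1,\dots,d\}$, $\theta_1,\dots,\theta_m\in\mathbb{R}$ and linearly independent vectors $v_1,\dots,v_m\in\mathbb{C}^d$ such that $$\lim_{t\to\infty}\left|\frac{e^{\gamma t}}{t^{\ell-1}}e^{-tQ}x_0-\sum_{k=1}^me^{it\theta_k}v_k\right|=0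 .$$ It is a known fact that such data exist for every $Q\in\mathcal{M}^+(d)$ and $x_0\ne0$, and that $0<\liminf_{t\to\infty}|\sum_ke^{it\theta_k}v_k|\le\limsup_{t\to\infty}|\sum_ke^{it\theta_k}v_k|\le\sum_k|v_k|$. Cut-off. Suppose $t_\epsilon\to\infty$ as $\epsilon\to0$ and $w_\epsilon=o(t_\epsilon)$. The family has window cut-off at $(t_\epsilon,w_\epsilon)$ if $\lim_{c\to-\infty}\liminf_{\epsilon\to0}d^{(\epsilon)}(t_\epsilon+cw_\epsilon)=1$ and $\lim_{c\to\infty}\limsup_{\epsilon\to0}d^{(\epsilon)}(t_\epsilon+cw_\epsilon)=0$. It has profile cut-off at $(t_\epsilon,w_\epsilon)$ with profile function $G$ if $G(c):=\lim_{\epsilon\to0}d^{(\epsilon)}(t_\epsilon+cw_\epsilon)$ exists for all $c\in\mathbb{R}$ and $\lim_{c\to-\infty}G(c)=1$, $\lim_{c\to\infty}G(c)=0$. *)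

theory Defs
  imports "HOL-Probability.Probability" "HOL-Library.Landau_Symbols"
begin

section \<open>Matrices\<close>

definition cvec :: "real ^ 'n \<Rightarrow> complex ^ 'n" where
  "cvec x = (\<chi> i. complex_of_real (x $ i))"

definition cmat :: "real ^ 'n ^ 'm \<Rightarrow> complex ^ 'n ^ 'm" where
  "cmat A = (\<chi> i j. complex_of_real (A $ i $ j))"

definition Mplus :: "(real ^ 'n ^ 'n) set" where
  "Mplus = {Q. \<forall>\<mu> z. z \<noteq> 0 \<and> cmat Q *v z = \<mu> *s z \<longrightarrow> Re \<mu> > 0}"

definition mexp :: "real ^ 'n ^ 'n \<Rightarrow> real ^ 'n ^ 'n" where
  "mexp A = (\<Sum>k. (1 / fact k) *\<^sub>R (((**) A ^^ k) (mat 1)))"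

text \<open>The index set of the family is \<open>{1..m}\<close>; linear independence is that of the family (hence the
  injectivity), over the complex numbers.\<close>

definition asymptotic_data ::
  "real ^ 'n ^ 'n \<Rightarrow> real ^ 'n \<Rightarrow> real \<Rightarrow> nat \<Rightarrow> nat \<Rightarrow> (nat \<Rightarrow> real) \<Rightarrow> (nat \<Rightarrow> complex ^ 'n) \<Rightarrow> bool" where
  "asymptotic_data Q x0 \<gamma> l m \<theta> v \<longleftrightarrow>
     \<gamma> > 0 \<and> l \<in> {1..CARD('n)} \<and> m \<in> {1..CARD('n)} \<and>
     inj_on v {1..m} \<and> vec.independent (v ` {1..m}) \<and>
     ((\<lambda>t. norm ((exp (\<gamma> * t) / t ^ (l - 1)) *\<^sub>R cvec (mexp ((- t) *\<^sub>R Q) *v x0)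
                 - (\<Sum>k = 1..m. exp (\<i> * of_real (t * \<theta> k)) *s v k))) \<longlongrightarrow> 0) at_top"

section \<open>Laws\<close>

definition tv_dist :: "'a::topological_space measure \<Rightarrow> 'a measure \<Rightarrow> real" where
  "tv_dist P P' = (SUP A\<in>sets borel. \<bar>measure P A - measure P' A\<bar>)"

definition cf :: "(real ^ 'n) measure \<Rightarrow> real ^ 'n \<Rightarrow> complex" where
  "cf P z = (\<integral>x. exp (\<i> * of_real (z \<bullet> x)) \<partial>P)"

text \<open>Convergence in law as \<open>t \<rightarrow> \<infinity>\<close>.  The library's \<open>weak_conv_m\<close> only covers laws on the real line.\<close>

definition limit_law :: "(real \<Rightarrow> (real ^ 'n) measure) \<Rightarrow> (real ^ 'n) measure \<Rightarrow> bool" where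
  "limit_law P L \<longleftrightarrow> prob_space L \<and> sets L = sets borel \<and>
     (\<forall>f :: real ^ 'n \<Rightarrow> real. continuous_on UNIV f \<and> bounded (range f) \<longrightarrow>
        ((\<lambda>t. \<integral>x. f x \<partial>P t) \<longlongrightarrow> (\<integral>x. f x \<partial>L)) at_top)"

section \<open>Levy processes\<close>

definition cadlag :: "(real \<Rightarrow> 'a::topological_space) \<Rightarrow> bool" where
  "cadlag f \<longleftrightarrow> (\<forall>t\<ge>0. continuous (at_right t) f) \<and> (\<forall>t>0. \<exists>y. (f \<longlongrightarrow> y) (at_left t))"

text \<open>A measure on the complement of the origin is rendered as a Borel measure that does not
  charge the origin.\<close>

definition levy_measure :: "(real ^ 'n) measure \<Rightarrow> bool" where
  "levy_measure \<nu> \<longleftrightarrow> sets \<nu> = sets borel \<and> emeasure \<nu> {0} = 0 \<and>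
     (\<integral>\<^sup>+x. ennreal (min 1 ((norm x)\<^sup>2)) \<partial>\<nu>) < \<infinity>"

definition levy_triplet ::
  "real ^ 'n \<Rightarrow> real ^ 'n ^ 'n \<Rightarrow> (real ^ 'n) measure \<Rightarrow> bool" where
  "levy_triplet a S \<nu> \<longleftrightarrow> transpose S = S \<and> (\<forall>x. x \<bullet> (S *v x) \<ge> 0) \<and> levy_measure \<nu>"

definition levy_exponent ::
  "real ^ 'n \<Rightarrow> real ^ 'n ^ 'n \<Rightarrow> (real ^ 'n) measure \<Rightarrow> real ^ 'n \<Rightarrow> complex" where
  "levy_exponent a S \<nu> z =
     - of_real (z \<bullet> (S *v z)) / 2 + \<i> * of_real (a \<bullet> z)
     + (\<integral>x. (exp (\<i> * of_real (z \<bullet> x)) - 1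
             - \<i> * of_real (z \<bullet> x) * indicator {x. norm x \<le> 1} x) \<partial>\<nu>)"

definition (in prob_space) levy_process ::
  "(real \<Rightarrow> 'a \<Rightarrow> real ^ 'n) \<Rightarrow> real ^ 'n \<Rightarrow> real ^ 'n ^ 'n \<Rightarrow> (real ^ 'n) measure \<Rightarrow> bool" where
  "levy_process \<xi> a S \<nu> \<longleftrightarrow> levy_triplet a S \<nu> \<and>
     (\<forall>t\<ge>0. random_variable borel (\<xi> t)) \<and>
     (\<forall>\<omega>\<in>space M. cadlag (\<lambda>t. \<xi> t \<omega>)) \<and>
     (AE \<omega> in M. \<xi> 0 \<omega> = 0) \<and>
     (\<forall>s t. 0 \<le> s \<and> s \<le> t \<longrightarrow>
        distr M borel (\<lambda>\<omega>. \<xi> t \<omega> - \<xi> s \<omega>) = distr M borel (\<xi> (t - s))) \<and>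
     (\<forall>(\<tau> :: nat \<Rightarrow> real) n. 0 \<le> \<tau> 0 \<and> mono \<tau> \<longrightarrow>
        indep_vars (\<lambda>_. borel) (\<lambda>k \<omega>. \<xi> (\<tau> (Suc k)) \<omega> - \<xi> (\<tau> k) \<omega>) {..<n}) \<and>
     (\<forall>t\<ge>0. \<forall>z. cf (distr M borel (\<xi> t)) z = exp (of_real t * levy_exponent a S \<nu> z))"

section \<open>The Ornstein-Uhlenbeck process\<close>

text \<open>Since the noise is additive, the equation is a pathwise integral equation with a unique
  solution along every cadlag path of \<open>\<xi>\<close>; adaptedness of the solution is therefore automatic.\<close>

definition (in prob_space) ou_process ::
  "(real \<Rightarrow> 'a \<Rightarrow> real ^ 'n) \<Rightarrow> real ^ 'n ^ 'n \<Rightarrow> real ^ 'n \<Rightarrow> real \<Rightarrow> (real \<Rightarrow> 'a \<Rightarrow> real ^ 'n) \<Rightarrow> bool" where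
  "ou_process \<xi> Q x0 \<epsilon> X \<longleftrightarrow>
     (\<forall>t\<ge>0. random_variable borel (X t)) \<and>
     (AE \<omega> in M. cadlag (\<lambda>t. X t \<omega>) \<and>
        (\<forall>t\<ge>0. X t \<omega> = x0 - integral {0..t} (\<lambda>s. Q *v X s \<omega>) + sqrt \<epsilon> *\<^sub>R \<xi> t \<omega>))"

text \<open>The stochastic integral of a deterministic, continuously differentiable integrand \<open>F\<close> against
  a cadlag semimartingale exists pathwise (\<open>g\<close> is the path), as the limit of the Riemann-Stieltjes sums
  \<open>\<Sum>F(s\<^sub>k)(g(t\<^sub>k\<^sub>+\<^sub>1) - g(t\<^sub>k))\<close> as the mesh tends to \<open>0\<close>.\<close>

definition has_stieltjes_integral ::
  "(real \<Rightarrow> real ^ 'n ^ 'm) \<Rightarrow> (real \<Rightarrow> real ^ 'n) \<Rightarrow> real \<Rightarrow> real \<Rightarrow> real ^ 'm \<Rightarrow> bool" where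
  "has_stieltjes_integral F g u t I \<longleftrightarrow>
     (\<forall>e>0. \<exists>\<delta>>0. \<forall>p. p tagged_division_of {u..t} \<and> (\<lambda>s. ball s \<delta>) fine p \<longrightarrow>
        norm ((\<Sum>(s, K)\<in>p. F s *v (g (Sup K) - g (Inf K))) - I) < e)"

definition stieltjes_integral ::
  "(real \<Rightarrow> real ^ 'n ^ 'm) \<Rightarrow> (real \<Rightarrow> real ^ 'n) \<Rightarrow> real \<Rightarrow> real \<Rightarrow> real ^ 'm" where
  "stieltjes_integral F g u t = (THE I. has_stieltjes_integral F g u t I)"

text \<open>\<open>I\<^sup>\<natural>\<^sub>t\<close>, driven by \<open>\<xi>\<^sup>\<natural>\<^sub>s = \<xi>\<^sub>s - a s\<close>.\<close>

definition I_nat ::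
  "(real \<Rightarrow> 'w \<Rightarrow> real ^ 'n) \<Rightarrow> real ^ 'n \<Rightarrow> real ^ 'n ^ 'n \<Rightarrow> real \<Rightarrow> 'w \<Rightarrow> real ^ 'n" where
  "I_nat \<xi> a Q t \<omega> =
     stieltjes_integral (\<lambda>s. mexp (- (t - s) *\<^sub>R Q)) (\<lambda>s. \<xi> s \<omega> - s *\<^sub>R a) 0 t"

definition condition_H :: "(real \<Rightarrow> (real ^ 'n) measure) \<Rightarrow> bool" where
  "condition_H \<mu> \<longleftrightarrow> (\<forall>t>0. integrable lborel (cf (\<mu> t))) \<and>
     (\<exists>t0 :: real \<Rightarrow> real. (\<forall>R>0. t0 R > 0) \<and> filterlim t0 at_top at_top \<and>
        ((\<lambda>R. SUP s\<in>{t0 R<..}. \<integral>\<^sup>+z\<in>{z. norm z > R}. ennreal (norm (cf (\<mu> s) z)) \<partial>lborel)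
           \<longlongrightarrow> 0) at_top)"

section \<open>Cut-off\<close>

text \<open>\<open>D \<epsilon> t\<close> is the distance to equilibrium of the \<open>\<epsilon>\<close>-th process at time \<open>t\<close>.\<close>

definition cutoff_scale :: "(real \<Rightarrow> real) \<Rightarrow> (real \<Rightarrow> real) \<Rightarrow> bool" where
  "cutoff_scale tc w \<longleftrightarrow> filterlim tc at_top (at_right 0) \<and> w \<in> o[at_right 0](tc)"

definition window_cutoff ::
  "(real \<Rightarrow> real \<Rightarrow> real) \<Rightarrow> (real \<Rightarrow> real) \<Rightarrow> (real \<Rightarrow> real) \<Rightarrow> bool" where
  "window_cutoff D tc w \<longleftrightarrow> cutoff_scale tc w \<and>
     ((\<lambda>c. Liminf (at_right 0) (\<lambda>\<epsilon>. ereal (D \<epsilon> (tc \<epsilon> + c * w \<epsilon>)))) \<longlongrightarrow> 1) at_bot \<and>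
     ((\<lambda>c. Limsup (at_right 0) (\<lambda>\<epsilon>. ereal (D \<epsilon> (tc \<epsilon> + c * w \<epsilon>)))) \<longlongrightarrow> 0) at_top"

definition profile_cutoff ::
  "(real \<Rightarrow> real \<Rightarrow> real) \<Rightarrow> (real \<Rightarrow> real) \<Rightarrow> (real \<Rightarrow> real) \<Rightarrow> (real \<Rightarrow> real) \<Rightarrow> bool" where
  "profile_cutoff D tc w G \<longleftrightarrow> cutoff_scale tc w \<and>
     (\<forall>c. ((\<lambda>\<epsilon>. D \<epsilon> (tc \<epsilon> + c * w \<epsilon>)) \<longlongrightarrow> G c) (at_right 0)) \<and>
     (G \<longlongrightarrow> 1) at_bot \<and> (G \<longlongrightarrow> 0) at_top"

definition t_cut :: "real \<Rightarrow> nat \<Rightarrow> real \<Rightarrow> real" where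
  "t_cut \<gamma> l \<epsilon> = 1 / (2 * \<gamma>) * ln (1 / \<epsilon>) + (real l - 1) / \<gamma> * ln (ln (1 / \<epsilon>))"

text \<open>\<open>v(x\<^sub>0)\<close>.  It is used only when all \<open>\<theta>\<^sub>k\<close> vanish; then \<open>\<Sum>v\<^sub>k\<close> is a limit of real vectors, so
  taking real parts merely turns it into an element of the real vector space.\<close>

definition v_sum :: "nat \<Rightarrow> (nat \<Rightarrow> complex ^ 'n) \<Rightarrow> real ^ 'n" where
  "v_sum m v = (\<chi> i. Re ((\<Sum>k = 1..m. v k) $ i))"

text \<open>Total variation distance between \<open>(2\<gamma>)\<^sup>1\<^sup>-\<^sup>l e\<^sup>-\<^sup>c u + Y\<close> and \<open>Y\<close>, where \<open>Y\<close> has law \<open>L\<close>.\<close>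

definition profile_fun :: "real \<Rightarrow> nat \<Rightarrow> real ^ 'n \<Rightarrow> (real ^ 'n) measure \<Rightarrow> real \<Rightarrow> real" where
  "profile_fun \<gamma> l u L c =
     tv_dist (distr L borel (\<lambda>y. ((2 * \<gamma>) powi (1 - int l) * exp (- c)) *\<^sub>R u + y)) L"

end

theory Submission
  imports Defs
begin

text \<open>
  Pathwise, \<open>X\<^sub>t = e\<^sup>-\<^sup>t\<^sup>Q x\<^sub>0 + \<surd>\<epsilon> (I\<^sub>t + c\<^sub>t)\<close> with a deterministic vector \<open>c\<^sub>t\<close>.  Total variation is
  invariant under affine bijections, so up to an error that depends on \<open>t\<close> only, the distance to
  equilibrium is the distance between the law of \<open>I\<^sub>\<infinity>\<close> and its translate by
  \<open>\<epsilon>\<^sup>-\<^sup>1\<^sup>/\<^sup>2 e\<^sup>-\<^sup>t\<^sup>Q x\<^sub>0\<close>.  The error tends to \<open>0\<close> because condition (H), which only involves the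
  modulus of the characteristic functions and is therefore insensitive to \<open>c\<^sub>t\<close>, makes the Fourier
  inversion densities converge pointwise, hence in \<open>L\<^sup>1\<close> by Scheffe's lemma.  The distance between
  \<open>I\<^sub>\<infinity>\<close> and its translate by \<open>u\<close> is continuous in \<open>u\<close>, vanishes at \<open>0\<close> and tends to \<open>1\<close> at infinity; at
  the time \<open>t\<^sub>\<epsilon> + c w\<^sub>\<epsilon>\<close> the translation vector is asymptotically \<open>(2\<gamma>)\<^sup>1\<^sup>-\<^sup>l e\<^sup>-\<^sup>c\<close> times
  \<open>\<Sum>\<^sub>k exp (i t \<theta>\<^sub>k) v\<^sub>k\<close>, which is bounded and bounded away from \<open>0\<close>.
\<close>

section \<open>Gaussian kernels on Euclidean space\<close>

text \<open>The cut-off scale is forced by one identity. With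
  \<open>T = t_cut \<gamma> l \<epsilon> + c * w \<epsilon>\<close> and
  \<open>L = ln (1 / \<epsilon>)\<close>, the quantity
  \<open>exp (- (\<gamma> * T)) / sqrt \<epsilon>\<close> equals
  \<open>exp (- (c * \<gamma> * w \<epsilon>)) / L ^ (l - 1)\<close>. Since \<open>T / L\<close>
  tends to \<open>1 / (2 * \<gamma>)\<close>, the double logarithm compensates the polynomial factor
  \<open>T ^ (l - 1)\<close> up to \<open>(2 * \<gamma>) powi (1 - int l)\<close>. The amplitude
  stays away from 0 because \<open>v 1\<close> has positive distance from the complex span of the
  other \<open>v k\<close>, whatever the phases are. Two obstacles shape the rest. A law need not
  have a density, so laws are convolved with Gaussian kernels, for which Fourier inversion converges
  absolutely, and the width is sent to 0; this yields uniqueness as well as inversion. A Levy path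
  may have infinite variation, so the Stieltjes sums are controlled by parts: all differentiation
  falls on the smooth kernel, and away from finitely many points a cadlag path oscillates little on
  short intervals. The laws \<open>Xinf \<epsilon>\<close> are given separately for each
  \<open>\<epsilon>\<close>; uniqueness shows that they are rescalings of
  \<open>Xinf 1\<close>.\<close>

lemma gaussian_fourier_real:
  fixes w s :: real
  assumes s: "s > 0"
  shows "integrable lborel (\<lambda>z. exp (- \<i> * of_real (z * w)) * of_real (exp (- (s * z)\<^sup>2 / 2)) :: complex)" (is ?A)
    and "(\<integral>z. exp (- \<i> * of_real (z * w)) * of_real (exp (- (s * z)\<^sup>2 / 2)) \<partial>lborel)
           = of_real (2 * pi * normal_density 0 s w)" (is ?B)
proof -
  \<comment> \<open>The integral of \<open>?f\<close> is the standard normal characteristic function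
    at \<open>- w / s\<close>; after the substitution \<open>x = s * z\<close> the phase becomes
    \<open>- z * w\<close>, as wanted.\<close>
  let ?f = "\<lambda>x. std_normal_density x *\<^sub>R exp (\<i> * of_real ((- w / s) * x))"
  have int: "integrable lborel ?f"
    by (rule Bochner_Integration.integrable_bound[OF integrable_normal_density[of 1 0]]) auto
  have eq: "?f (0 + s * z) = of_real (1 / sqrt (2 * pi)) *
      (exp (- \<i> * of_real (z * w)) * of_real (exp (- (s * z)\<^sup>2 / 2)))" for z
    using s by (simp add: std_normal_density_def scaleR_conv_of_real mult_ac)
  have "integrable lborel (\<lambda>z. ?f (0 + s * z))"
    using lborel_integrable_real_affine[OF int, of s 0] s by simp
  moreover have "exp (- \<i> * of_real (z * w)) * of_real (exp (- (s * z)\<^sup>2 / 2)) =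
      of_real (sqrt (2 * pi)) * ?f (0 + s * z)" for z
    unfolding eq by simp
  ultimately show ?A
    by (simp only: integrable_mult_right)
  have "of_real (exp (- (w / s)\<^sup>2 / 2)) = integral\<^sup>L lborel ?f"
    using fun_cong[OF char_std_normal_distribution, of "- w / s"]
    unfolding char_def by (subst (asm) integral_density) (auto simp: power_divide)
  also have "\<dots> = \<bar>s\<bar> *\<^sub>R (\<integral>z. ?f (0 + s * z) \<partial>lborel)"
    using s by (intro lborel_integral_real_affine) auto
  also have "\<dots> = of_real (s / sqrt (2 * pi)) *
      (\<integral>z. exp (- \<i> * of_real (z * w)) * of_real (exp (- (s * z)\<^sup>2 / 2)) \<partial>lborel)"
    unfolding eq using s by (simp add: scaleR_conv_of_real)
  finally have "(\<integral>z. exp (- \<i> * of_real (z * w)) * of_real (exp (- (s * z)\<^sup>2 / 2)) \<partial>lborel)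
     = of_real (exp (- (w / s)\<^sup>2 / 2) * (sqrt (2 * pi) / s))"
    using s by (simp add: field_simps)
  also have "exp (- (w / s)\<^sup>2 / 2) * (sqrt (2 * pi) / s) = 2 * pi * normal_density 0 s w"
    using s by (simp add: normal_density_def real_sqrt_mult power_divide field_simps)
  finally show ?B .
qed

text \<open>Lebesgue measure is the image of the product of one-dimensional Lebesgue measures under
  the coordinate map, so this is Fubini; it lifts the one-dimensional Fourier integral to any
  dimension.\<close>

lemma lborel_integral_prod_Basis:
  fixes f :: "'a::euclidean_space \<Rightarrow> real \<Rightarrow> complex"
  assumes int: "\<And>b. b \<in> Basis \<Longrightarrow> integrable lborel (f b)"
  shows "integrable lborel (\<lambda>x::'a. \<Prod>b\<in>Basis. f b (x \<bullet> b))"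
    and "(\<integral>x. (\<Prod>b\<in>Basis. f b (x \<bullet> b)) \<partial>(lborel :: 'a measure)) = (\<Prod>b\<in>Basis. integral\<^sup>L lborel (f b))"
proof -
  interpret product_sigma_finite "\<lambda>b::'a. lborel :: real measure" by standard
  have [measurable]: "f b \<in> borel_measurable borel" if "b \<in> Basis" for b
    using int[OF that] by auto
  have eq: "(\<Prod>b\<in>Basis. f b ((\<Sum>c\<in>Basis. x c *\<^sub>R c) \<bullet> b)) = (\<Prod>b\<in>Basis. f b (x b))" for x :: "'a \<Rightarrow> real"
    by (intro prod.cong) auto
  show "integrable lborel (\<lambda>x::'a. \<Prod>b\<in>Basis. f b (x \<bullet> b))"
    by (subst lborel_eq, subst integrable_distr_eq)
       (auto simp: eq intro!: product_integrable_prod int)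
  show "(\<integral>x. (\<Prod>b\<in>Basis. f b (x \<bullet> b)) \<partial>(lborel :: 'a measure)) = (\<Prod>b\<in>Basis. integral\<^sup>L lborel (f b))"
    by (subst lborel_eq, subst integral_distr)
       (auto simp: eq intro!: product_integral_prod int)
qed

text \<open>The centred Gaussian density with covariance \<open>s ^ 2\<close> times the identity,
  kept as a product so that its integrals split over the coordinates.\<close>

definition gauss_density :: "real \<Rightarrow> 'a::euclidean_space \<Rightarrow> real" where
  "gauss_density s x = (\<Prod>b\<in>Basis. normal_density 0 s (x \<bullet> b))"

lemma gauss_density_nonneg [simp]: "gauss_density s x \<ge> 0"
  by (simp add: gauss_density_def prod_nonneg)

lemma measurable_gauss_density [measurable]: "gauss_density s \<in> borel_measurable borel"
  unfolding gauss_density_def by measurable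

lemma nn_integral_gauss_density:
  assumes "s > 0"
  shows "(\<integral>\<^sup>+x. ennreal (gauss_density s x) \<partial>(lborel :: 'a::euclidean_space measure)) = 1"
proof -
  have "(\<integral>\<^sup>+x. ennreal (normal_density 0 s x) \<partial>lborel) = 1"
    using prob_space.emeasure_space_1[OF prob_space_normal_density[OF assms, of 0]]
    by (subst (asm) emeasure_density) auto
  then show ?thesis
    using nn_integral_lborel_prod[where 'a='a and f="\<lambda>_ x. ennreal (normal_density 0 s x)"]
    by (simp add: gauss_density_def prod_ennreal)
qed

lemma gauss_exp_prod:
  fixes z :: "'a::euclidean_space"
  shows "exp (- (s * norm z)\<^sup>2 / 2) = (\<Prod>b\<in>Basis. exp (- (s * (z \<bullet> b))\<^sup>2 / 2))"
proof -
  have "(norm z)\<^sup>2 = (\<Sum>b\<in>Basis. (z \<bullet> b)\<^sup>2)"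
    by (subst power2_norm_eq_inner, subst euclidean_inner) (simp add: power2_eq_square)
  then show ?thesis
    by (simp add: power_mult_distrib sum_distrib_left sum_negf sum_divide_distrib flip: exp_sum)
qed

lemma gaussian_fourier:
  fixes w :: "'a::euclidean_space" and s :: real
  assumes s: "s > 0"
  shows "integrable lborel (\<lambda>z::'a. exp (- \<i> * of_real (z \<bullet> w)) * of_real (exp (- (s * norm z)\<^sup>2 / 2)) :: complex)" (is ?A)
    and "(\<integral>z. exp (- \<i> * of_real (z \<bullet> w)) * of_real (exp (- (s * norm z)\<^sup>2 / 2)) \<partial>(lborel :: 'a measure))
           = of_real ((2 * pi) ^ DIM('a) * gauss_density s w)" (is ?B)
proof -
  have eq: "exp (- \<i> * of_real (z \<bullet> w)) * of_real (exp (- (s * norm z)\<^sup>2 / 2)) =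
    (\<Prod>b\<in>Basis. exp (- \<i> * of_real ((z \<bullet> b) * (w \<bullet> b))) * of_real (exp (- (s * (z \<bullet> b))\<^sup>2 / 2)) :: complex)" for z
  proof -
    have "- \<i> * of_real (z \<bullet> w) = (\<Sum>b\<in>Basis. - \<i> * of_real ((z \<bullet> b) * (w \<bullet> b)))"
      by (simp add: euclidean_inner[of z w] sum_distrib_left sum_negf)
    then show ?thesis
      unfolding gauss_exp_prod by (simp add: prod.distrib exp_sum of_real_prod del: of_real_exp)
  qed
  show ?A unfolding eq
    by (rule lborel_integral_prod_Basis(1)[where f="\<lambda>b z. exp (- \<i> * of_real (z * (w \<bullet> b))) * of_real (exp (- (s * z)\<^sup>2 / 2))"])
       (rule gaussian_fourier_real[OF s])
  show ?B unfolding eq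
    by (subst lborel_integral_prod_Basis(2)[where f="\<lambda>b z. exp (- \<i> * of_real (z * (w \<bullet> b))) * of_real (exp (- (s * z)\<^sup>2 / 2))"])
       (simp_all only: gaussian_fourier_real[OF s], simp add: prod.distrib gauss_density_def)
qed

text \<open>The norm is at most the sum of the absolute coordinates. Each of them contributes the
  one-dimensional absolute moment \<open>s * sqrt (2 / pi)\<close>, the other coordinates
  integrating to 1. Only the linear order in \<open>s\<close> matters later.\<close>

lemma nn_integral_norm_gauss_density:
  assumes s: "s > 0"
  shows "(\<integral>\<^sup>+x. ennreal (norm x * gauss_density s x) \<partial>(lborel :: 'a::euclidean_space measure))
           \<le> ennreal (DIM('a) * (s * sqrt (2 / pi)))"
proof -
  have 1: "(\<integral>\<^sup>+x. ennreal (normal_density 0 s x) \<partial>lborel) = 1"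
    using prob_space.emeasure_space_1[OF prob_space_normal_density[OF s, of 0]]
    by (subst (asm) emeasure_density) auto
  have 2: "(\<integral>\<^sup>+x. ennreal (\<bar>x\<bar> * normal_density 0 s x) \<partial>lborel) = ennreal (s * sqrt (2 / pi))"
  proof -
    have "has_bochner_integral lborel (\<lambda>x. \<bar>x\<bar> * normal_density 0 s x) (s * sqrt (2 / pi))"
      by (rule has_bochner_integral_cong[THEN iffD1, OF refl _ _ normal_moment_abs_odd[of s 0 0]])
         (use s in \<open>auto simp: mult.commute\<close>)
    then show ?thesis
      by (subst nn_integral_eq_integral) (auto simp: has_bochner_integral_iff)
  qed
  have 3: "(\<integral>\<^sup>+x. ennreal (\<bar>x \<bullet> c\<bar> * gauss_density s x) \<partial>(lborel :: 'a measure)) = ennreal (s * sqrt (2 / pi))"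
    if c: "c \<in> Basis" for c
  proof -
    have "\<bar>x \<bullet> c\<bar> * gauss_density s x = (\<Prod>b\<in>Basis. (if b = c then \<bar>x \<bullet> b\<bar> else 1) * normal_density 0 s (x \<bullet> b))" for x
      using c by (simp add: gauss_density_def prod.distrib)
    then have "ennreal (\<bar>x \<bullet> c\<bar> * gauss_density s x) = (\<Prod>b\<in>Basis. ennreal ((if b = c then \<bar>x \<bullet> b\<bar> else 1) * normal_density 0 s (x \<bullet> b)))" for x
      by (simp add: prod_ennreal)
    then have "(\<integral>\<^sup>+x. ennreal (\<bar>x \<bullet> c\<bar> * gauss_density s x) \<partial>(lborel :: 'a measure)) =
       (\<Prod>b\<in>Basis. (\<integral>\<^sup>+x. ennreal ((if b = c then \<bar>x\<bar> else 1) * normal_density 0 s x) \<partial>lborel))"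
      using nn_integral_lborel_prod[where 'a='a and f="\<lambda>b x. ennreal ((if b = c then \<bar>x\<bar> else 1) * normal_density 0 s x)"]
      by simp
    also have "\<dots> = (\<Prod>b\<in>Basis. (if b = c then ennreal (s * sqrt (2 / pi)) else 1))"
      by (intro prod.cong) (auto simp: 1 2)
    also have "\<dots> = ennreal (s * sqrt (2 / pi))" using c by simp
    finally show ?thesis .
  qed
  have "(\<integral>\<^sup>+x. ennreal (norm x * gauss_density s x) \<partial>(lborel :: 'a measure))
      \<le> (\<integral>\<^sup>+x. (\<Sum>c\<in>Basis. ennreal (\<bar>x \<bullet> c\<bar> * gauss_density s x)) \<partial>(lborel :: 'a measure))"
    by (intro nn_integral_mono) (auto simp: sum_ennreal simp flip: sum_distrib_right
        intro!: ennreal_leI mult_right_mono norm_le_l1)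
  also have "\<dots> = (\<Sum>c\<in>(Basis::'a set). ennreal (s * sqrt (2 / pi)))"
    by (subst nn_integral_sum) (auto simp: 3)
  finally show ?thesis using s by (simp add: ennreal_mult ennreal_of_nat_eq_real_of_nat)
qed

section \<open>Characteristic functions determine laws\<close>

lemma integrable_gauss_density:
  assumes "s > 0"
  shows "integrable lborel (gauss_density s :: 'a::euclidean_space \<Rightarrow> real)"
    and "(\<integral>x. gauss_density s x \<partial>(lborel :: 'a measure)) = 1"
  using nn_integral_gauss_density[OF assms, where 'a='a]
  by (auto simp: integrable_iff_bounded integral_eq_nn_integral)

section \<open>Integrals under translation and under limits\<close>

lemma lborel_integral_translate:
  fixes f :: "'a::euclidean_space \<Rightarrow> 'b::{banach, second_countable_topology}"
  assumes [measurable]: "f \<in> borel_measurable borel"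
  shows "(\<integral>x. f (c + x) \<partial>lborel) = integral\<^sup>L lborel f"
    and "integrable lborel (\<lambda>x. f (c + x)) \<longleftrightarrow> integrable lborel f"
  using integral_distr[of "(+) c" lborel borel f] integrable_distr_eq[of "(+) c" lborel borel f]
  by (simp_all add: lborel_distr_plus)

lemma integrable_prob_borel:
  fixes f :: "'a::euclidean_space \<Rightarrow> 'b::{banach, second_countable_topology}"
  assumes "prob_space P" "sets P = sets borel" "f \<in> borel_measurable borel" "\<And>x. norm (f x) \<le> B"
  shows "integrable P f"
proof -
  interpret prob_space P by fact
  show ?thesis
    using assms measurable_cong_sets[OF assms(2) refl] by (intro integrable_const_bound[of _ B]) auto
qed

lemma continuous_on_integral_dominated:
  fixes f :: "'a::metric_space \<Rightarrow> 'c \<Rightarrow> 'b::{banach, second_countable_topology}"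
  assumes "\<And>x. f x \<in> borel_measurable M" "\<And>y. continuous_on UNIV (\<lambda>x. f x y)"
    and "integrable M w" "\<And>x y. norm (f x y) \<le> w y"
  shows "continuous_on UNIV (\<lambda>x. \<integral>y. f x y \<partial>M)"
  unfolding continuous_on_sequentially o_def
proof safe
  fix u :: "nat \<Rightarrow> 'a" and a assume "u \<longlonglongrightarrow> a"
  then have "(\<lambda>n. f (u n) y) \<longlonglongrightarrow> f a y" for y
    using assms(2)[of y] by (auto simp: continuous_on_sequentially o_def)
  then show "(\<lambda>n. \<integral>y. f (u n) y \<partial>M) \<longlonglongrightarrow> (\<integral>y. f a y \<partial>M)"
    using assms by (intro integral_dominated_convergence[where w=w]) auto
qed

lemma continuous_on_cf:
  fixes P :: "(real ^ 'n) measure"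
  assumes "prob_space P" "sets P = sets borel"
  shows "continuous_on UNIV (cf P)"
proof -
  interpret prob_space P by fact
  note [measurable_cong] = assms(2)
  show ?thesis
    unfolding cf_def
    by (rule continuous_on_integral_dominated[where w="\<lambda>_. 1"]) (auto intro!: continuous_intros)
qed

lemma norm_cf_le_1:
  fixes P :: "(real ^ 'n) measure"
  assumes "prob_space P"
  shows "norm (cf P z) \<le> 1"
proof -
  interpret prob_space P by fact
  have "norm (cf P z) \<le> (\<integral>x. norm (exp (\<i> * of_real (z \<bullet> x))) \<partial>P)"
    unfolding cf_def by (rule integral_norm_bound)
  then show ?thesis by (simp add: prob_space)
qed

text \<open>The right-hand integral is the density of \<open>P\<close> convolved with a Gaussian of
  width \<open>s\<close>. The Gaussian damping on the left makes the inversion integral absolutely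
  convergent for every law, so Fubini applies and \<open>gaussian_fourier\<close> evaluates the
  inner integral.\<close>

lemma smoothing_inversion:
  fixes P :: "(real ^ 'n) measure"
  assumes P: "prob_space P" "sets P = sets borel" and s: "s > 0"
  shows "(\<integral>z. exp (- \<i> * of_real (z \<bullet> x)) * of_real (exp (- (s * norm z)\<^sup>2 / 2)) * cf P z \<partial>lborel)
       = of_real ((2 * pi) ^ CARD('n) * (\<integral>y. gauss_density s (x - y) \<partial>P))"
proof -
  interpret P: prob_space P by fact
  interpret pair_sigma_finite P "lborel :: (real ^ 'n) measure" ..
  note [measurable_cong] = assms(2)
  let ?f = "\<lambda>y z :: real ^ 'n. exp (- \<i> * of_real (z \<bullet> (x - y))) * of_real (exp (- (s * norm z)\<^sup>2 / 2)) :: complex"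
  have nf: "norm (?f y z) = exp (- (s * norm z)\<^sup>2 / 2)" for y z
    by (simp add: norm_mult)
  \<comment> \<open>The modulus of the integrand does not depend on \<open>y\<close>, so the outer
    integral is that of a constant against a probability measure.\<close>
  have int: "integrable (P \<Otimes>\<^sub>M lborel) (case_prod ?f)"
  proof (rule Fubini_integrable)
    show "integrable P (\<lambda>y. \<integral>z. norm (case_prod ?f (y, z)) \<partial>lborel)"
      unfolding prod.case nf by (rule P.integrable_const)
    show "AE y in P. integrable lborel (\<lambda>z. case_prod ?f (y, z))"
      unfolding prod.case by (intro AE_I2 gaussian_fourier(1)[OF s])
  qed measurable
  have "exp (- \<i> * of_real (z \<bullet> x)) * of_real (exp (- (s * norm z)\<^sup>2 / 2)) * cf P z = (\<integral>y. ?f y z \<partial>P)" for z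
  proof -
    have "(\<integral>y. ?f y z \<partial>P) = (\<integral>y. exp (- \<i> * of_real (z \<bullet> x)) * of_real (exp (- (s * norm z)\<^sup>2 / 2)) * exp (\<i> * of_real (z \<bullet> y)) \<partial>P)"
    proof (intro Bochner_Integration.integral_cong refl)
      fix y
      have "- \<i> * of_real (z \<bullet> (x - y)) = - \<i> * of_real (z \<bullet> x) + \<i> * of_real (z \<bullet> y)"
        by (simp add: inner_diff_right right_diff_distrib)
      then show "?f y z = exp (- \<i> * of_real (z \<bullet> x)) * of_real (exp (- (s * norm z)\<^sup>2 / 2)) * exp (\<i> * of_real (z \<bullet> y))"
        by (simp only: exp_add mult_ac)
    qed
    then show ?thesis unfolding cf_def by simp
  qed
  then have "(\<integral>z. exp (- \<i> * of_real (z \<bullet> x)) * of_real (exp (- (s * norm z)\<^sup>2 / 2)) * cf P z \<partial>lborel)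
     = (\<integral>z. (\<integral>y. ?f y z \<partial>P) \<partial>lborel)" by (simp only:)
  also have "\<dots> = (\<integral>y. (\<integral>z. ?f y z \<partial>lborel) \<partial>P)"
    by (rule Fubini_integral[OF int])
  also have "\<dots> = (\<integral>y. of_real ((2 * pi) ^ CARD('n) * gauss_density s (x - y)) \<partial>P)"
    by (simp only: gaussian_fourier(2)[OF s] DIM_cart DIM_real mult_1_right)
  also have "\<dots> = of_real ((2 * pi) ^ CARD('n) * (\<integral>y. gauss_density s (x - y) \<partial>P))"
    by (simp only: integral_complex_of_real integral_mult_right_zero)
  finally show ?thesis .
qed

text \<open>After Fubini and a translation, smoothing replaces \<open>g y\<close> by the Gaussian
  average of \<open>g (y + u)\<close>. The Lipschitz bound then reduces the error to
  \<open>k\<close> times the first absolute moment of the kernel.\<close>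

lemma smoothing_error:
  fixes P :: "'a::euclidean_space measure" and g :: "'a \<Rightarrow> real"
  assumes P: "prob_space P" "sets P = sets borel" and s: "s > 0"
    and [measurable]: "g \<in> borel_measurable borel" and g1: "\<And>x. \<bar>g x\<bar> \<le> 1"
    and lip: "\<And>x y. \<bar>g x - g y\<bar> \<le> k * norm (x - y)" and k: "k \<ge> 0"
  shows "\<bar>(\<integral>x. g x * (\<integral>y. gauss_density s (x - y) \<partial>P) \<partial>lborel) - (\<integral>x. g x \<partial>P)\<bar>
           \<le> k * (DIM('a) * (s * sqrt (2 / pi)))"
proof -
  interpret P: prob_space P by fact
  interpret pair_sigma_finite P "lborel :: 'a measure" ..
  note [measurable_cong] = assms(2)
  let ?C = "DIM('a) * (s * sqrt (2 / pi))"
  have tr: "(\<integral>x. f x * gauss_density s (x - y) \<partial>lborel) = (\<integral>u. f (y + u) * gauss_density s u \<partial>lborel)"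
    "integrable lborel (\<lambda>x. f x * gauss_density s (x - y)) \<longleftrightarrow> integrable lborel (\<lambda>u. f (y + u) * gauss_density s u)"
    if [measurable]: "f \<in> borel_measurable borel" for f :: "'a \<Rightarrow> real" and y
    using lborel_integral_translate[of "\<lambda>x. f x * gauss_density s (x - y)" y] by simp_all
  have gi: "integrable lborel (\<lambda>u. g (y + u) * gauss_density s u)" for y
    by (rule Bochner_Integration.integrable_bound[OF integrable_gauss_density(1)[OF s]])
       (auto simp: abs_mult g1 mult_left_le_one_le)
  have "(\<integral>x. \<bar>g x\<bar> * gauss_density s (x - y) \<partial>lborel) \<le> 1" for y
  proof -
    have "(\<integral>x. \<bar>g (y + x)\<bar> * gauss_density s x \<partial>lborel) \<le> (\<integral>x. gauss_density s x \<partial>(lborel :: 'a measure))"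
      using gi[of y, THEN integrable_norm]
      by (intro integral_mono integrable_gauss_density s) (auto simp: abs_mult g1 mult_left_le_one_le)
    then show ?thesis by (subst tr) (auto simp: integrable_gauss_density s)
  qed
  then have int: "integrable (P \<Otimes>\<^sub>M lborel) (\<lambda>(y, x). g x * gauss_density s (x - y))"
    by (intro Fubini_integrable P.integrable_const_bound[where B=1])
       (auto simp: abs_mult tr gi intro!: AE_I2)
  have "(\<integral>x. g x * (\<integral>y. gauss_density s (x - y) \<partial>P) \<partial>lborel)
      = (\<integral>x. (\<integral>y. g x * gauss_density s (x - y) \<partial>P) \<partial>lborel)" by simp
  also have "\<dots> = (\<integral>y. (\<integral>x. g x * gauss_density s (x - y) \<partial>lborel) \<partial>P)"
    by (rule Fubini_integral[OF int])
  also have "\<dots> = (\<integral>y. (\<integral>u. g (y + u) * gauss_density s u \<partial>lborel) \<partial>P)"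
    by (simp add: tr)
  finally have eq: "(\<integral>x. g x * (\<integral>y. gauss_density s (x - y) \<partial>P) \<partial>lborel)
      = (\<integral>y. (\<integral>u. g (y + u) * gauss_density s u \<partial>lborel) \<partial>P)" .
  have nint: "integrable lborel (\<lambda>u::'a. norm u * gauss_density s u)"
    using nn_integral_norm_gauss_density[OF s, where 'a='a]
    by (auto simp: integrable_iff_bounded abs_mult less_top[symmetric] top_unique)
  have nle: "(\<integral>u. norm (u::'a) * gauss_density s u \<partial>lborel) \<le> ?C"
    using nn_integral_norm_gauss_density[OF s, where 'a='a] s
    by (subst integral_eq_nn_integral) (auto intro!: enn2real_leI)
  have diff: "\<bar>(\<integral>u. g (y + u) * gauss_density s u \<partial>lborel) - g y\<bar> \<le> k * ?C" for y
  proof -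
    have "(\<integral>u. g (y + u) * gauss_density s u \<partial>lborel) - g y
       = (\<integral>u. g (y + u) * gauss_density s u - g y * gauss_density s u \<partial>lborel)"
      using gi integrable_gauss_density[OF s, where 'a='a] by (subst Bochner_Integration.integral_diff) auto
    also have "\<bar>\<dots>\<bar> \<le> (\<integral>u. \<bar>g (y + u) * gauss_density s u - g y * gauss_density s u\<bar> \<partial>lborel)"
      by (rule integral_abs_bound)
    also have "\<dots> \<le> (\<integral>u. k * (norm u * gauss_density s u) \<partial>(lborel :: 'a measure))"
    proof (rule integral_mono)
      fix u
      have "\<bar>(g (y + u) - g y) * gauss_density s u\<bar> \<le> k * norm u * gauss_density s u"
        using lip[of "y + u" y] by (simp add: abs_mult mult_right_mono)
      then show "\<bar>g (y + u) * gauss_density s u - g y * gauss_density s u\<bar> \<le> k * (norm u * gauss_density s u)"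
        by (simp add: left_diff_distrib mult.assoc)
    qed (intro integrable_abs Bochner_Integration.integrable_diff integrable_mult_right gi
          integrable_gauss_density(1)[OF s] nint)+
    also have "\<dots> \<le> k * ?C"
      unfolding integral_mult_right_zero by (rule mult_left_mono[OF nle k])
    finally show ?thesis .
  qed
  have gP: "integrable P g" by (rule integrable_prob_borel[OF P assms(4), of 1]) (simp add: g1)
  have GP: "integrable P (\<lambda>y. \<integral>u. g (y + u) * gauss_density s u \<partial>lborel)"
    using integrable_fst[OF int] by (simp only: prod.case tr(1)[OF assms(4)])
  have "\<bar>(\<integral>y. (\<integral>u. g (y + u) * gauss_density s u \<partial>lborel) \<partial>P) - (\<integral>y. g y \<partial>P)\<bar>
      = \<bar>\<integral>y. (\<integral>u. g (y + u) * gauss_density s u \<partial>lborel) - g y \<partial>P\<bar>"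
    by (simp only: Bochner_Integration.integral_diff[OF GP gP])
  also have "\<dots> \<le> (\<integral>y. \<bar>(\<integral>u. g (y + u) * gauss_density s u \<partial>lborel) - g y\<bar> \<partial>P)"
    by (rule integral_abs_bound)
  also have "\<dots> \<le> (\<integral>y. k * ?C \<partial>P)"
    by (intro integral_mono integrable_abs Bochner_Integration.integrable_diff GP gP P.integrable_const diff)
  also have "\<dots> = k * ?C" by (simp only: lebesgue_integral_const P.prob_space scaleR_one)
  finally show ?thesis unfolding eq .
qed

text \<open>Compact sets are stable under intersection and generate the Borel sets, and balls
  exhaust the space with finite mass. Compact sets are preferred to closed ones because the test
  functions built on them have bounded support, which gives a dominating function in
  \<open>inv_density\<close>.\<close>

lemma measure_eqI_compact:
  fixes P N :: "'a::euclidean_space measure"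
  assumes "finite_measure P" "sets P = sets borel" "sets N = sets borel"
    and eq: "\<And>C. compact C \<Longrightarrow> emeasure P C = emeasure N C"
  shows "P = N"
proof (rule measure_eqI_generator_eq[where \<Omega>=UNIV and E="Collect compact" and A="\<lambda>i. cball 0 (real i)"])
  interpret finite_measure P by fact
  have "sigma_sets UNIV (Collect closed) \<subseteq> sigma_sets UNIV (Collect (compact :: 'a set \<Rightarrow> bool))"
  proof (rule sigma_sets_mono, safe)
    fix C :: "'a set" assume C: "closed C"
    have "C = (\<Union>i. C \<inter> cball 0 (real i))"
      using real_arch_simple by auto
    also have "\<dots> \<in> sigma_sets UNIV (Collect compact)"
      using C by (intro sigma_sets.Union sigma_sets.Basic) (auto simp: closed_Int_compact)
    finally show "C \<in> sigma_sets UNIV (Collect compact)" .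
  qed
  moreover have "sigma_sets UNIV (Collect (compact :: 'a set \<Rightarrow> bool)) \<subseteq> sigma_sets UNIV (Collect closed)"
    by (rule sigma_sets_mono') (auto simp: compact_imp_closed)
  ultimately have "sets (borel :: 'a measure) = sigma_sets UNIV (Collect compact)"
    by (simp add: borel_eq_closed)
  then show "sets P = sigma_sets UNIV (Collect compact)" "sets N = sigma_sets UNIV (Collect compact)"
    by (simp_all add: assms)
  show "(\<Union>i. cball (0::'a) (real i)) = UNIV" using real_arch_simple by auto
qed (auto simp: Int_stable_def compact_Int assms(2,3) simp flip: eq simp: finite_measure.emeasure_finite[OF assms(1)])

text \<open>A Lipschitz upper approximation of the indicator of \<open>C\<close>, falling linearly
  to 0 at distance \<open>1 / k\<close>. For \<open>k = 0\<close>, and also for empty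
  \<open>C\<close> where \<open>infdist\<close> is 0, it is constantly 1; hence the index
  \<open>Suc k\<close> and the condition \<open>C \<noteq> {}\<close> in the limits below.\<close>

definition bump :: "'a::metric_space set \<Rightarrow> nat \<Rightarrow> 'a \<Rightarrow> real" where
  "bump C k x = max 0 (1 - real k * infdist x C)"

lemma bump_lipschitz: "\<bar>bump C k x - bump C k y\<bar> \<le> real k * dist x y"
proof -
  have "\<bar>infdist x C - infdist y C\<bar> \<le> dist x y"
    using infdist_triangle[of x C y] infdist_triangle[of y C x] by (simp add: dist_commute)
  then have "real k * \<bar>infdist x C - infdist y C\<bar> \<le> real k * dist x y"
    by (intro mult_left_mono) auto
  moreover have "\<bar>bump C k x - bump C k y\<bar> \<le> \<bar>real k * infdist x C - real k * infdist y C\<bar>"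
    unfolding bump_def by linarith
  ultimately show ?thesis by (simp add: abs_mult flip: right_diff_distrib)
qed

lemma bump_bounds: "0 \<le> bump C k x" "bump C k x \<le> 1"
  by (auto simp: bump_def infdist_nonneg)

lemma measurable_bump [measurable]: "bump C k \<in> borel_measurable borel"
  unfolding bump_def by (intro borel_measurable_continuous_onI continuous_intros)

lemma bump_tendsto:
  assumes "closed C" "C \<noteq> {}"
  shows "(\<lambda>k. bump C (Suc k) x) \<longlonglongrightarrow> indicator C x"
proof (cases "x \<in> C")
  case True
  then show ?thesis by (simp add: bump_def)
next
  case False
  then have pos: "infdist x C > 0"
    using assms infdist_nonneg[of x C] in_closed_iff_infdist_zero[of C x] by (auto simp: less_le)
  obtain K where K: "1 / infdist x C < real K" using reals_Archimedean2 by blast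
  have "bump C (Suc k) x = 0" if "k \<ge> K" for k
  proof -
    have "1 / infdist x C \<le> real (Suc k)" using K that by linarith
    then show ?thesis using pos by (simp add: bump_def field_simps)
  qed
  then show ?thesis using False
    by (auto intro!: tendsto_eventually eventually_sequentiallyI[of K])
qed


lemma bump_integral_tendsto:
  assumes P: "prob_space P" "sets P = sets borel" and C: "closed C" "C \<noteq> {}"
  shows "(\<lambda>k. \<integral>x. bump C (Suc k) x \<partial>P) \<longlonglongrightarrow> measure P C"
proof -
  interpret prob_space P by fact
  note [measurable_cong] = P(2)
  have "(\<lambda>k. \<integral>x. bump C (Suc k) x \<partial>P) \<longlonglongrightarrow> (\<integral>x. indicator C x \<partial>P)"
    using bump_bounds[of C] borel_closed[OF C(1)] bump_tendsto[OF C]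
    by (intro integral_dominated_convergence[where w="\<lambda>_. 1"]) auto
  then show ?thesis using sets_eq_imp_space_eq[OF P(2)] by simp
qed

lemma smoothing_tendsto:
  fixes P :: "'a::euclidean_space measure"
  assumes P: "prob_space P" "sets P = sets borel"
  shows "(\<lambda>j. \<integral>x. bump C k x * (\<integral>y. gauss_density (1 / Suc j) (x - y) \<partial>P) \<partial>lborel)
           \<longlonglongrightarrow> (\<integral>x. bump C k x \<partial>P)"
proof (rule LIM_zero_cancel, rule tendsto_0_le[where K=1])
  have "(\<lambda>j. real k * (DIM('a) * (1 / Suc j * sqrt (2 / pi)))) \<longlonglongrightarrow> real k * (DIM('a) * (0 * sqrt (2 / pi)))"
    using LIMSEQ_inverse_real_of_nat by (intro tendsto_intros) (simp add: inverse_eq_divide)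
  then show "(\<lambda>j. real k * (DIM('a) * (1 / Suc j * sqrt (2 / pi)))) \<longlonglongrightarrow> 0" by simp
next
  show "\<forall>\<^sub>F j in sequentially.
       norm ((\<integral>x. bump C k x * (\<integral>y. gauss_density (1 / Suc j) (x - y) \<partial>P) \<partial>lborel) - (\<integral>x. bump C k x \<partial>P))
       \<le> norm (real k * (DIM('a) * (1 / Suc j * sqrt (2 / pi)))) * 1"
  proof (intro always_eventually allI)
    fix j
    have "\<bar>(\<integral>x. bump C k x * (\<integral>y. gauss_density (1 / Suc j) (x - y) \<partial>P) \<partial>lborel) - (\<integral>x. bump C k x \<partial>P)\<bar>
       \<le> real k * (DIM('a) * (1 / Suc j * sqrt (2 / pi)))"
      by (rule smoothing_error[OF P]) (use bump_lipschitz[of C k] bump_bounds[of C k] in \<open>auto simp: dist_norm\<close>)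
    then show "norm ((\<integral>x. bump C k x * (\<integral>y. gauss_density (1 / Suc j) (x - y) \<partial>P) \<partial>lborel) - (\<integral>x. bump C k x \<partial>P))
       \<le> norm (real k * (DIM('a) * (1 / Suc j * sqrt (2 / pi)))) * 1"
      unfolding real_norm_def mult_1_right by linarith
  qed
qed

text \<open>Equal characteristic functions give equal Gaussian smoothings by
  \<open>smoothing_inversion\<close>. Letting the width tend to 0 gives equal integrals of all
  \<open>bump C k\<close>, and letting \<open>k\<close> tend to infinity gives equal masses of
  compact sets.\<close>

theorem cf_unique:
  fixes P P' :: "(real ^ 'n) measure"
  assumes P: "prob_space P" "sets P = sets borel" and P': "prob_space P'" "sets P' = sets borel"
    and eq: "cf P = cf P'"
  shows "P = P'"
proof (rule measure_eqI_compact)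
  interpret P: prob_space P by fact
  interpret P': prob_space P' by fact
  fix C :: "(real ^ 'n) set" assume C: "compact C"
  have "(\<integral>y. gauss_density s (x - y) \<partial>P) = (\<integral>y. gauss_density s (x - y) \<partial>P')" if "s > 0" for s and x :: "real ^ 'n"
  proof -
    have "(of_real ((2 * pi) ^ CARD('n) * (\<integral>y. gauss_density s (x - y) \<partial>P)) :: complex)
        = of_real ((2 * pi) ^ CARD('n) * (\<integral>y. gauss_density s (x - y) \<partial>P'))"
      unfolding smoothing_inversion[OF P that, symmetric] smoothing_inversion[OF P' that, symmetric] eq ..
    then show ?thesis unfolding of_real_eq_iff by simp
  qed
  then have "(\<lambda>j. \<integral>x. bump C k x * (\<integral>y. gauss_density (1 / Suc j) (x - y) \<partial>P) \<partial>lborel)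
     \<longlonglongrightarrow> (\<integral>x. bump C k x \<partial>P')" for k
    using smoothing_tendsto[OF P', of C k] by simp
  then have "(\<integral>x. bump C k x \<partial>P) = (\<integral>x. bump C k x \<partial>P')" for k
    by (rule LIMSEQ_unique[OF smoothing_tendsto[OF P, of C k]])
  then have "measure P C = measure P' C" if "C \<noteq> {}"
    using LIMSEQ_unique[OF bump_integral_tendsto[OF P compact_imp_closed[OF C] that]]
      bump_integral_tendsto[OF P' compact_imp_closed[OF C] that] by simp
  then show "emeasure P C = emeasure P' C"
    by (cases "C = {}") (simp_all add: P.emeasure_eq_measure P'.emeasure_eq_measure)
qed (use assms prob_space.finite_measure in auto)

section \<open>Densities by Fourier inversion\<close>

text \<open>For an integrable characteristic function the integral is a limit of the real values in
  \<open>smoothing_inversion\<close>; \<open>Re\<close> then only changes the type.\<close>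

definition inv_density :: "(real ^ 'n) measure \<Rightarrow> real ^ 'n \<Rightarrow> real" where
  "inv_density P x = Re (\<integral>z. exp (- \<i> * of_real (z \<bullet> x)) * cf P z \<partial>lborel) / (2 * pi) ^ CARD('n)"

lemma continuous_on_inv_density:
  fixes P :: "(real ^ 'n) measure"
  assumes int: "integrable lborel (cf P)"
  shows "continuous_on UNIV (inv_density P)"
  unfolding inv_density_def using int
  by (intro continuous_intros continuous_on_integral_dominated[where w="\<lambda>z. norm (cf P z)"])
     (auto simp: norm_mult intro!: continuous_intros)

text \<open>The Gaussian damping is removed by dominated convergence, with the modulus of
  \<open>cf P\<close> as dominating function. The same modulus bounds all smoothed densities
  uniformly in \<open>x\<close> and \<open>s\<close>, which later dominates their integrals.\<close>

lemma smoothing_tendsto_inv_density: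
  fixes P :: "(real ^ 'n) measure"
  assumes P: "prob_space P" "sets P = sets borel" and int: "integrable lborel (cf P)"
  shows "(\<lambda>j. \<integral>y. gauss_density (1 / Suc j) (x - y) \<partial>P) \<longlonglongrightarrow> inv_density P x"
    and "s > 0 \<Longrightarrow> (\<integral>y. gauss_density s (x - y) \<partial>P) \<le> (\<integral>z. norm (cf P z) \<partial>lborel) / (2 * pi) ^ CARD('n)"
proof -
  let ?G = "\<lambda>s z. exp (- \<i> * of_real (z \<bullet> x)) * of_real (exp (- (s * norm z)\<^sup>2 / 2)) * cf P z"
  have sm: "(\<integral>y. gauss_density s (x - y) \<partial>P) = Re (\<integral>z. ?G s z \<partial>lborel) / (2 * pi) ^ CARD('n)" if "s > 0" for s
    unfolding smoothing_inversion[OF P that, of x] Re_complex_of_real by simp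
  have [measurable]: "cf P \<in> borel_measurable borel" using int by auto
  have "(\<lambda>j. \<integral>z. ?G (1 / Suc j) z \<partial>lborel) \<longlonglongrightarrow> (\<integral>z. exp (- \<i> * of_real (z \<bullet> x)) * cf P z \<partial>lborel)"
  proof (rule integral_dominated_convergence[where w="\<lambda>z. norm (cf P z)"])
    show "AE z in lborel. (\<lambda>j. ?G (1 / Suc j) z) \<longlonglongrightarrow> exp (- \<i> * of_real (z \<bullet> x)) * cf P z"
    proof (rule AE_I2)
      fix z :: "real ^ 'n"
      have "(\<lambda>j. ?G (1 / Suc j) z) \<longlonglongrightarrow> exp (- \<i> * of_real (z \<bullet> x)) * of_real (exp (- (0 * norm z)\<^sup>2 / 2)) * cf P z"
        using LIMSEQ_inverse_real_of_nat by (intro tendsto_intros) (auto simp: inverse_eq_divide)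
      then show "(\<lambda>j. ?G (1 / Suc j) z) \<longlonglongrightarrow> exp (- \<i> * of_real (z \<bullet> x)) * cf P z" by simp
    qed
  qed (use int in \<open>auto simp: norm_mult mult_left_le_one_le\<close>)
  then show "(\<lambda>j. \<integral>y. gauss_density (1 / Suc j) (x - y) \<partial>P) \<longlonglongrightarrow> inv_density P x"
    by (subst sm) (auto simp: inv_density_def intro!: tendsto_intros)
  assume s: "s > 0"
  have "Re (\<integral>z. ?G s z \<partial>lborel) \<le> norm (\<integral>z. ?G s z \<partial>lborel)" by (rule complex_Re_le_cmod)
  also have "\<dots> \<le> (\<integral>z. norm (?G s z) \<partial>lborel)" by (rule integral_norm_bound)
  also have "\<dots> \<le> (\<integral>z. norm (cf P z) \<partial>lborel)"
    by (rule integral_mono, rule Bochner_Integration.integrable_bound[OF integrable_norm[OF int]])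
       (use int in \<open>auto simp: norm_mult mult_left_le_one_le\<close>)
  finally show "(\<integral>y. gauss_density s (x - y) \<partial>P) \<le> (\<integral>z. norm (cf P z) \<partial>lborel) / (2 * pi) ^ CARD('n)"
    by (simp only: sm[OF s] divide_right_mono zero_le_power pi_ge_zero mult_nonneg_nonneg zero_le_numeral)
qed

text \<open>The integral of \<open>bump C (Suc k)\<close> against the smoothed density has two
  limits as the width tends to 0: the integral against \<open>P\<close> by
  \<open>smoothing_tendsto\<close>, and the one against \<open>inv_density P\<close> by dominated
  convergence. Equating them and letting \<open>k\<close> grow identifies the mass of
  \<open>C\<close>.\<close>

theorem inv_density:
  fixes P :: "(real ^ 'n) measure"
  assumes P: "prob_space P" "sets P = sets borel" and int: "integrable lborel (cf P)"
  shows "inv_density P x \<ge> 0" "P = density lborel (\<lambda>x. ennreal (inv_density P x))"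
proof -
  interpret P: prob_space P by fact
  note [measurable_cong] = P(2)
  note lim = smoothing_tendsto_inv_density[OF P int]
  show pos: "inv_density P x \<ge> 0" for x
    by (rule LIMSEQ_le_const[OF lim(1)]) auto
  have [measurable]: "inv_density P \<in> borel_measurable borel"
    using continuous_on_inv_density[OF int] by (rule borel_measurable_continuous_onI)
  let ?B = "(\<integral>z. norm (cf P z) \<partial>lborel) / (2 * pi) ^ CARD('n)"
  have le: "inv_density P x \<le> ?B" for x
    by (rule LIMSEQ_le_const2[OF lim(1)]) (use lim(2) in auto)
  have [simp]: "?B \<ge> 0" by auto
  show "P = density lborel (\<lambda>x. ennreal (inv_density P x))"
  proof (rule measure_eqI_compact)
    fix C :: "(real ^ 'n) set" assume C: "compact C"
    show "emeasure P C = emeasure (density lborel (\<lambda>x. ennreal (inv_density P x))) C"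
    proof (cases "C = {}")
      case False
      obtain r where "\<forall>x\<in>C. norm x \<le> r"
        using compact_imp_bounded[OF C] unfolding bounded_iff by blast
      then have r: "C \<subseteq> cball 0 r" by auto
      \<comment> \<open>The slope \<open>Suc k\<close> is at least 1, so the function vanishes at
        distance 1 from \<open>C\<close>; one ball serves for all \<open>k\<close>, and
        \<open>w\<close> dominates in both limits below.\<close>
      have supp: "bump C (Suc k) x \<le> indicator (cball 0 (r + 1)) x" for k and x :: "real ^ 'n"
      proof (cases "x \<in> cball 0 (r + 1)")
        case False
        have "infdist x C \<ge> 1"
          unfolding infdist_notempty[OF \<open>C \<noteq> {}\<close>]
        proof (rule cINF_greatest[OF \<open>C \<noteq> {}\<close>])
          fix y assume "y \<in> C"
          with r have "norm y \<le> r" by auto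
          moreover have "norm x > r + 1" using False by simp
          ultimately show "1 \<le> dist x y" using norm_triangle_ineq2[of x y] by (simp add: dist_norm)
        qed
        then have "real (Suc k) * infdist x C \<ge> 1"
          using mult_mono[of 1 "real (Suc k)" 1 "infdist x C"] by simp
        then show ?thesis using False by (simp add: bump_def)
      qed (use bump_bounds in auto)
      have w: "integrable lborel (\<lambda>x. ?B * indicator (cball 0 (r + 1)) x :: real)"
        by (intro integrable_mult_right integrable_real_indicator emeasure_lborel_cball_finite) auto
      have bd: "\<bar>bump C (Suc k) x * q\<bar> \<le> ?B * indicator (cball 0 (r + 1)) x" if "0 \<le> q" "q \<le> ?B" for k x q
        using mult_mono[OF supp[of k x] that(2)] bump_bounds[of C "Suc k" x] that(1)
        by (simp add: abs_mult mult.commute)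
      have "(\<lambda>j. \<integral>x. bump C (Suc k) x * (\<integral>y. gauss_density (1 / Suc j) (x - y) \<partial>P) \<partial>lborel)
         \<longlonglongrightarrow> (\<integral>x. bump C (Suc k) x * inv_density P x \<partial>lborel)" for k
        by (rule integral_dominated_convergence[OF _ _ w])
           (use bd[OF _ lim(2)] in \<open>auto simp del: of_nat_Suc intro!: tendsto_intros AE_I2 lim(1)\<close>)
      then have "(\<integral>x. bump C (Suc k) x \<partial>P) = (\<integral>x. bump C (Suc k) x * inv_density P x \<partial>lborel)" for k
        by (rule LIMSEQ_unique[OF smoothing_tendsto[OF P]])
      moreover have "(\<lambda>k. \<integral>x. bump C (Suc k) x * inv_density P x \<partial>lborel)
          \<longlonglongrightarrow> (\<integral>x. indicator C x * inv_density P x \<partial>lborel)"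
        by (rule integral_dominated_convergence[OF _ _ w])
           (use bd[OF pos le] borel_compact[OF C] in \<open>auto intro!: tendsto_intros AE_I2 bump_tendsto compact_imp_closed C False\<close>)
      ultimately have eq: "measure P C = (\<integral>x. indicator C x * inv_density P x \<partial>lborel)"
        using LIMSEQ_unique[OF bump_integral_tendsto[OF P compact_imp_closed[OF C] False]] by simp
      have "integrable lborel (\<lambda>x. indicator C x * inv_density P x)"
        by (rule Bochner_Integration.integrable_bound[OF w])
           (use r pos le borel_compact[OF C] in \<open>auto split: split_indicator intro!: AE_I2 dest!: subsetD[OF r]\<close>)
      then have "(\<integral>\<^sup>+x. ennreal (indicator C x * inv_density P x) \<partial>lborel) = ennreal (measure P C)"
        unfolding eq by (intro nn_integral_eq_integral) (auto simp: pos)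
      then show ?thesis using borel_compact[OF C]
        by (subst emeasure_density) (auto simp: P.emeasure_eq_measure mult.commute ennreal_mult' pos ennreal_indicator intro!: nn_integral_cong)
    qed simp
  qed (use P P.finite_measure_axioms in auto)
qed

section \<open>Total variation distance\<close>

lemma
  fixes P P' :: "'a::topological_space measure"
  assumes "prob_space P" "prob_space P'"
  shows tv_dist_upper: "A \<in> sets borel \<Longrightarrow> \<bar>measure P A - measure P' A\<bar> \<le> tv_dist P P'"
    and tv_dist_nonneg: "tv_dist P P' \<ge> 0"
    and tv_dist_le_1: "tv_dist P P' \<le> 1"
proof -
  have le: "\<bar>measure P A - measure P' A\<bar> \<le> 1" for A
    using prob_space.prob_le_1[OF assms(1), of A] prob_space.prob_le_1[OF assms(2), of A]
      measure_nonneg[of P A] measure_nonneg[of P' A] by linarith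
  then have bdd: "bdd_above ((\<lambda>A. \<bar>measure P A - measure P' A\<bar>) ` sets borel)"
    by (intro bdd_aboveI2)
  show up: "\<bar>measure P A - measure P' A\<bar> \<le> tv_dist P P'" if "A \<in> sets borel" for A
    unfolding tv_dist_def by (rule cSUP_upper[OF that bdd])
  show "tv_dist P P' \<ge> 0"
    using up[of "{}"] by simp
  show "tv_dist P P' \<le> 1"
    unfolding tv_dist_def by (rule cSUP_least) (auto simp: le)
qed

lemma tv_dist_leI:
  assumes "\<And>A. A \<in> sets borel \<Longrightarrow> \<bar>measure P A - measure P' A\<bar> \<le> c"
  shows "tv_dist P P' \<le> c"
  unfolding tv_dist_def by (rule cSUP_least) (auto simp: assms)

lemma tv_dist_commute: "tv_dist P P' = tv_dist P' P"
  by (simp add: tv_dist_def abs_minus_commute)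

lemma tv_dist_self: "tv_dist P P = 0" for P :: "'a::topological_space measure"
proof -
  have "sets (borel :: 'a measure) \<noteq> {}" using sets.empty_sets by blast
  then show ?thesis by (simp add: tv_dist_def)
qed

lemma tv_dist_triangle:
  assumes "prob_space P" "prob_space P'" "prob_space P''"
  shows "tv_dist P P'' \<le> tv_dist P P' + tv_dist P' P''"
proof (rule tv_dist_leI)
  fix A :: "'a set" assume A: "A \<in> sets borel"
  show "\<bar>measure P A - measure P'' A\<bar> \<le> tv_dist P P' + tv_dist P' P''"
    using tv_dist_upper[OF assms(1,2) A] tv_dist_upper[OF assms(2,3) A] by linarith
qed

lemma tv_dist_distr_le:
  fixes f :: "'a::topological_space \<Rightarrow> 'b::topological_space"
  assumes P: "prob_space P" "sets P = sets borel" and P': "prob_space P'" "sets P' = sets borel"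
    and f: "f \<in> borel \<rightarrow>\<^sub>M borel"
  shows "tv_dist (distr P borel f) (distr P' borel f) \<le> tv_dist P P'"
proof (rule tv_dist_leI)
  fix A :: "'b set" assume A: "A \<in> sets borel"
  have fA: "f -` A \<in> sets borel" using measurable_sets[OF f A] by simp
  have "measure (distr P borel f) A = measure P (f -` A)" "measure (distr P' borel f) A = measure P' (f -` A)"
    using f A sets_eq_imp_space_eq[OF P(2)] sets_eq_imp_space_eq[OF P'(2)]
    by (simp_all add: measure_distr measurable_cong_sets[OF P(2) refl] measurable_cong_sets[OF P'(2) refl])
  then show "\<bar>measure (distr P borel f) A - measure (distr P' borel f) A\<bar> \<le> tv_dist P P'"
    using tv_dist_upper[OF P(1) P'(1) fA] by simp
qed

text \<open>A measurable left inverse suffices: \<open>tv_dist_distr_le\<close> is applied to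
  \<open>f\<close> and then to \<open>g\<close>, which recovers the original laws.\<close>

lemma tv_dist_distr_eq:
  fixes f :: "'a::topological_space \<Rightarrow> 'b::topological_space"
  assumes P: "prob_space P" "sets P = sets borel" and P': "prob_space P'" "sets P' = sets borel"
    and f: "f \<in> borel \<rightarrow>\<^sub>M borel" and g: "g \<in> borel \<rightarrow>\<^sub>M borel" and gf: "\<And>x. g (f x) = x"
  shows "tv_dist (distr P borel f) (distr P' borel f) = tv_dist P P'"
proof (rule antisym)
  have fm: "f \<in> P \<rightarrow>\<^sub>M borel" "f \<in> P' \<rightarrow>\<^sub>M borel"
    unfolding measurable_cong_sets[OF P(2) refl] measurable_cong_sets[OF P'(2) refl] by (rule f)+
  have gf': "g \<circ> f = (\<lambda>x. x)" using gf by auto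
  have "distr (distr P borel f) borel g = P" "distr (distr P' borel f) borel g = P'"
    unfolding distr_distr[OF g fm(1)] distr_distr[OF g fm(2)] gf'
    by (rule distr_id2[OF P(2)[symmetric]], rule distr_id2[OF P'(2)[symmetric]])
  moreover have "tv_dist (distr (distr P borel f) borel g) (distr (distr P' borel f) borel g)
     \<le> tv_dist (distr P borel f) (distr P' borel f)"
    by (rule tv_dist_distr_le[OF prob_space.prob_space_distr[OF P(1) fm(1)] sets_distr
          prob_space.prob_space_distr[OF P'(1) fm(2)] sets_distr g])
  ultimately show "tv_dist P P' \<le> tv_dist (distr P borel f) (distr P' borel f)" by simp
qed (rule tv_dist_distr_le[OF P P' f])

text \<open>Total variation is bounded by the full \<open>L1\<close> distance of the densities; the
  sharp factor 1/2 is irrelevant for convergence.\<close>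

lemma tv_dist_density_tendsto:
  fixes p :: "nat \<Rightarrow> 'a::euclidean_space \<Rightarrow> real"
  assumes P: "\<And>n. prob_space (P n)" "\<And>n. P n = density lborel (\<lambda>x. ennreal (p n x))"
    and [measurable]: "\<And>n. p n \<in> borel_measurable borel" and pos: "\<And>n x. p n x \<ge> 0"
    and L: "prob_space L" "L = density lborel (\<lambda>x. ennreal (q x))"
    and [measurable]: "q \<in> borel_measurable borel" and qpos: "\<And>x. q x \<ge> 0"
    and lim: "\<And>x. (\<lambda>n. p n x) \<longlonglongrightarrow> q x"
  shows "(\<lambda>n. tv_dist (P n) L) \<longlonglongrightarrow> 0"
proof -
  have one: "(\<integral>\<^sup>+x. ennreal (f x) \<partial>lborel) = 1"
    if "prob_space (density lborel (\<lambda>x. ennreal (f x)))" "f \<in> borel_measurable borel" for f :: "'a \<Rightarrow> real"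
    using prob_space.emeasure_space_1[OF that(1)] that(2) by (subst (asm) emeasure_density) auto
  have one': "(\<integral>\<^sup>+x. ennreal (p n x) \<partial>lborel) = 1" "(\<integral>\<^sup>+x. ennreal (q x) \<partial>lborel) = 1" for n
    by (rule one; use P(1)[of n] L(1) in \<open>simp flip: P(2) L(2)\<close>)+
  have int: "integrable lborel (p n)" "integrable lborel q" for n
    by (auto simp: integrable_iff_bounded pos qpos one')
  have meas: "measure (density lborel (\<lambda>x. ennreal (f x))) A = (\<integral>x. indicator A x * f x \<partial>lborel)"
    if "integrable lborel f" "\<And>x. f x \<ge> 0" "A \<in> sets borel" for f :: "'a \<Rightarrow> real" and A
  proof -
    have "emeasure (density lborel (\<lambda>x. ennreal (f x))) A = (\<integral>\<^sup>+x. ennreal (indicator A x * f x) \<partial>lborel)"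
      using that by (subst emeasure_density) (auto intro!: nn_integral_cong split: split_indicator)
    also have "\<dots> = ennreal (\<integral>x. indicator A x * f x \<partial>lborel)"
      using that integrable_mult_indicator[of A lborel f]
      by (intro nn_integral_eq_integral) auto
    finally show ?thesis using that by (simp add: measure_def)
  qed
  have le: "tv_dist (P n) L \<le> (\<integral>x. \<bar>p n x - q x\<bar> \<partial>lborel)" for n
  proof (rule tv_dist_leI)
    fix A :: "'a set" assume A: "A \<in> sets borel"
    have ii: "integrable lborel (\<lambda>x. indicator A x * p n x)" "integrable lborel (\<lambda>x. indicator A x * q x)"
      using integrable_mult_indicator[of A lborel "p n"] integrable_mult_indicator[of A lborel q] int A by simp_all
    have "measure (P n) A - measure L A = (\<integral>x. indicator A x * p n x - indicator A x * q x \<partial>lborel)"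
      unfolding P(2) L(2) by (simp add: meas int pos qpos A ii)
    also have "\<bar>\<dots>\<bar> \<le> (\<integral>x. \<bar>indicator A x * p n x - indicator A x * q x\<bar> \<partial>lborel)"
      by (rule integral_abs_bound)
    also have "\<dots> \<le> (\<integral>x. \<bar>p n x - q x\<bar> \<partial>lborel)"
      using ii int by (intro integral_mono) (auto split: split_indicator)
    finally show "\<bar>measure (P n) A - measure L A\<bar> \<le> (\<integral>x. \<bar>p n x - q x\<bar> \<partial>lborel)" .
  qed
  have "(\<lambda>n. \<integral>\<^sup>+x. norm (p n x - q x) \<partial>lborel) \<longlonglongrightarrow> 0"
  proof (rule Scheffe_lemma1)
    \<comment> \<open>All densities have mass one, so the limsup condition of Scheffe's lemma reads
      1 \<le> 1.\<close>
    have "limsup (\<lambda>n :: nat. 1 :: ennreal) = 1" by (rule Limsup_const) simp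
    then show "limsup (\<lambda>n. \<integral>\<^sup>+x. norm (p n x) \<partial>lborel) \<le> (\<integral>\<^sup>+x. norm (q x) \<partial>lborel)"
      by (simp add: pos qpos one')
  qed (simp_all add: int lim)
  then have "(\<lambda>n. ennreal (\<integral>x. \<bar>p n x - q x\<bar> \<partial>lborel)) \<longlonglongrightarrow> ennreal 0"
    using int by (subst (asm) nn_integral_eq_integral) auto
  then have "(\<lambda>n. \<integral>x. \<bar>p n x - q x\<bar> \<partial>lborel) \<longlonglongrightarrow> 0"
    by (subst (asm) tendsto_ennreal_iff) auto
  then show ?thesis
    by (rule tendsto_sandwich[OF always_eventually always_eventually tendsto_const, rotated -1])
       (simp_all add: le tv_dist_nonneg[OF P(1) L(1)])
qed

section \<open>Translates of a law\<close>

lemma measurable_shift: "(+) u \<in> borel \<rightarrow>\<^sub>M (borel :: 'a::euclidean_space measure)"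
  by (rule borel_measurable_add[OF borel_measurable_const measurable_ident_sets[OF refl]])

lemma prob_space_shift:
  fixes L :: "'a::euclidean_space measure"
  assumes "prob_space L" "sets L = sets borel"
  shows "prob_space (distr L borel ((+) u))"
proof -
  have "(+) u \<in> L \<rightarrow>\<^sub>M borel" unfolding measurable_cong_sets[OF assms(2) refl] by (rule measurable_shift)
  then show ?thesis by (rule prob_space.prob_space_distr[OF assms(1)])
qed

lemma shift_density:
  fixes q :: "'a::euclidean_space \<Rightarrow> ennreal"
  assumes [measurable]: "q \<in> borel_measurable borel"
  shows "distr (density lborel q) borel ((+) u) = density lborel (\<lambda>x. q (x - u))"
proof (rule measure_eqI)
  fix A assume "A \<in> sets (distr (density lborel q) borel ((+) u))"
  then have A[measurable]: "A \<in> sets borel" by simp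
  have A': "(+) u -` A \<in> sets borel" using measurable_sets[OF measurable_shift A, of u] by simp
  have m: "(+) u \<in> lborel \<rightarrow>\<^sub>M borel" using measurable_shift by simp
  have "emeasure (density lborel (\<lambda>x. q (x - u))) A = (\<integral>\<^sup>+x. q (x - u) * indicator A x \<partial>distr lborel borel ((+) u))"
    by (simp add: emeasure_density lborel_distr_plus)
  also have "\<dots> = (\<integral>\<^sup>+x. q (u + x - u) * indicator A (u + x) \<partial>lborel)"
    by (rule nn_integral_distr[OF m]) measurable
  also have "\<dots> = (\<integral>\<^sup>+x. q x * indicator ((+) u -` A) x \<partial>lborel)"
    by (simp add: indicator_vimage)
  also have "\<dots> = emeasure (density lborel q) ((+) u -` A)"
    using A' by (simp add: emeasure_density)
  also have "\<dots> = emeasure (distr (density lborel q) borel ((+) u)) A"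
    using m A by (subst emeasure_distr) simp_all
  finally show "emeasure (distr (density lborel q) borel ((+) u)) A = emeasure (density lborel (\<lambda>x. q (x - u))) A" by simp
qed simp

text \<open>Integrability of the characteristic function makes the density continuous, so densities
  of translates converge pointwise when the shifts do. Scheffe's lemma and the reverse triangle
  inequality finish the argument.\<close>

lemma tv_dist_shift_continuous:
  fixes L :: "(real ^ 'n) measure"
  assumes L: "prob_space L" "sets L = sets borel" and int: "integrable lborel (cf L)"
  shows "continuous_on UNIV (\<lambda>u. tv_dist (distr L borel ((+) u)) L)"
  unfolding continuous_on_sequentially o_def
proof safe
  fix w :: "nat \<Rightarrow> real ^ 'n" and a assume w: "w \<longlonglongrightarrow> a"
  let ?q = "inv_density L"
  have [measurable]: "?q \<in> borel_measurable borel"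
    using continuous_on_inv_density[OF int] by (rule borel_measurable_continuous_onI)
  have sh: "distr L borel ((+) u) = density lborel (\<lambda>x. ennreal (?q (x - u)))" for u
    by (subst inv_density(2)[OF L int], rule shift_density) auto
  have ps: "prob_space (distr L borel ((+) u))" for u by (rule prob_space_shift[OF L])
  have "(\<lambda>n. tv_dist (distr L borel ((+) (w n))) (distr L borel ((+) a))) \<longlonglongrightarrow> 0"
  proof (rule tv_dist_density_tendsto[OF ps sh _ _ ps sh])
    fix x
    have "(\<lambda>n. x - w n) \<longlonglongrightarrow> x - a" by (intro tendsto_intros w)
    then show "(\<lambda>n. ?q (x - w n)) \<longlonglongrightarrow> ?q (x - a)"
      using continuous_on_inv_density[OF int] by (auto simp: continuous_on_sequentially o_def)
  qed (auto simp: inv_density(1)[OF L int])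
  moreover have "\<bar>tv_dist (distr L borel ((+) (w n))) L - tv_dist (distr L borel ((+) a)) L\<bar>
      \<le> tv_dist (distr L borel ((+) (w n))) (distr L borel ((+) a))" for n
    using tv_dist_triangle[OF ps[of "w n"] ps[of a] L(1)] tv_dist_triangle[OF ps[of a] ps[of "w n"] L(1)]
    using tv_dist_commute[of "distr L borel ((+) a)" "distr L borel ((+) (w n))"] by linarith
  moreover have "tv_dist (distr L borel ((+) (w n))) (distr L borel ((+) a)) \<ge> 0" for n
    by (rule tv_dist_nonneg[OF ps ps])
  ultimately have "(\<lambda>n. tv_dist (distr L borel ((+) (w n))) L - tv_dist (distr L borel ((+) a)) L) \<longlonglongrightarrow> 0"
    by (elim tendsto_0_le[where K=1]) (simp add: always_eventually)
  then show "(\<lambda>n. tv_dist (distr L borel ((+) (w n))) L) \<longlonglongrightarrow> tv_dist (distr L borel ((+) a)) L"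
    by (rule LIM_zero_cancel)
qed

text \<open>A large ball carries almost all the mass of \<open>L\<close>, and a far enough
  translation moves almost all mass out of it; no density is involved.\<close>

lemma tv_dist_shift_at_infinity:
  fixes L :: "'a::euclidean_space measure"
  assumes L: "prob_space L" "sets L = sets borel"
  shows "((\<lambda>u. tv_dist (distr L borel ((+) u)) L) \<longlongrightarrow> 1) at_infinity"
proof (rule tendstoI)
  fix e :: real assume e: "e > 0"
  interpret prob_space L by fact
  note [measurable_cong] = L(2)
  have sp: "space L = UNIV" using sets_eq_imp_space_eq[OF L(2)] by simp
  have "(\<lambda>n. measure L (cball 0 (real n))) \<longlonglongrightarrow> measure L (\<Union>n. cball 0 (real n))"
    by (rule finite_Lim_measure_incseq) (auto simp: L incseq_def)
  also have "(\<Union>n. cball (0::'a) (real n)) = space L"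
    using real_arch_simple by (auto simp: sp)
  finally have "(\<lambda>n. measure L (cball 0 (real n))) \<longlonglongrightarrow> 1" by (simp add: prob_space)
  then have "\<forall>\<^sub>F n in sequentially. measure L (cball 0 (real n)) > 1 - e / 2"
    using e by (intro order_tendstoD) auto
  then obtain n where n: "measure L (cball 0 (real n)) > 1 - e / 2"
    by (auto simp: eventually_sequentially)
  \<comment> \<open>Two points of the ball of radius \<open>n\<close> differ by at most
    \<open>2 * n\<close>, so for these \<open>u\<close> the ball and its preimage under the shift
    are disjoint. Their masses are above \<open>1 - e / 2\<close> and below \<open>e / 2\<close>,
    whose difference exceeds \<open>1 - e\<close>.\<close>
  have "dist (tv_dist (distr L borel ((+) u)) L) 1 < e" if u: "norm u \<ge> 2 * real n + 1" for u
  proof -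
    let ?K = "cball (0::'a) (real n)"
    have "measure (distr L borel ((+) u)) ?K = measure L ((+) u -` ?K \<inter> space L)"
      using measurable_shift[of u]
      by (intro measure_distr) (simp_all add: measurable_cong_sets[OF L(2) refl])
    also have "\<dots> \<le> measure L (space L - ?K)"
    proof (rule finite_measure_mono)
      show "(+) u -` ?K \<inter> space L \<subseteq> space L - ?K"
      proof safe
        fix x assume "u + x \<in> ?K" "x \<in> ?K"
        then show False using u norm_triangle_ineq4[of "u + x" x] by simp
      qed
    qed (auto simp: L sp)
    also have "\<dots> = 1 - measure L ?K" by (rule prob_compl) (auto simp: L)
    finally have "\<bar>measure (distr L borel ((+) u)) ?K - measure L ?K\<bar> > 1 - e" using n by linarith
    with tv_dist_upper[OF prob_space_shift[OF L] L(1), of ?K u] tv_dist_le_1[OF prob_space_shift[OF L] L(1), of u]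
    show ?thesis by (simp add: dist_real_def)
  qed
  then show "\<forall>\<^sub>F u in at_infinity. dist (tv_dist (distr L borel ((+) u)) L) 1 < e"
    unfolding eventually_at_infinity by blast
qed

section \<open>Convergence in total variation under condition (H)\<close>

text \<open>Condition (H) ties the admissible times to \<open>R\<close>. Fixing a single large
  \<open>R\<close> decouples them: the bound on the supremum holds at every time beyond
  \<open>t0 R\<close>.\<close>

lemma condition_H_tail:
  fixes P :: "real \<Rightarrow> (real ^ 'n) measure"
  assumes H: "condition_H P" and e: "e > 0"
  obtains R where "R > 0"
    "\<forall>\<^sub>F t in at_top. (\<integral>\<^sup>+z\<in>{z. norm z > R}. ennreal (norm (cf (P t) z)) \<partial>lborel) \<le> ennreal e"
proof -
  from H obtain t0 :: "real \<Rightarrow> real" where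
    "((\<lambda>R. SUP s\<in>{t0 R<..}. \<integral>\<^sup>+z\<in>{z. norm z > R}. ennreal (norm (cf (P s) z)) \<partial>lborel) \<longlongrightarrow> 0) at_top"
    unfolding condition_H_def by blast
  then have "\<forall>\<^sub>F R in at_top. (SUP s\<in>{t0 R<..}. \<integral>\<^sup>+z\<in>{z. norm z > R}. ennreal (norm (cf (P s) z)) \<partial>lborel) < ennreal e"
    using e by (intro order_tendstoD) auto
  then have "\<forall>\<^sub>F R in at_top. R > 0 \<and> (SUP s\<in>{t0 R<..}. \<integral>\<^sup>+z\<in>{z. norm z > R}. ennreal (norm (cf (P s) z)) \<partial>lborel) < ennreal e"
    using eventually_gt_at_top[of 0] by eventually_elim simp
  then obtain R where R: "R > 0" and
    *: "(SUP s\<in>{t0 R<..}. \<integral>\<^sup>+z\<in>{z. norm z > R}. ennreal (norm (cf (P s) z)) \<partial>lborel) < ennreal e"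
    using eventually_happens'[OF trivial_limit_at_top_linorder] by blast
  have "\<forall>\<^sub>F t in at_top. (\<integral>\<^sup>+z\<in>{z. norm z > R}. ennreal (norm (cf (P t) z)) \<partial>lborel) \<le> ennreal e"
    using eventually_gt_at_top[of "t0 R"]
  proof eventually_elim
    case (elim t)
    then show ?case
      by (intro order_trans[OF _ less_imp_le[OF *]] SUP_upper) auto
  qed
  with R that show ?thesis by blast
qed

text \<open>Used to transfer condition (H) from the driftless functional to its translates by the
  drift, whose characteristic functions differ by a factor of modulus one.\<close>

lemma condition_H_norm_eq:
  fixes P P' :: "real \<Rightarrow> (real ^ 'n) measure"
  assumes "condition_H P" and P': "\<And>t. t > 0 \<Longrightarrow> prob_space (P' t)" "\<And>t. t > 0 \<Longrightarrow> sets (P' t) = sets borel"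
    and eq: "\<And>t z. t > 0 \<Longrightarrow> norm (cf (P' t) z) = norm (cf (P t) z)"
  shows "condition_H P'"
  unfolding condition_H_def
proof (intro conjI allI impI)
  fix t :: real assume t: "t > 0"
  then have "integrable lborel (cf (P t))" using assms(1) by (auto simp: condition_H_def)
  then show "integrable lborel (cf (P' t))"
    by (rule Bochner_Integration.integrable_bound)
       (use borel_measurable_continuous_onI[OF continuous_on_cf[OF P'[OF t]]] eq[OF t] in auto)
next
  from assms(1) obtain t0 :: "real \<Rightarrow> real" where t0: "\<forall>R>0. t0 R > 0" "filterlim t0 at_top at_top"
    and lim: "((\<lambda>R. SUP s\<in>{t0 R<..}. \<integral>\<^sup>+z\<in>{z. norm z > R}. ennreal (norm (cf (P s) z)) \<partial>lborel) \<longlongrightarrow> 0) at_top"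
    unfolding condition_H_def by blast
  have "\<forall>\<^sub>F R in at_top. (SUP s\<in>{t0 R<..}. \<integral>\<^sup>+z\<in>{z. norm z > R}. ennreal (norm (cf (P s) z)) \<partial>lborel)
      = (SUP s\<in>{t0 R<..}. \<integral>\<^sup>+z\<in>{z. norm z > R}. ennreal (norm (cf (P' s) z)) \<partial>lborel)"
    using eventually_gt_at_top[of 0]
  proof eventually_elim
    case (elim R)
    \<comment> \<open>Positivity of \<open>t0 R\<close> restricts the supremum to positive times,
      where the two moduli agree.\<close>
    then have "t0 R > 0" using t0 by auto
    then show ?case by (intro SUP_cong refl) (simp add: eq)
  qed
  then have "((\<lambda>R. SUP s\<in>{t0 R<..}. \<integral>\<^sup>+z\<in>{z. norm z > R}. ennreal (norm (cf (P' s) z)) \<partial>lborel) \<longlongrightarrow> 0) at_top"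
    using lim by (rule Lim_transform_eventually[rotated])
  with t0 show "\<exists>t0 :: real \<Rightarrow> real. (\<forall>R>0. t0 R > 0) \<and> filterlim t0 at_top at_top \<and>
        ((\<lambda>R. SUP s\<in>{t0 R<..}. \<integral>\<^sup>+z\<in>{z. norm z > R}. ennreal (norm (cf (P' s) z)) \<partial>lborel)
           \<longlongrightarrow> 0) at_top" by blast
qed

text \<open>Fatou's lemma: a tail bound that holds eventually along the sequence passes to the
  pointwise limit.\<close>

lemma nn_integral_tail_limit:
  fixes f :: "nat \<Rightarrow> 'a \<Rightarrow> complex"
  assumes [measurable]: "\<And>n. f n \<in> borel_measurable M" "A \<in> sets M"
    and lim: "\<And>z. (\<lambda>n. f n z) \<longlonglongrightarrow> g z"
    and le: "\<forall>\<^sub>F n in sequentially. (\<integral>\<^sup>+z\<in>A. ennreal (norm (f n z)) \<partial>M) \<le> e"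
  shows "(\<integral>\<^sup>+z\<in>A. ennreal (norm (g z)) \<partial>M) \<le> e"
proof -
  have "(\<lambda>n. ennreal (norm (f n z)) * indicator A z) \<longlonglongrightarrow> ennreal (norm (g z)) * indicator A z" for z
    by (cases "z \<in> A") (auto intro!: tendsto_intros lim)
  then have "liminf (\<lambda>n. ennreal (norm (f n z)) * indicator A z) = ennreal (norm (g z)) * indicator A z" for z
    by (intro lim_imp_Liminf) auto
  then have "(\<integral>\<^sup>+z\<in>A. ennreal (norm (g z)) \<partial>M) = (\<integral>\<^sup>+z. liminf (\<lambda>n. ennreal (norm (f n z)) * indicator A z) \<partial>M)"
    by simp
  also have "\<dots> \<le> liminf (\<lambda>n. \<integral>\<^sup>+z\<in>A. ennreal (norm (f n z)) \<partial>M)"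
    by (rule nn_integral_liminf) auto
  also have "\<dots> \<le> limsup (\<lambda>n. \<integral>\<^sup>+z\<in>A. ennreal (norm (f n z)) \<partial>M)"
    by (rule Liminf_le_Limsup) auto
  also have "\<dots> \<le> e"
    by (rule Limsup_bounded[OF le])
  finally show ?thesis .
qed

text \<open>Uniform tails turn pointwise convergence of the characteristic functions into
  \<open>L1\<close> convergence, and the inversion formula turns this into pointwise convergence of
  the densities.\<close>

theorem tv_dist_tendsto_limit:
  fixes P :: "real \<Rightarrow> (real ^ 'n) measure"
  assumes P: "\<And>t. t > 0 \<Longrightarrow> prob_space (P t)" "\<And>t. t > 0 \<Longrightarrow> sets (P t) = sets borel"
    and L: "prob_space L" "sets L = sets borel"
    and H: "condition_H P"
    and lim: "\<And>z. ((\<lambda>t. cf (P t) z) \<longlongrightarrow> cf L z) at_top"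
  shows "integrable lborel (cf L)" "((\<lambda>t. tv_dist (P t) L) \<longlongrightarrow> 0) at_top"
proof -
  have [measurable]: "cf L \<in> borel_measurable borel"
    using continuous_on_cf[OF L] by (rule borel_measurable_continuous_onI)
  have int: "integrable lborel (cf (P t))" if "t > 0" for t
    using H that by (auto simp: condition_H_def)
  have tail: "(\<integral>\<^sup>+z\<in>{z. norm z > R}. ennreal (norm (cf L z)) \<partial>lborel) \<le> ennreal e"
    if ev: "\<forall>\<^sub>F t in at_top. (\<integral>\<^sup>+z\<in>{z. norm z > R}. ennreal (norm (cf (P t) z)) \<partial>lborel) \<le> ennreal e" for R e
  proof (rule nn_integral_tail_limit)
    \<comment> \<open>The integer times \<open>Suc n\<close> are positive, so condition (H) supplies
      measurability at each of them.\<close>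
    have rs: "filterlim (\<lambda>n. real (Suc n)) at_top sequentially"
      by (rule filterlim_compose[OF filterlim_real_sequentially filterlim_Suc])
    show "(\<lambda>n. cf (P (real (Suc n))) z) \<longlonglongrightarrow> cf L z" for z
      by (rule filterlim_compose[OF lim rs])
    show "\<forall>\<^sub>F n in sequentially. (\<integral>\<^sup>+z\<in>{z. norm z > R}. ennreal (norm (cf (P (real (Suc n))) z)) \<partial>lborel) \<le> ennreal e"
      by (rule eventually_compose_filterlim[OF ev rs])
    show "cf (P (real (Suc n))) \<in> borel_measurable lborel" for n
      using int[of "real (Suc n)"] by auto
  qed measurable
  show intL: "integrable lborel (cf L)"
  proof -
    obtain R where "R > 0" and R: "\<forall>\<^sub>F t in at_top. (\<integral>\<^sup>+z\<in>{z. norm z > R}. ennreal (norm (cf (P t) z)) \<partial>lborel) \<le> ennreal 1"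
      using condition_H_tail[OF H, of 1] by auto
    \<comment> \<open>Inside the ball of radius \<open>R\<close> the modulus is at most 1; outside,
      the tail bound inherited from the \<open>P t\<close> applies.\<close>
    have "(\<integral>\<^sup>+z. ennreal (norm (cf L z)) \<partial>lborel)
       \<le> (\<integral>\<^sup>+z. indicator (cball 0 R) z + ennreal (norm (cf L z)) * indicator {z. norm z > R} z \<partial>lborel)"
      using norm_cf_le_1[OF L(1)] by (intro nn_integral_mono) (auto split: split_indicator)
    also have "\<dots> = emeasure lborel (cball (0 :: real ^ 'n) R) + (\<integral>\<^sup>+z\<in>{z. norm z > R}. ennreal (norm (cf L z)) \<partial>lborel)"
      by (subst nn_integral_add) (auto intro!: borel_measurable_indicator)
    also have "\<dots> < \<infinity>"
      using tail[OF R] emeasure_lborel_cball_finite[of "0 :: real ^ 'n" R]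
      by (auto simp: less_top[symmetric] top_unique)
    finally show ?thesis by (auto simp: integrable_iff_bounded)
  qed
  show "((\<lambda>t. tv_dist (P t) L) \<longlongrightarrow> 0) at_top"
  proof (rule tendsto_at_topI_sequentially)
    fix X :: "nat \<Rightarrow> real" assume X: "filterlim X at_top sequentially"
    then obtain N where N: "\<And>n. n \<ge> N \<Longrightarrow> X n > 0"
      using filterlim_at_top_dense[of X sequentially] by (auto simp: eventually_sequentially)
    \<comment> \<open>The offset drops the finitely many indices at which the time may fail to be
      positive and nothing is assumed.\<close>
    define Y where "Y n = X (n + N)" for n
    have Ypos: "Y n > 0" for n using N by (simp add: Y_def)
    have Y: "filterlim Y at_top sequentially"
      unfolding Y_def by (rule filterlim_compose[OF X filterlim_add_const_nat_at_top])
    define \<psi> where "\<psi> n z = cf (P (Y n)) z - cf L z" for n z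
    have \<psi>int: "integrable lborel (\<psi> n)" for n
      unfolding \<psi>_def using int[OF Ypos] intL by (intro Bochner_Integration.integrable_diff) auto
    then have [measurable]: "\<psi> n \<in> borel_measurable borel" for n
      using borel_measurable_integrable by force
    have \<psi>lim: "(\<lambda>n. \<psi> n z) \<longlonglongrightarrow> 0" for z
      unfolding \<psi>_def by (rule LIM_zero[OF filterlim_compose[OF lim Y]])
    have \<psi>2: "norm (\<psi> n z) \<le> 2" for n z
      unfolding \<psi>_def using norm_triangle_ineq4[of "cf (P (Y n)) z" "cf L z"]
        norm_cf_le_1[OF P(1)[OF Ypos], of n z] norm_cf_le_1[OF L(1), of z] by linarith
    \<comment> \<open>On the ball of radius \<open>R\<close> bounded convergence applies, with bound
      2. Off the ball the tails of \<open>P (Y n)\<close> and of \<open>L\<close> cost at most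
      \<open>e / 4\<close> each.\<close>
    have main: "(\<lambda>n. \<integral>z. norm (\<psi> n z) \<partial>lborel) \<longlonglongrightarrow> 0"
    proof (rule tendstoI)
      fix e :: real assume e: "e > 0"
      obtain R where "R > 0" and R: "\<forall>\<^sub>F t in at_top. (\<integral>\<^sup>+z\<in>{z. norm z > R}. ennreal (norm (cf (P t) z)) \<partial>lborel) \<le> ennreal (e / 4)"
        using condition_H_tail[OF H, of "e / 4"] e by auto
      have "(\<lambda>n. \<integral>z. indicator (cball 0 R) z * norm (\<psi> n z) \<partial>lborel) \<longlonglongrightarrow> (\<integral>z. indicator (cball 0 R) z * norm (0 :: complex) \<partial>(lborel :: (real ^ 'n) measure))"
      proof (rule integral_dominated_convergence[where w="\<lambda>z. indicator (cball 0 R) z * 2"])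
        have [measurable]: "cball (0 :: real ^ 'n) R \<in> sets borel" by simp
        show "(\<lambda>z. indicator (cball 0 R) z * norm (\<psi> n z)) \<in> borel_measurable lborel" for n
          by measurable
        show "AE z in lborel. (\<lambda>n. indicator (cball 0 R) z * norm (\<psi> n z)) \<longlonglongrightarrow> indicator (cball 0 R) z * norm (0 :: complex)"
          by (intro AE_I2 tendsto_intros \<psi>lim)
        show "integrable lborel (\<lambda>z :: real ^ 'n. indicator (cball 0 R) z * 2 :: real)"
          by (intro integrable_mult_left integrable_real_indicator emeasure_lborel_cball_finite) auto
      qed (use \<psi>2 in \<open>auto split: split_indicator\<close>)
      then have "(\<lambda>n. \<integral>z. indicator (cball 0 R) z * norm (\<psi> n z) \<partial>lborel) \<longlonglongrightarrow> 0" by simp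
      then have "\<forall>\<^sub>F n in sequentially. (\<integral>z. indicator (cball 0 R) z * norm (\<psi> n z) \<partial>lborel) < e / 2"
        using e by (intro order_tendstoD) auto
      moreover have "\<forall>\<^sub>F n in sequentially. (\<integral>\<^sup>+z\<in>{z. norm z > R}. ennreal (norm (cf (P (Y n)) z)) \<partial>lborel) \<le> ennreal (e / 4)"
        by (rule eventually_compose_filterlim[OF R Y])
      ultimately show "\<forall>\<^sub>F n in sequentially. dist (\<integral>z. norm (\<psi> n z) \<partial>lborel) 0 < e"
      proof eventually_elim
        case (elim n)
        have m[measurable]: "cf (P (Y n)) \<in> borel_measurable borel" using int[OF Ypos[of n]] by auto
        have i1: "integrable lborel (\<lambda>z. indicator (cball 0 R) z * norm (\<psi> n z))"
          using integrable_mult_indicator[OF _ integrable_norm[OF \<psi>int[of n]], of "cball 0 R"] by simp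
        have i2: "integrable lborel (\<lambda>z. indicator {z. norm z > R} z * norm (\<psi> n z))"
          using integrable_mult_indicator[OF _ integrable_norm[OF \<psi>int[of n]], of "{z. norm z > R}"] by simp
        have "ennreal (\<integral>z. indicator {z. norm z > R} z * norm (\<psi> n z) \<partial>lborel)
           = (\<integral>\<^sup>+z. ennreal (indicator {z. norm z > R} z * norm (\<psi> n z)) \<partial>lborel)"
          by (rule nn_integral_eq_integral[symmetric, OF i2]) simp
        also have "\<dots> \<le> (\<integral>\<^sup>+z. ennreal (norm (cf (P (Y n)) z)) * indicator {z. norm z > R} z
            + ennreal (norm (cf L z)) * indicator {z. norm z > R} z \<partial>lborel)"
          by (intro nn_integral_mono)
             (auto simp: \<psi>_def norm_triangle_ineq4 simp flip: ennreal_plus split: split_indicator)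
        also have "\<dots> \<le> ennreal (e / 4) + ennreal (e / 4)"
          using elim(2) tail[OF R] by (subst nn_integral_add) (auto intro: add_mono)
        also have "\<dots> = ennreal (e / 2)" using e by (simp flip: ennreal_plus)
        finally have "(\<integral>z. indicator {z. norm z > R} z * norm (\<psi> n z) \<partial>lborel) \<le> e / 2"
          using e by (simp add: ennreal_le_iff)
        moreover have "(\<integral>z. norm (\<psi> n z) \<partial>lborel) = (\<integral>z. indicator (cball 0 R) z * norm (\<psi> n z)
             + indicator {z. norm z > R} z * norm (\<psi> n z) \<partial>lborel)"
          by (intro Bochner_Integration.integral_cong) (auto split: split_indicator)
        ultimately show ?case
          using elim(1) by (simp add: i1 i2)
      qed
    qed
    \<comment> \<open>The difference of the two inversion integrals is bounded by the
      \<open>L1\<close> norm of \<open>\<psi> n\<close>, whatever \<open>x\<close> is.\<close>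
    have pw: "(\<lambda>n. inv_density (P (Y n)) x) \<longlonglongrightarrow> inv_density L x" for x
    proof -
      have "(\<lambda>n. (\<integral>z. exp (- \<i> * of_real (z \<bullet> x)) * cf (P (Y n)) z \<partial>lborel)) \<longlonglongrightarrow> (\<integral>z. exp (- \<i> * of_real (z \<bullet> x)) * cf L z \<partial>lborel)"
      proof (rule LIM_zero_cancel, rule tendsto_0_le[OF main, where K=1], intro always_eventually allI)
        fix n
        have ii: "integrable lborel (\<lambda>z. exp (- \<i> * of_real (z \<bullet> x)) * g z)" if "integrable lborel g" for g
          by (rule Bochner_Integration.integrable_bound[OF that]) (use that in \<open>auto simp: norm_mult\<close>)
        have "(\<integral>z. exp (- \<i> * of_real (z \<bullet> x)) * cf (P (Y n)) z \<partial>lborel) - (\<integral>z. exp (- \<i> * of_real (z \<bullet> x)) * cf L z \<partial>lborel)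
           = (\<integral>z. exp (- \<i> * of_real (z \<bullet> x)) * \<psi> n z \<partial>lborel)"
          unfolding \<psi>_def right_diff_distrib
          by (rule Bochner_Integration.integral_diff[symmetric, OF ii[OF int[OF Ypos]] ii[OF intL]])
        also have "norm \<dots> \<le> (\<integral>z. norm (exp (- \<i> * of_real (z \<bullet> x)) * \<psi> n z) \<partial>lborel)"
          by (rule integral_norm_bound)
        also have "\<dots> = (\<integral>z. norm (\<psi> n z) \<partial>lborel)" by (simp add: norm_mult)
        finally show "norm ((\<integral>z. exp (- \<i> * of_real (z \<bullet> x)) * cf (P (Y n)) z \<partial>lborel) - (\<integral>z. exp (- \<i> * of_real (z \<bullet> x)) * cf L z \<partial>lborel))
            \<le> norm (\<integral>z. norm (\<psi> n z) \<partial>lborel) * 1" by simp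
      qed
      then show ?thesis unfolding inv_density_def by (intro tendsto_intros) auto
    qed
    have "(\<lambda>n. tv_dist (P (Y n)) L) \<longlonglongrightarrow> 0"
    proof (rule tv_dist_density_tendsto[OF P(1)[OF Ypos] inv_density(2) _ _ L(1) inv_density(2)])
      show "inv_density (P (Y n)) \<in> borel_measurable borel" for n
        by (rule borel_measurable_continuous_onI[OF continuous_on_inv_density[OF int[OF Ypos]]])
      show "inv_density L \<in> borel_measurable borel"
        by (rule borel_measurable_continuous_onI[OF continuous_on_inv_density[OF intL]])
      show "inv_density (P (Y n)) x \<ge> 0" for n x
        by (rule inv_density(1)[OF P(1)[OF Ypos] P(2)[OF Ypos] int[OF Ypos]])
      show "inv_density L x \<ge> 0" for x
        by (rule inv_density(1)[OF L intL])
    qed (rule pw P(1)[OF Ypos] P(2)[OF Ypos] int[OF Ypos] L intL)+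
    then show "(\<lambda>n. tv_dist (P (X n)) L) \<longlonglongrightarrow> 0"
      unfolding Y_def by (rule LIMSEQ_offset)
  qed
qed

section \<open>The matrix exponential\<close>

lemma sums_vecI:
  fixes f :: "nat \<Rightarrow> 'a::real_normed_vector ^ 'n"
  assumes "\<And>i. (\<lambda>k. f k $ i) sums (s $ i)"
  shows "f sums s"
  unfolding sums_def by (rule vec_tendstoI) (use assms in \<open>simp add: sums_def sum_component\<close>)

lemma has_vector_derivative_vecI:
  fixes f :: "real \<Rightarrow> 'a::real_normed_vector ^ 'n"
  assumes "\<And>i. ((\<lambda>x. f x $ i) has_vector_derivative f' $ i) (at x within S)"
  shows "(f has_vector_derivative f') (at x within S)"
  unfolding has_vector_derivative_def has_derivative_def
proof (intro conjI bounded_linear_scaleR_left)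
  show "((\<lambda>y. ((f y - f (Lim (at x within S) (\<lambda>x. x))) -
      (y - Lim (at x within S) (\<lambda>x. x)) *\<^sub>R f') /\<^sub>R norm (y - Lim (at x within S) (\<lambda>x. x))) \<longlongrightarrow> 0) (at x within S)"
    using assms unfolding has_vector_derivative_def has_derivative_def
    by (intro vec_tendstoI) simp
qed

section \<open>Matrix powers and the entries of the exponential series\<close>

abbreviation matpow :: "real ^ 'n ^ 'n \<Rightarrow> nat \<Rightarrow> real ^ 'n ^ 'n" where
  "matpow A k \<equiv> ((**) A ^^ k) (mat 1)"

lemma matrix_mult_scaleR_left: "(c *\<^sub>R A) ** B = c *\<^sub>R (A ** B)" for A :: "real ^ 'n ^ 'm"
  by (simp add: vec_eq_iff matrix_matrix_mult_def sum_distrib_left mult.assoc)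

lemma matrix_mult_scaleR_right: "A ** (c *\<^sub>R B) = c *\<^sub>R (A ** B)" for A :: "real ^ 'n ^ 'm"
  by (simp add: vec_eq_iff matrix_matrix_mult_def sum_distrib_left mult.left_commute)

lemma matpow_commute: "A ** matpow A k = matpow A k ** A"
  by (induction k) (simp_all add: matrix_mul_assoc)

lemma matpow_scaleR: "matpow (s *\<^sub>R A) k = s ^ k *\<^sub>R matpow A k"
  by (induction k) (simp_all add: matrix_mult_scaleR_left matrix_mult_scaleR_right mult.commute)

text \<open>With \<open>a\<close> bounding all entries of \<open>A\<close>, an entry of the next
  power is a sum of \<open>CARD('n)\<close> products, each at most \<open>a\<close> times the
  previous bound. This gives the base \<open>CARD('n) * a\<close>, and geometric growth is dominated
  by the factorials.\<close>

lemma matpow_entry_bound: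
  fixes A :: "real ^ 'n ^ 'n"
  obtains c where "c \<ge> 0" "\<And>k i j. \<bar>matpow A k $ i $ j\<bar> \<le> c ^ k"
proof
  define a where "a = (\<Sum>i\<in>UNIV. \<Sum>j\<in>UNIV. \<bar>A $ i $ j\<bar>)"
  have a: "\<bar>A $ i $ j\<bar> \<le> a" for i j
  proof -
    have "\<bar>A $ i $ j\<bar> \<le> (\<Sum>j\<in>UNIV. \<bar>A $ i $ j\<bar>)"
      by (rule member_le_sum) auto
    also have "\<dots> \<le> a"
      unfolding a_def by (rule member_le_sum[where f="\<lambda>i. \<Sum>j\<in>UNIV. \<bar>A $ i $ j\<bar>"]) (auto intro: sum_nonneg)
    finally show ?thesis .
  qed
  then have a0: "a \<ge> 0" by (meson abs_ge_zero order_trans)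
  then show "real CARD('n) * a \<ge> 0" by simp
  show "\<bar>matpow A k $ i $ j\<bar> \<le> (real CARD('n) * a) ^ k" for k i j
  proof (induction k arbitrary: i j)
    case 0
    then show ?case by (simp add: mat_def)
  next
    case (Suc k)
    have "\<bar>matpow A (Suc k) $ i $ j\<bar> = \<bar>\<Sum>l\<in>UNIV. A $ i $ l * matpow A k $ l $ j\<bar>"
      by (simp add: matrix_matrix_mult_def)
    also have "\<dots> \<le> (\<Sum>l\<in>UNIV. \<bar>A $ i $ l\<bar> * \<bar>matpow A k $ l $ j\<bar>)"
      unfolding abs_mult[symmetric] by (rule sum_abs)
    also have "\<dots> \<le> (\<Sum>l\<in>(UNIV::'n set). a * (real CARD('n) * a) ^ k)"
      by (intro sum_mono mult_mono a Suc.IH a0) auto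
    finally show ?case by (simp add: mult_ac)
  qed
qed

lemma summable_mexp_entry:
  fixes A :: "real ^ 'n ^ 'n"
  shows "summable (\<lambda>k. matpow A k $ i $ j / fact k * s ^ k)"
proof -
  obtain c where c: "c \<ge> 0" "\<And>k i j. \<bar>matpow A k $ i $ j\<bar> \<le> c ^ k"
    using matpow_entry_bound[of A] by blast
  show ?thesis
  proof (rule summable_comparison_test'[where N=0])
    show "summable (\<lambda>k. inverse (fact k) * (c * \<bar>s\<bar>) ^ k)" by (rule summable_exp)
    show "norm (matpow A k $ i $ j / fact k * s ^ k) \<le> inverse (fact k) * (c * \<bar>s\<bar>) ^ k" for k
      using mult_right_mono[OF c(2)[of k i j], of "\<bar>s\<bar> ^ k / fact k"]
      by (simp add: abs_mult power_abs power_mult_distrib field_simps)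
  qed
qed

lemma mexp_entry:
  fixes A :: "real ^ 'n ^ 'n"
  shows "mexp (s *\<^sub>R A) $ i $ j = (\<Sum>k. matpow A k $ i $ j / fact k * s ^ k)"
proof -
  have "(\<lambda>k. (1 / fact k) *\<^sub>R matpow (s *\<^sub>R A) k) sums (\<chi> i j. \<Sum>k. matpow A k $ i $ j / fact k * s ^ k)"
  proof (intro sums_vecI)
    fix i j
    show "(\<lambda>k. ((1 / fact k) *\<^sub>R matpow (s *\<^sub>R A) k) $ i $ j) sums (\<chi> i j. \<Sum>k. matpow A k $ i $ j / fact k * s ^ k) $ i $ j"
      using summable_sums[OF summable_mexp_entry[of A i j s]] by (simp add: matpow_scaleR mult_ac)
  qed
  then show ?thesis
    unfolding mexp_def by (simp add: sums_iff)
qed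

lemma mexp_0 [simp]: "mexp (0 :: real ^ 'n ^ 'n) = mat 1"
proof -
  have "mexp (0 *\<^sub>R (0 :: real ^ 'n ^ 'n)) $ i $ j = mat 1 $ i $ j" for i j
    unfolding mexp_entry by (subst powser_zero) simp
  then show ?thesis by (simp add: vec_eq_iff)
qed

text \<open>Each entry is an everywhere convergent scalar power series and may be differentiated
  termwise. The shifted coefficient contains \<open>A ** matpow A k\<close>, and
  \<open>matpow_commute\<close> moves \<open>A\<close> to the right, the side on which variation of
  constants uses it.\<close>

lemma mexp_has_vector_derivative:
  fixes A :: "real ^ 'n ^ 'n"
  shows "((\<lambda>s. mexp (s *\<^sub>R A)) has_vector_derivative mexp (s *\<^sub>R A) ** A) (at s within T)"
proof (intro has_vector_derivative_vecI)
  fix i j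
  let ?c = "\<lambda>j k. matpow A k $ i $ j / fact k"
  have "((\<lambda>s. \<Sum>k. ?c j k * s ^ k) has_field_derivative (\<Sum>k. diffs (?c j) k * s ^ k)) (at s)"
    by (rule termdiffs_strong_converges_everywhere[OF summable_mexp_entry])
  moreover have "(\<Sum>k. diffs (?c j) k * s ^ k) = (mexp (s *\<^sub>R A) ** A) $ i $ j"
  proof -
    have "diffs (?c j) k = (\<Sum>l\<in>UNIV. ?c l k * A $ l $ j)" for k
    proof -
      have "diffs (?c j) k = (A ** matpow A k) $ i $ j / fact k"
        by (simp add: diffs_def del: of_nat_Suc)
      also have "\<dots> = (\<Sum>l\<in>UNIV. ?c l k * A $ l $ j)"
        unfolding matpow_commute by (simp add: matrix_matrix_mult_def sum_divide_distrib)
      finally show ?thesis .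
    qed
    then have "(\<Sum>k. diffs (?c j) k * s ^ k) = (\<Sum>k. \<Sum>l\<in>UNIV. A $ l $ j * (?c l k * s ^ k))"
      by (simp add: sum_distrib_right sum_distrib_left mult_ac)
    also have "\<dots> = (\<Sum>l\<in>UNIV. \<Sum>k. A $ l $ j * (?c l k * s ^ k))"
      by (intro suminf_sum summable_mult summable_mexp_entry)
    also have "\<dots> = (\<Sum>l\<in>UNIV. A $ l $ j * mexp (s *\<^sub>R A) $ i $ l)"
      unfolding mexp_entry by (intro sum.cong refl suminf_mult summable_mexp_entry)
    finally show ?thesis by (simp add: matrix_matrix_mult_def mult.commute)
  qed
  ultimately show "((\<lambda>s. mexp (s *\<^sub>R A) $ i $ j) has_vector_derivative (mexp (s *\<^sub>R A) ** A) $ i $ j) (at s within T)"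
    unfolding mexp_entry[symmetric] has_real_derivative_iff_has_vector_derivative
    by (simp add: has_vector_derivative_at_within)
qed

lemma bounded_bilinear_matrix_vector_mult:
  "bounded_bilinear ((*v) :: real ^ 'n ^ 'm \<Rightarrow> real ^ 'n \<Rightarrow> real ^ 'm)"
  unfolding bilinear_conv_bounded_bilinear[symmetric] bilinear_def
  by (auto intro!: linearI simp: matrix_vector_right_distrib matrix_vector_mult_add_rdistrib
      scaleR_matrix_vector_assoc matrix_vector_mult_scaleR)

lemma bounded_bilinear_matrix_matrix_mult:
  "bounded_bilinear ((**) :: real ^ 'n ^ 'm \<Rightarrow> real ^ 'k ^ 'n \<Rightarrow> real ^ 'k ^ 'm)"
  unfolding bilinear_conv_bounded_bilinear[symmetric] bilinear_def
  by (auto intro!: linearI simp: matrix_mult_scaleR_left matrix_mult_scaleR_right)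
     (simp_all add: vec_eq_iff matrix_matrix_mult_def algebra_simps sum.distrib)

text \<open>One-sided limits make \<open>g\<close> oscillate by less than \<open>e\<close> on each
  side of every point. Compactness leaves finitely many centres \<open>S\<close>, and a Lebesgue
  number \<open>\<delta>\<close> puts every shorter interval into one of their balls. An interval
  that misses the centre lies on one side of it.\<close>

lemma cadlag_osc:
  fixes g :: "real \<Rightarrow> 'a::metric_space"
  assumes g: "cadlag g" and e: "e > 0"
  obtains S \<delta> where "finite S" "\<delta> > 0"
    "\<And>u v x y. \<lbrakk>0 \<le> u; v \<le> t; v - u < \<delta>; S \<inter> {u..v} = {}; x \<in> {u..v}; y \<in> {u..v}\<rbrakk> \<Longrightarrow> dist (g x) (g y) < e"
proof -
  have "\<exists>r>0. (\<forall>x\<in>{s<..<s + r}. \<forall>y\<in>{s<..<s + r}. dist (g x) (g y) < e) \<and>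
    (\<forall>x\<in>{s - r<..<s}\<inter>{0..}. \<forall>y\<in>{s - r<..<s}\<inter>{0..}. dist (g x) (g y) < e)" if s: "s \<in> {0..t}" for s
  proof -
    have "(g \<longlongrightarrow> g s) (at_right s)"
      using g s by (auto simp: cadlag_def continuous_within)
    then have "\<forall>\<^sub>F x in at_right s. dist (g x) (g s) < e / 2"
      using e by (intro tendstoD) auto
    then obtain b where b: "b > s" "\<And>x. s < x \<Longrightarrow> x < b \<Longrightarrow> dist (g x) (g s) < e / 2"
      unfolding eventually_at_right_field by blast
    have "\<exists>a<s. \<exists>z. \<forall>x. a < x \<longrightarrow> x < s \<longrightarrow> x \<ge> 0 \<longrightarrow> dist (g x) z < e / 2"
    proof (cases "s > 0")
      case True
      then obtain z where "(g \<longlongrightarrow> z) (at_left s)" using g by (auto simp: cadlag_def)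
      then have "\<forall>\<^sub>F x in at_left s. dist (g x) z < e / 2"
        using e by (intro tendstoD) auto
      then show ?thesis unfolding eventually_at_left_field by blast
    next
      \<comment> \<open>Here \<open>s = 0\<close>: no nonnegative time precedes it, so the claim
        about the left side is vacuous.\<close>
      case False
      with s show ?thesis by (intro exI[of _ "s - 1"]) auto
    qed
    then obtain a z where a: "a < s" "\<And>x. a < x \<Longrightarrow> x < s \<Longrightarrow> x \<ge> 0 \<Longrightarrow> dist (g x) z < e / 2" by blast
    show ?thesis
    proof (intro exI[of _ "min (b - s) (s - a)"] conjI ballI)
      fix x y assume "x \<in> {s<..<s + min (b - s) (s - a)}" "y \<in> {s<..<s + min (b - s) (s - a)}"
      then show "dist (g x) (g y) < e"
        using b(2)[of x] b(2)[of y] dist_triangle_half_l[of "g x" "g s" e "g y"] by auto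
    next
      fix x y assume "x \<in> {s - min (b - s) (s - a)<..<s} \<inter> {0..}" "y \<in> {s - min (b - s) (s - a)<..<s} \<inter> {0..}"
      then show "dist (g x) (g y) < e"
        using a(2)[of x] a(2)[of y] dist_triangle_half_l[of "g x" z e "g y"] by auto
    qed (use a b in auto)
  qed
  then obtain r where r: "\<And>s. s \<in> {0..t} \<Longrightarrow> r s > 0"
    "\<And>s x y. s \<in> {0..t} \<Longrightarrow> x \<in> {s<..<s + r s} \<Longrightarrow> y \<in> {s<..<s + r s} \<Longrightarrow> dist (g x) (g y) < e"
    "\<And>s x y. s \<in> {0..t} \<Longrightarrow> x \<in> {s - r s<..<s} \<inter> {0..} \<Longrightarrow> y \<in> {s - r s<..<s} \<inter> {0..} \<Longrightarrow> dist (g x) (g y) < e"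
    by metis
  obtain S where S: "S \<subseteq> {0..t}" "finite S" "{0..t} \<subseteq> (\<Union>s\<in>S. ball s (r s))"
  proof (rule compactE_image[of "{0..t}" "{0..t}" "\<lambda>s. ball s (r s)"])
    show "{0..t} \<subseteq> (\<Union>s\<in>{0..t}. ball s (r s))" using r(1) by force
  qed (use that in auto)
  show ?thesis
  proof (cases "S = {}")
    case True
    with S have "t < 0" by auto
    then show ?thesis by (intro that[of "{}" 1]) auto
  next
    case False
    obtain \<delta> where \<delta>: "0 < \<delta>" "\<And>T. \<lbrakk>T \<subseteq> {0..t}; diameter T < \<delta>\<rbrakk> \<Longrightarrow> \<exists>B\<in>(\<lambda>s. ball s (r s)) ` S. T \<subseteq> B"
    proof (rule Lebesgue_number_lemma[of "{0..t}" "(\<lambda>s. ball s (r s)) ` S"])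
      show "{0..t} \<subseteq> \<Union> ((\<lambda>s. ball s (r s)) ` S)" by (rule S(3))
    qed (use that False in auto)
    show ?thesis
    proof (rule that[OF S(2) \<delta>(1)])
      fix u v x y assume uv: "0 \<le> u" "v \<le> t" "v - u < \<delta>" "S \<inter> {u..v} = {}" "x \<in> {u..v}" "y \<in> {u..v}"
      then have "diameter {u..v} < \<delta>" by auto
      then obtain s where s: "s \<in> S" "{u..v} \<subseteq> ball s (r s)"
        using \<delta>(2)[of "{u..v}"] uv by auto
      then have "s \<notin> {u..v}" "s \<in> {0..t}" using uv S by auto
      moreover have "x \<in> ball s (r s)" "y \<in> ball s (r s)" using s uv by blast+
      ultimately show "dist (g x) (g y) < e"
        using r(2)[of s x y] r(3)[of s x y] uv by (auto simp: dist_real_def)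
    qed
  qed
qed

section \<open>Cadlag paths and pathwise Stieltjes integrals\<close>

text \<open>Each point has a neighbourhood that contains no other exceptional point of
  \<open>cadlag_osc\<close>. Its two punctured halves therefore have images of bounded oscillation,
  and compactness gives a finite union.\<close>

lemma cadlag_bounded:
  fixes g :: "real \<Rightarrow> 'a::real_normed_vector"
  assumes "cadlag g"
  shows "bounded (g ` {0..t})"
proof (rule ccontr)
  assume unb: "\<not> bounded (g ` {0..t})"
  obtain S \<delta> where S: "finite S" "\<delta> > 0"
    "\<And>u v x y. \<lbrakk>0 \<le> u; v \<le> t; v - u < \<delta>; S \<inter> {u..v} = {}; x \<in> {u..v}; y \<in> {u..v}\<rbrakk> \<Longrightarrow> dist (g x) (g y) < 1"
    using cadlag_osc[OF assms, of 1 t] by auto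
  have "\<exists>r>0. bounded (g ` ({s - r<..<s + r} \<inter> {0..t}))" if s: "s \<in> {0..t}" for s
  proof -
    have "finite (S - {s})" using S by simp
    then obtain d where d: "d > 0" "\<And>x. x \<in> S - {s} \<Longrightarrow> d \<le> dist s x"
      using finite_set_avoid[of "S - {s}" s] by blast
    define r where "r = min (\<delta> / 2) (d / 2)"
    have r: "r > 0" "r < d" "r < \<delta>" using d S(2) by (auto simp: r_def)
    have L: "dist (g x) (g y) < 1"
      if "x \<in> {s - r<..<s} \<inter> {0..t}" "y \<in> {s - r<..<s} \<inter> {0..t}" for x y
    proof (rule S(3)[of "min x y" "max x y"])
      show "S \<inter> {min x y..max x y} = {}"
        using that r d(2) by (force simp: dist_real_def)
    qed (use that r in auto)
    have R: "dist (g x) (g y) < 1"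
      if "x \<in> {s<..<s + r} \<inter> {0..t}" "y \<in> {s<..<s + r} \<inter> {0..t}" for x y
    proof (rule S(3)[of "min x y" "max x y"])
      show "S \<inter> {min x y..max x y} = {}"
        using that r d(2) by (force simp: dist_real_def)
    qed (use that r in auto)
    have bd: "bounded (g ` T)" if "\<And>x y. x \<in> T \<Longrightarrow> y \<in> T \<Longrightarrow> dist (g x) (g y) < 1" for T
    proof (cases "T = {}")
      case False
      then obtain x where "x \<in> T" by auto
      then show ?thesis using that unfolding bounded_def
        by (intro exI[of _ "g x"] exI[of _ 1]) (auto intro: less_imp_le)
    qed simp
    have "{s - r<..<s + r} \<inter> {0..t} \<subseteq> ({s - r<..<s} \<inter> {0..t}) \<union> ({s<..<s + r} \<inter> {0..t}) \<union> {s}" by auto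
    then have "g ` ({s - r<..<s + r} \<inter> {0..t}) \<subseteq> g ` ({s - r<..<s} \<inter> {0..t}) \<union> g ` ({s<..<s + r} \<inter> {0..t}) \<union> {g s}"
      by blast
    then have "bounded (g ` ({s - r<..<s + r} \<inter> {0..t}))"
    proof (rule bounded_subset[rotated])
      have "bounded (g ` ({s - r<..<s} \<inter> {0..t}))" by (rule bd, rule L)
      moreover have "bounded (g ` ({s<..<s + r} \<inter> {0..t}))" by (rule bd, rule R)
      ultimately show "bounded (g ` ({s - r<..<s} \<inter> {0..t}) \<union> g ` ({s<..<s + r} \<inter> {0..t}) \<union> {g s})"
        by simp
    qed
    with r show ?thesis by blast
  qed
  then obtain r where r: "\<And>s. s \<in> {0..t} \<Longrightarrow> r s > 0"
    "\<And>s. s \<in> {0..t} \<Longrightarrow> bounded (g ` ({s - r s<..<s + r s} \<inter> {0..t}))" by metis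
  obtain C where C: "C \<subseteq> {0..t}" "finite C" "{0..t} \<subseteq> (\<Union>s\<in>C. {s - r s<..<s + r s})"
  proof (rule compactE_image[of "{0..t}" "{0..t}" "\<lambda>s. {s - r s<..<s + r s}"])
    show "{0..t} \<subseteq> (\<Union>s\<in>{0..t}. {s - r s<..<s + r s})" using r(1) by force
  qed (use that in auto)
  have "g ` {0..t} \<subseteq> (\<Union>s\<in>C. g ` ({s - r s<..<s + r s} \<inter> {0..t}))" using C(3) by blast
  moreover have "bounded (\<Union>s\<in>C. g ` ({s - r s<..<s + r s} \<inter> {0..t}))"
    using C(1,2) r(2) by (intro bounded_UN) auto
  ultimately show False using unb bounded_subset by blast
qed

text \<open>Right continuity makes \<open>g\<close> a limit of step functions sampled on a grid.
  Rounding down and adding one picks a grid point strictly to the right of \<open>s\<close>, as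
  convergence along \<open>at_right\<close> requires. Clipping by \<open>max 0\<close> stays where
  \<open>cadlag\<close> says something.\<close>

lemma cadlag_measurable:
  fixes g :: "real \<Rightarrow> 'a::{metric_space, second_countable_topology}"
  assumes "cadlag g"
  shows "(\<lambda>s. g (max 0 s)) \<in> borel_measurable borel"
proof (rule borel_measurable_LIMSEQ_metric)
  show "(\<lambda>s. g ((of_int \<lfloor>real (Suc n) * max 0 s\<rfloor> + 1) / real (Suc n))) \<in> borel_measurable borel" for n
    by measurable
  fix s :: real
  let ?s = "max 0 s"
  let ?a = "\<lambda>n. (of_int \<lfloor>real (Suc n) * ?s\<rfloor> + 1) / real (Suc n)"
  have gt: "?a n > ?s" for n
  proof -
    have "?s * real (Suc n) < of_int \<lfloor>real (Suc n) * ?s\<rfloor> + 1"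
      using real_of_int_floor_add_one_gt[of "real (Suc n) * ?s"] by (simp only: mult.commute)
    then show ?thesis by (simp only: pos_less_divide_eq of_nat_0_less_iff zero_less_Suc)
  qed
  have le: "?a n \<le> ?s + 1 / real (Suc n)" for n
  proof -
    have "of_int \<lfloor>real (Suc n) * ?s\<rfloor> + 1 \<le> real (Suc n) * ?s + 1" by simp
    then have "?a n \<le> (real (Suc n) * ?s + 1) / real (Suc n)" by (rule divide_right_mono) simp
    then show ?thesis by (simp add: add_divide_distrib del: of_nat_Suc)
  qed
  have "?a \<longlonglongrightarrow> ?s"
  proof (rule tendsto_sandwich[where f="\<lambda>_. ?s" and h="\<lambda>n. ?s + 1 / real (Suc n)"])
    show "(\<lambda>n. ?s + 1 / real (Suc n)) \<longlonglongrightarrow> ?s"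
      using tendsto_add[OF tendsto_const LIMSEQ_inverse_real_of_nat, of ?s] by (simp add: inverse_eq_divide)
    show "\<forall>\<^sub>F n in sequentially. ?a n \<le> ?s + 1 / real (Suc n)" by (intro always_eventually allI le)
    show "\<forall>\<^sub>F n in sequentially. ?s \<le> ?a n" by (intro always_eventually allI less_imp_le gt)
  qed (rule tendsto_const)
  then have "filterlim ?a (at_right ?s) sequentially"
    unfolding filterlim_at
  proof (intro conjI always_eventually allI)
    show "?a n \<in> {?s<..}" "?a n \<noteq> ?s" for n
      using gt[of n] by (simp_all only: greaterThan_iff less_imp_neq[symmetric] not_False_eq_True)
  qed
  moreover have "(g \<longlongrightarrow> g ?s) (at_right ?s)"
    using assms by (auto simp: cadlag_def continuous_within)
  ultimately show "(\<lambda>n. g (?a n)) \<longlonglongrightarrow> g ?s"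
    by (rule filterlim_compose[rotated])
qed

lemma cadlag_mult_integrable:
  fixes g :: "real \<Rightarrow> real ^ 'n" and G :: "real \<Rightarrow> real ^ 'n ^ 'm"
  assumes g: "cadlag g" and G: "continuous_on UNIV G" and u: "0 \<le> u"
  shows "(\<lambda>s. G s *v g s) integrable_on {u..t}"
proof -
  interpret bounded_bilinear "(*v) :: real ^ 'n ^ 'm \<Rightarrow> real ^ 'n \<Rightarrow> real ^ 'm"
    by (rule bounded_bilinear_matrix_vector_mult)
  obtain K where K: "K \<ge> 0" "\<And>A x. norm ((A :: real ^ 'n ^ 'm) *v (x :: real ^ 'n)) \<le> norm A * norm x * K"
    using nonneg_bounded by blast
  obtain B where B: "\<And>s. s \<in> {0..t} \<Longrightarrow> norm (g s) \<le> B"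
    using cadlag_bounded[OF g, of t] unfolding bounded_iff by blast
  have "bounded (G ` {u..t})"
    using G by (intro compact_imp_bounded compact_continuous_image) (auto intro: continuous_on_subset)
  then obtain C where C: "\<And>s. s \<in> {u..t} \<Longrightarrow> norm (G s) \<le> C"
    unfolding bounded_iff by blast
  have m: "(\<lambda>s. G s *v g (max 0 s)) \<in> borel_measurable borel"
  proof (rule borel_measurable_continuous_Pair[where H="(*v)"])
    show "G \<in> borel_measurable borel" by (rule borel_measurable_continuous_onI[OF G])
    show "(\<lambda>s. g (max 0 s)) \<in> borel_measurable borel" by (rule cadlag_measurable[OF g])
    show "continuous_on UNIV (\<lambda>x :: (real ^ 'n ^ 'm) \<times> (real ^ 'n). fst x *v snd x)"
      by (intro continuous_on continuous_on_fst continuous_on_snd continuous_on_id)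
  qed
  have "(\<lambda>s. G s *v g (max 0 s)) integrable_on {u..t}"
  proof (rule measurable_bounded_by_integrable_imp_integrable)
    show "(\<lambda>s. G s *v g (max 0 s)) \<in> borel_measurable (lebesgue_on {u..t})"
      using m by (intro measurable_restrict_space1 measurable_completion) simp
    show "(\<lambda>_. C * B * K) integrable_on {u..t}" by (rule integrable_const_ivl)
    fix s assume s: "s \<in> {u..t}"
    then have "s \<in> {0..t}" using u by auto
    then have "norm (G s) * norm (g s) * K \<le> C * B * K"
      using C[OF s] B[of s] K(1) order_trans[OF norm_ge_zero C[OF s]] by (intro mult_right_mono mult_mono) auto
    with K(2)[of "G s" "g s"] show "norm (G s *v g (max 0 s)) \<le> C * B * K"
      using \<open>s \<in> {0..t}\<close> by simp
  qed auto
  then show ?thesis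
    by (rule integrable_eq) (use u in auto)
qed

text \<open>The constant \<open>K\<close> comes from bounded bilinearity, so no particular relation
  between the norms of matrices and vectors is used.\<close>

lemma norm_matrix_vector_bound:
  obtains K where "K \<ge> 0" "\<And>A x. norm ((A :: real ^ 'n ^ 'm) *v (x :: real ^ 'n)) \<le> K * (norm A * norm x)"
  using bounded_bilinear.nonneg_bounded[OF bounded_bilinear_matrix_vector_mult[where 'n='n and 'm='m]] that
  by (auto simp: mult.commute)

lemma derivative_has_integral_vector:
  fixes F F' :: "real \<Rightarrow> real ^ 'n ^ 'm"
  assumes F: "\<And>s. (F has_vector_derivative F' s) (at s)" and uv: "u \<le> v"
  shows "((\<lambda>r. F' r *v x) has_integral (F v - F u) *v x) {u..v}"
proof -
  have "(F' has_integral F v - F u) {u..v}"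
    by (rule fundamental_theorem_of_calculus[OF uv has_vector_derivative_at_within[OF F]])
  from has_integral_linear[OF this bounded_bilinear.bounded_linear_left[OF bounded_bilinear_matrix_vector_mult]]
  show ?thesis by (simp add: o_def)
qed

lemma lipschitz_from_derivative:
  fixes F F' :: "real \<Rightarrow> real ^ 'n ^ 'm"
  assumes F: "\<And>s. (F has_vector_derivative F' s) (at s)" and uv: "u \<le> v"
    and C: "\<And>r. r \<in> {u..v} \<Longrightarrow> norm (F' r) \<le> C" "C \<ge> 0"
  shows "norm (F v - F u) \<le> C * (v - u)"
proof -
  have "(F' has_integral F v - F u) {u..v}"
    by (rule fundamental_theorem_of_calculus[OF uv has_vector_derivative_at_within[OF F]])
  from has_integral_bound_real[OF C(2) _ this, of "{}"] show ?thesis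
    using C uv by simp
qed

text \<open>The error of integration by parts on one cell is at most its length times the
  oscillation of \<open>g\<close> on it. A jump inside the cell is thus also harmless: it still
  costs only a multiple of \<open>v - u\<close>.\<close>

lemma stieltjes_error_bound:
  fixes F F' :: "real \<Rightarrow> real ^ 'n ^ 'm" and g :: "real \<Rightarrow> real ^ 'n"
  assumes F: "\<And>s. (F has_vector_derivative F' s) (at s)"
    and int: "(\<lambda>r. F' r *v g r) integrable_on {u..v}"
    and C: "\<And>r. r \<in> {u..v} \<Longrightarrow> norm (F' r) \<le> C" "C \<ge> 0"
    and K: "K \<ge> 0" "\<And>A x. norm ((A :: real ^ 'n ^ 'm) *v (x :: real ^ 'n)) \<le> K * (norm A * norm x)"
    and s: "u \<le> s" "s \<le> v" and osc: "\<And>x. x \<in> {u..v} \<Longrightarrow> norm (g x - g s) \<le> \<omega>" and \<omega>: "\<omega> \<ge> 0"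
  shows "norm (F s *v (g v - g u) - (F v *v g v - F u *v g u) + integral {u..v} (\<lambda>r. F' r *v g r))
           \<le> 3 * C * K * \<omega> * (v - u)"
proof -
  have uv: "u \<le> v" using s by simp
  have "((\<lambda>r. F' r *v g r - F' r *v g s) has_integral
      (integral {u..v} (\<lambda>r. F' r *v g r) - (F v - F u) *v g s)) {u..v}"
    by (intro has_integral_diff integrable_integral int derivative_has_integral_vector[OF F uv])
  then have "norm (integral {u..v} (\<lambda>r. F' r *v g r) - (F v - F u) *v g s) \<le> (C * K * \<omega>) * (v - u)"
  proof -
    assume I: "((\<lambda>r. F' r *v g r - F' r *v g s) has_integral
      (integral {u..v} (\<lambda>r. F' r *v g r) - (F v - F u) *v g s)) {u..v}"
    have "norm (F' r *v g r - F' r *v g s) \<le> C * K * \<omega>" if "r \<in> {u..v}" for r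
    proof -
      have "norm (F' r *v (g r - g s)) \<le> K * (norm (F' r) * norm (g r - g s))" by (rule K(2))
      also have "\<dots> \<le> K * (C * \<omega>)"
        using that C osc K(1) by (intro mult_left_mono mult_mono) auto
      finally show ?thesis by (simp add: matrix_vector_mult_diff_distrib mult_ac)
    qed
    then have "norm (integral {u..v} (\<lambda>r. F' r *v g r) - (F v - F u) *v g s) \<le> (C * K * \<omega>) * measure lborel {u..v}"
      using C K \<omega> by (intro has_integral_bound_real[OF _ _ I, of _ "{}"]) auto
    then show ?thesis using uv by simp
  qed
  moreover have "norm ((F s - F v) *v (g v - g s)) \<le> C * K * \<omega> * (v - u)"
  proof -
    have "norm (F s - F v) \<le> C * (v - s)"
      using lipschitz_from_derivative[OF F s(2), of C] C s by (simp add: norm_minus_commute)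
    also have "\<dots> \<le> C * (v - u)" using s C by (intro mult_left_mono) auto
    finally have "norm (F s - F v) * norm (g v - g s) \<le> (C * (v - u)) * \<omega>"
      using osc[of v] C uv \<omega> by (intro mult_mono) auto
    then have "K * (norm (F s - F v) * norm (g v - g s)) \<le> K * ((C * (v - u)) * \<omega>)"
      using K(1) by (rule mult_left_mono)
    with K(2)[of "F s - F v" "g v - g s"] show ?thesis by (simp add: mult_ac)
  qed
  moreover have "norm ((F u - F s) *v (g u - g s)) \<le> C * K * \<omega> * (v - u)"
  proof -
    have "norm (F u - F s) \<le> C * (s - u)"
      using lipschitz_from_derivative[OF F s(1), of C] C s by (simp add: norm_minus_commute)
    also have "\<dots> \<le> C * (v - u)" using s C by (intro mult_left_mono) auto
    finally have "norm (F u - F s) * norm (g u - g s) \<le> (C * (v - u)) * \<omega>"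
      using osc[of u] C uv \<omega> by (intro mult_mono) auto
    then have "K * (norm (F u - F s) * norm (g u - g s)) \<le> K * ((C * (v - u)) * \<omega>)"
      using K(1) by (rule mult_left_mono)
    with K(2)[of "F u - F s" "g u - g s"] show ?thesis by (simp add: mult_ac)
  qed
  \<comment> \<open>Centring \<open>g\<close> at its value at the tag \<open>s\<close> makes every
    term a product of an increment of \<open>F\<close>, or an integral of \<open>F'\<close>, with an
    increment of \<open>g\<close>; each of the three is at most
    \<open>C * K * \<omega> * (v - u)\<close>.\<close>
  moreover have "F s *v (g v - g u) - (F v *v g v - F u *v g u) + integral {u..v} (\<lambda>r. F' r *v g r)
     = (F s - F v) *v (g v - g s) + (F u - F s) *v (g u - g s)
       + (integral {u..v} (\<lambda>r. F' r *v g r) - (F v - F u) *v g s)"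
    by (simp add: matrix_vector_mult_diff_distrib matrix_vector_mult_diff_rdistrib)
  moreover have "norm (a + b + c) \<le> norm a + norm b + norm c" for a b c :: "real ^ 'm"
    by (intro order_trans[OF norm_triangle_ineq] add_right_mono norm_triangle_ineq)
  moreover have "3 * C * K * \<omega> * (v - u) = C * K * \<omega> * (v - u) + C * K * \<omega> * (v - u) + C * K * \<omega> * (v - u)"
    by simp
  ultimately show ?thesis
    by (smt (verit))
qed

text \<open>Cells that miss the exceptional set \<open>S\<close> of \<open>cadlag_osc\<close> have
  error at most \<open>M * \<eta>\<close> times their length. Cells that meet \<open>S\<close> have
  only the crude oscillation bound \<open>2 * B\<close>, but their total length is of order
  \<open>\<delta>\<close>.\<close>

theorem stieltjes_by_parts:
  fixes F F' :: "real \<Rightarrow> real ^ 'n ^ 'm" and g :: "real \<Rightarrow> real ^ 'n"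
  assumes t: "0 \<le> t" and g: "cadlag g"
    and F: "\<And>s. (F has_vector_derivative F' s) (at s)" and F': "continuous_on UNIV F'"
  shows "has_stieltjes_integral F g 0 t (F t *v g t - F 0 *v g 0 - integral {0..t} (\<lambda>s. F' s *v g s))"
  unfolding has_stieltjes_integral_def
proof (intro allI impI)
  fix e :: real assume e: "e > 0"
  obtain K where K: "K \<ge> 0" "\<And>A x. norm ((A :: real ^ 'n ^ 'm) *v (x :: real ^ 'n)) \<le> K * (norm A * norm x)"
    by (rule norm_matrix_vector_bound[where 'n='n and 'm='m]) blast
  obtain B where B: "\<And>s. s \<in> {0..t} \<Longrightarrow> norm (g s) \<le> B"
    using cadlag_bounded[OF g, of t] unfolding bounded_iff by blast
  have B0: "B \<ge> 0" using order_trans[OF norm_ge_zero B[of 0]] t by simp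
  have "bounded (F' ` {0..t})"
    using F' by (intro compact_imp_bounded compact_continuous_image) (auto intro: continuous_on_subset)
  then obtain C where C: "\<And>s. s \<in> {0..t} \<Longrightarrow> norm (F' s) \<le> C"
    unfolding bounded_iff by blast
  have C0: "C \<ge> 0" using order_trans[OF norm_ge_zero C[of 0]] t by simp
  have int: "(\<lambda>r. F' r *v g r) integrable_on {u..v}" if "0 \<le> u" for u v
    by (rule cadlag_mult_integrable[OF g F' that])
  define M where "M = 3 * C * K"
  have M0: "M \<ge> 0" using C0 K(1) by (simp add: M_def)
  \<comment> \<open>Half of \<open>e\<close> is reserved for the cells missing \<open>S\<close>; the
    summand 1 keeps the denominator positive when \<open>M * t = 0\<close>.\<close>
  define \<eta> where "\<eta> = e / (2 * (M * t + 1))"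
  have Mt: "M * t \<ge> 0" using M0 t by simp
  have \<eta>: "\<eta> > 0" using e Mt by (simp add: \<eta>_def)
  have \<eta>2: "M * \<eta> * t < e / 2" using e Mt by (simp add: \<eta>_def divide_simps)
  obtain S \<delta>0 where S: "finite S" "\<delta>0 > 0"
    "\<And>u v x y. \<lbrakk>0 \<le> u; v \<le> t; v - u < \<delta>0; S \<inter> {u..v} = {}; x \<in> {u..v}; y \<in> {u..v}\<rbrakk> \<Longrightarrow> dist (g x) (g y) < \<eta>"
    using cadlag_osc[OF g \<eta>, of t] by blast
  \<comment> \<open>\<open>N * \<delta>\<close> will bound the error on all cells meeting
    \<open>S\<close>: oscillation \<open>2 * B\<close> over a length of \<open>4 * \<delta>\<close>
    for each point of \<open>S\<close>.\<close>
  define N where "N = M * (2 * B * (real (card S) * 4))"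
  have N0: "N \<ge> 0" using M0 B0 by (simp add: N_def)
  define \<delta> where "\<delta> = min (\<delta>0 / 2) (e / (2 * (N + 1)))"
  have \<delta>: "\<delta> > 0" "2 * \<delta> \<le> \<delta>0" using S(2) e N0 by (auto simp: \<delta>_def)
  have "N * \<delta> \<le> N * (e / (2 * (N + 1)))" using N0 by (intro mult_left_mono) (auto simp: \<delta>_def)
  also have "\<dots> < e / 2" using e N0 by (simp add: divide_simps)
  finally have N\<delta>: "N * \<delta> < e / 2" .
  \<comment> \<open>A clock that runs only within \<open>2 * \<delta>\<close> of
    \<open>\<sigma>\<close>. It advances by the full \<open>v - u\<close> on a cell shorter than
    \<open>2 * \<delta>\<close> that contains \<open>\<sigma>\<close>, and by at most
    \<open>4 * \<delta>\<close> in total.\<close>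
  define \<phi> where "\<phi> \<sigma> x = max (\<sigma> - 2 * \<delta>) (min (\<sigma> + 2 * \<delta>) x)" for \<sigma> x :: real
  define f where "f x = M * (\<eta> * x + 2 * B * (\<Sum>\<sigma>\<in>S. \<phi> \<sigma> x))" for x
  have f_diff: "f v - f u = M * (\<eta> * (v - u) + 2 * B * (\<Sum>\<sigma>\<in>S. \<phi> \<sigma> v - \<phi> \<sigma> u))" for u v
    by (simp add: f_def sum_subtractf algebra_simps)
  show "\<exists>\<delta>>0. \<forall>p. p tagged_division_of {0..t} \<and> (\<lambda>s. ball s \<delta>) fine p \<longrightarrow>
     norm ((\<Sum>(s, K)\<in>p. F s *v (g (Sup K) - g (Inf K))) -
        (F t *v g t - F 0 *v g 0 - integral {0..t} (\<lambda>s. F' s *v g s))) < e"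
  proof (intro exI[of _ \<delta>] conjI allI impI \<delta>(1))
    fix p assume "p tagged_division_of {0..t} \<and> (\<lambda>s. ball s \<delta>) fine p"
    then have p: "p tagged_division_of {0..t}" and fine: "(\<lambda>s. ball s \<delta>) fine p" by auto
    let ?E = "\<lambda>s K. F s *v (g (Sup K) - g (Inf K)) - (F (Sup K) *v g (Sup K) - F (Inf K) *v g (Inf K))
        + integral K (\<lambda>r. F' r *v g r)"
    have "(\<Sum>(s, K)\<in>p. ?E s K) = (\<Sum>(s, K)\<in>p. F s *v (g (Sup K) - g (Inf K)))
        - (\<Sum>(s, K)\<in>p. F (Sup K) *v g (Sup K) - F (Inf K) *v g (Inf K)) + (\<Sum>(s, K)\<in>p. integral K (\<lambda>r. F' r *v g r))"
      by (simp add: sum.distrib sum_subtractf split_def)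
    also have "(\<Sum>(s, K)\<in>p. F (Sup K) *v g (Sup K) - F (Inf K) *v g (Inf K)) = F t *v g t - F 0 *v g 0"
      by (rule additive_tagged_division_1[OF t p])
    also have "(\<Sum>(s, K)\<in>p. integral K (\<lambda>r. F' r *v g r)) = integral {0..t} (\<lambda>s. F' s *v g s)"
      using integral_combine_tagged_division_topdown[of "\<lambda>r. F' r *v g r" 0 t p] int[of 0 t] p by simp
    finally have "(\<Sum>(s, K)\<in>p. F s *v (g (Sup K) - g (Inf K))) -
        (F t *v g t - F 0 *v g 0 - integral {0..t} (\<lambda>s. F' s *v g s)) = (\<Sum>(s, K)\<in>p. ?E s K)"
      by simp
    also have "norm \<dots> \<le> (\<Sum>(s, K)\<in>p. norm (?E s K))"
      unfolding split_def by (rule norm_sum)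
    \<comment> \<open>Both kinds of cell error are bounded by increments of the single function
      \<open>f\<close>, so the sum telescopes over the division.\<close>
    also have "\<dots> \<le> (\<Sum>(s, K)\<in>p. f (Sup K) - f (Inf K))"
    proof (rule sum_mono, clarify)
      fix s K assume sK: "(s, K) \<in> p"
      obtain u v where Kuv: "K = {u..v}" using tagged_division_ofD(4)[OF p sK] by (auto simp: box_real)
      have s: "u \<le> s" "s \<le> v" using tagged_division_ofD(2)[OF p sK] Kuv by auto
      have sub: "{u..v} \<subseteq> {0..t}" using tagged_division_ofD(3)[OF p sK] Kuv by simp
      then have uv: "0 \<le> u" "v \<le> t" "u \<le> v" using s by auto
      have "{u..v} \<subseteq> ball s \<delta>" using fineD[OF fine sK] Kuv by simp
      moreover have "u \<in> {u..v}" "v \<in> {u..v}" using uv by auto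
      ultimately have "u \<in> ball s \<delta>" "v \<in> ball s \<delta>" by blast+
      then have len: "v - u < 2 * \<delta>" using s by (auto simp: dist_real_def)
      have SI: "Sup K = v" "Inf K = u" using uv Kuv by auto
      have eb: "norm (?E s K) \<le> M * (\<omega> * (v - u))"
        if "\<And>x. x \<in> {u..v} \<Longrightarrow> norm (g x - g s) \<le> \<omega>" "\<omega> \<ge> 0" for \<omega>
        using stieltjes_error_bound[OF F int[OF uv(1)] _ C0 K s that] C sub
        unfolding SI unfolding Kuv by (auto simp: M_def mult.assoc)
      have mono: "\<phi> \<sigma> u \<le> \<phi> \<sigma> v" for \<sigma> using uv unfolding \<phi>_def by linarith
      have snn: "(\<Sum>\<sigma>\<in>S. \<phi> \<sigma> v - \<phi> \<sigma> u) \<ge> 0" using mono by (intro sum_nonneg) simp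
      show "norm (?E s K) \<le> f (Sup K) - f (Inf K)"
      proof (cases "S \<inter> {u..v} = {}")
        case True
        have "norm (?E s K) \<le> M * (\<eta> * (v - u))"
          using S(3)[OF uv(1,2) _ True _, of _ s] len \<delta>(2) s \<eta>
          by (intro eb) (auto simp: dist_norm intro: less_imp_le)
        also have "\<dots> \<le> f (Sup K) - f (Inf K)"
          unfolding SI f_diff using snn B0 M0 by (intro mult_left_mono) auto
        finally show ?thesis .
      next
        case False
        then obtain \<sigma> where \<sigma>: "\<sigma> \<in> S" "u \<le> \<sigma>" "\<sigma> \<le> v" by auto
        have "v - u = \<phi> \<sigma> v - \<phi> \<sigma> u" using \<sigma> len by (auto simp: \<phi>_def)
        also have "\<dots> \<le> (\<Sum>\<sigma>\<in>S. \<phi> \<sigma> v - \<phi> \<sigma> u)"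
          using mono by (intro member_le_sum[OF \<sigma>(1)] S(1)) auto
        finally have le: "v - u \<le> (\<Sum>\<sigma>\<in>S. \<phi> \<sigma> v - \<phi> \<sigma> u)" .
        have "norm (g x - g s) \<le> 2 * B" if "x \<in> {u..v}" for x
          using norm_triangle_ineq4[of "g x" "g s"] B[of x] B[of s] that s sub by (auto simp: subset_eq)
        then have "norm (?E s K) \<le> M * (2 * B * (v - u))" using B0 by (intro eb) auto
        also have "\<dots> \<le> M * (2 * B * (\<Sum>\<sigma>\<in>S. \<phi> \<sigma> v - \<phi> \<sigma> u))"
          using le B0 M0 by (intro mult_left_mono) auto
        also have "\<dots> \<le> f (Sup K) - f (Inf K)"
          unfolding SI f_diff using uv \<eta> M0 by (intro mult_left_mono) auto
        finally show ?thesis .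
      qed
    qed
    also have "\<dots> = f t - f 0" by (rule additive_tagged_division_1[OF t p])
    also have "\<dots> \<le> M * (\<eta> * t + 2 * B * (\<Sum>\<sigma>\<in>S. 4 * \<delta>))"
    proof -
      have "\<phi> \<sigma> t - \<phi> \<sigma> 0 \<le> 4 * \<delta>" for \<sigma> using \<delta>(1) unfolding \<phi>_def by linarith
      then have "(\<Sum>\<sigma>\<in>S. \<phi> \<sigma> t - \<phi> \<sigma> 0) \<le> (\<Sum>\<sigma>\<in>S. 4 * \<delta>)" by (intro sum_mono)
      then show ?thesis unfolding f_diff using M0 B0 \<eta> t by (intro mult_left_mono add_mono) auto
    qed
    also have "\<dots> = M * \<eta> * t + N * \<delta>" by (simp add: N_def algebra_simps)
    also have "\<dots> < e" using \<eta>2 N\<delta> by simp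
    finally show "norm ((\<Sum>(s, K)\<in>p. F s *v (g (Sup K) - g (Inf K))) -
        (F t *v g t - F 0 *v g 0 - integral {0..t} (\<lambda>s. F' s *v g s))) < e" .
  qed
qed

text \<open>One sequence of arbitrarily fine divisions serves twice: it makes Stieltjes integrals
  unique, and it writes them as limits of finite sums whose nodes do not depend on the path.\<close>

lemma fine_tagged_divisions:
  "\<exists>p. \<forall>n. p n tagged_division_of {0..t::real} \<and> (\<lambda>s. ball s (1 / Suc n)) fine p n"
proof (rule choice, rule allI)
  fix n
  have "gauge (\<lambda>s::real. ball s (1 / Suc n))" by (intro gauge_ball) simp
  then show "\<exists>p. p tagged_division_of {0..t} \<and> (\<lambda>s. ball s (1 / Suc n)) fine p"
    by (rule fine_division_exists_real[where a=0 and b=t]) blast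
qed

lemma has_stieltjes_integral_sequentially:
  assumes I: "has_stieltjes_integral F g 0 t I"
    and p: "\<And>n. p n tagged_division_of {0..t}" "\<And>n. (\<lambda>s. ball s (1 / Suc n)) fine p n"
  shows "(\<lambda>n. \<Sum>(s, K)\<in>p n. F s *v (g (Sup K) - g (Inf K))) \<longlonglongrightarrow> I"
proof (rule LIMSEQ_I)
  fix e :: real assume "e > 0"
  from I[unfolded has_stieltjes_integral_def, rule_format, OF this]
  obtain \<delta> where \<delta>: "\<delta> > 0" "\<forall>p. p tagged_division_of {0..t} \<and> (\<lambda>s. ball s \<delta>) fine p \<longrightarrow>
        norm ((\<Sum>(s, K)\<in>p. F s *v (g (Sup K) - g (Inf K))) - I) < e"
    by (elim exE conjE)
  obtain N where N: "inverse (real (Suc N)) < \<delta>" using reals_Archimedean[OF \<delta>(1)] by blast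
  show "\<exists>no. \<forall>n\<ge>no. norm ((\<Sum>(s, K)\<in>p n. F s *v (g (Sup K) - g (Inf K))) - I) < e"
  proof (intro exI[of _ N] allI impI \<delta>(2)[rule_format] conjI p(1))
    fix n assume "n \<ge> N"
    then have "1 / real (Suc n) \<le> inverse (real (Suc N))" by (simp add: divide_simps)
    with N have "ball s (1 / Suc n) \<subseteq> ball s \<delta>" for s :: real by (intro subset_ball) linarith
    then show "(\<lambda>s. ball s \<delta>) fine p n" using p(2)[of n] unfolding fine_def by blast
  qed
qed

lemma stieltjes_integral_eqI:
  assumes "has_stieltjes_integral F g 0 t I"
  shows "stieltjes_integral F g 0 t = I"
  unfolding stieltjes_integral_def
proof (rule the_equality[where P="has_stieltjes_integral F g 0 t", OF assms])
  fix J assume J: "has_stieltjes_integral F g 0 t J"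
  obtain p where "\<forall>n. p n tagged_division_of {0..t} \<and> (\<lambda>s. ball s (1 / Suc n)) fine p n"
    using fine_tagged_divisions[of t] by blast
  then have p: "\<And>n. p n tagged_division_of {0..t}" "\<And>n. (\<lambda>s. ball s (1 / Suc n)) fine p n" by auto
  show "J = I"
    by (rule LIMSEQ_unique[OF has_stieltjes_integral_sequentially[OF J p] has_stieltjes_integral_sequentially[OF assms p]])
qed

section \<open>The Ornstein-Uhlenbeck equation\<close>

text \<open>Quadratically small increments force a zero derivative. This replaces the product rule
  for \<open>F V\<close> below, as \<open>V\<close> is the integral of a path with jumps and need
  not be differentiable.\<close>

lemma quadratic_increments_constant:
  fixes Z :: "real \<Rightarrow> 'a::real_normed_vector"
  assumes t: "0 \<le> t" and M: "\<And>u v. 0 \<le> u \<Longrightarrow> u \<le> v \<Longrightarrow> v \<le> t \<Longrightarrow> norm (Z v - Z u) \<le> M * (v - u)\<^sup>2"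
  shows "Z t = Z 0"
proof -
  have M': "norm (Z y - Z x) \<le> M * (y - x)\<^sup>2" if "x \<in> {0..t}" "y \<in> {0..t}" for x y
    using M[of x y] M[of y x] that by (cases "x \<le> y") (auto simp: norm_minus_commute power2_commute)
  have "\<exists>c. \<forall>x\<in>{0..t}. Z x = c"
  proof (rule has_derivative_zero_constant)
    fix x assume x: "x \<in> {0..t}"
    have "((\<lambda>y. (1 / norm (y - x)) *\<^sub>R (Z y - (Z x + 0))) \<longlongrightarrow> 0) (at x within {0..t})"
    proof (rule Lim_null_comparison)
      show "\<forall>\<^sub>F y in at x within {0..t}. norm ((1 / norm (y - x)) *\<^sub>R (Z y - (Z x + 0))) \<le> M * \<bar>y - x\<bar>"
        unfolding eventually_at_filter
      proof (intro always_eventually allI impI)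
        fix y assume "y \<noteq> x" "y \<in> {0..t}"
        then show "norm ((1 / norm (y - x)) *\<^sub>R (Z y - (Z x + 0))) \<le> M * \<bar>y - x\<bar>"
          using M'[OF x, of y] by (simp add: divide_le_eq power2_eq_square mult.assoc)
      qed
      have "((\<lambda>y. M * \<bar>y - x\<bar>) \<longlongrightarrow> M * \<bar>x - x\<bar>) (at x within {0..t})"
        by (intro tendsto_intros)
      then show "((\<lambda>y. M * \<bar>y - x\<bar>) \<longlongrightarrow> 0) (at x within {0..t})" by simp
    qed
    then show "(Z has_derivative (\<lambda>h. 0)) (at x within {0..t})"
      unfolding has_derivative_within by simp
  qed auto
  then show ?thesis using t by auto
qed

lemma continuous_on_derivative:
  fixes F :: "real \<Rightarrow> 'a::real_normed_vector"
  assumes "\<And>s. (F has_vector_derivative F' s) (at s)"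
  shows "continuous_on UNIV F"
  by (auto simp: continuous_on_eq_continuous_at intro: has_vector_derivative_continuous[OF assms])

text \<open>Variation of constants: the derivative of \<open>F V\<close> with \<open>V\<close> the integral of \<open>Q X\<close> contains no
  \<open>V\<close> once \<open>X + V\<close> is replaced by the driving path, so no semigroup property of \<open>F\<close> is needed.\<close>

lemma variation_of_constants:
  fixes F :: "real \<Rightarrow> real ^ 'n ^ 'n" and X \<xi> :: "real \<Rightarrow> real ^ 'n"
  assumes t: "0 \<le> t" and X: "cadlag X" and \<xi>: "cadlag \<xi>"
    and F: "\<And>s. (F has_vector_derivative F s ** Q) (at s)"
    and eq: "\<And>s. 0 \<le> s \<Longrightarrow> X s = x0 - integral {0..s} (\<lambda>r. Q *v X r) + c *\<^sub>R \<xi> s"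
  shows "F t *v X t = F 0 *v x0 + c *\<^sub>R (F t *v \<xi> t - integral {0..t} (\<lambda>s. (F s ** Q) *v \<xi> s))"
proof -
  define V where "V s = integral {0..s} (\<lambda>r. Q *v X r)" for s
  define J where "J s = integral {0..s} (\<lambda>r. (F r ** Q) *v (x0 + c *\<^sub>R \<xi> r))" for s
  \<comment> \<open>The claim is that \<open>F V\<close> equals the integral \<open>J\<close> of its
    formal derivative; the difference \<open>Z\<close> is shown to be constant.\<close>
  define Z where "Z s = F s *v V s - J s" for s
  have Fc: "continuous_on UNIV F" by (rule continuous_on_derivative[OF F])
  have F'c: "continuous_on UNIV (\<lambda>s. F s ** Q)"
    by (intro bounded_bilinear.continuous_on[OF bounded_bilinear_matrix_matrix_mult] Fc continuous_on_const)
  have VX: "x0 + c *\<^sub>R \<xi> r = V r + X r" if "0 \<le> r" for r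
    using eq[OF that] by (simp add: V_def)
  have intQ: "(\<lambda>r. Q *v X r) integrable_on {u..v}" if "0 \<le> u" for u v
    using cadlag_mult_integrable[OF X continuous_on_const that, of Q] .
  have int\<xi>: "(\<lambda>r. (F r ** Q) *v \<xi> r) integrable_on {u..v}" if "0 \<le> u" for u v
    by (rule cadlag_mult_integrable[OF \<xi> F'c that])
  have Fx: "((\<lambda>r. (F r ** Q) *v x) has_integral (F v - F u) *v x) {u..v}" if "u \<le> v" for u v x
    by (rule derivative_has_integral_vector[OF F that])
  have intJ: "(\<lambda>r. (F r ** Q) *v (x0 + c *\<^sub>R \<xi> r)) integrable_on {u..v}" if "0 \<le> u" "u \<le> v" for u v
    unfolding matrix_vector_right_distrib matrix_vector_mult_scaleR
    by (intro integrable_add integrable_cmul int\<xi> that has_integral_integrable[OF Fx])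
  obtain K where K: "K \<ge> 0" "\<And>A x. norm ((A :: real ^ 'n ^ 'n) *v (x :: real ^ 'n)) \<le> K * (norm A * norm x)"
    by (rule norm_matrix_vector_bound[where 'n='n and 'm='n]) blast
  obtain B where B: "\<And>s. s \<in> {0..t} \<Longrightarrow> norm (X s) \<le> B"
    using cadlag_bounded[OF X, of t] unfolding bounded_iff by blast
  define B1 where "B1 = K * (norm Q * B)"
  have B1: "norm (Q *v X s) \<le> B1" if "s \<in> {0..t}" for s
    unfolding B1_def using K(1) B[OF that] by (intro order_trans[OF K(2)] mult_left_mono) auto
  have B10: "B1 \<ge> 0" using order_trans[OF norm_ge_zero B1[of 0]] t by simp
  have "bounded ((\<lambda>s. F s ** Q) ` {0..t})"
    using F'c by (intro compact_imp_bounded compact_continuous_image) (auto intro: continuous_on_subset)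
  then obtain C where C: "\<And>s. s \<in> {0..t} \<Longrightarrow> norm (F s ** Q) \<le> C"
    unfolding bounded_iff by blast
  have C0: "C \<ge> 0" using order_trans[OF norm_ge_zero C[of 0]] t by simp
  have Vi: "((\<lambda>r. Q *v X r) has_integral V v - V u) {u..v}" if "0 \<le> u" "u \<le> v" for u v
  proof -
    have "V v = V u + integral {u..v} (\<lambda>r. Q *v X r)"
      unfolding V_def using that intQ[of 0 v] by (simp add: Henstock_Kurzweil_Integration.integral_combine)
    then show ?thesis using integrable_integral[OF intQ[OF that(1)], of v] by simp
  qed
  have Ji: "((\<lambda>r. (F r ** Q) *v (V r + X r)) has_integral J v - J u) {u..v}" if "0 \<le> u" "u \<le> v" for u v
  proof -
    have "J v = J u + integral {u..v} (\<lambda>r. (F r ** Q) *v (x0 + c *\<^sub>R \<xi> r))"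
      unfolding J_def using that intJ[of 0 v] by (simp add: Henstock_Kurzweil_Integration.integral_combine)
    then have "((\<lambda>r. (F r ** Q) *v (x0 + c *\<^sub>R \<xi> r)) has_integral J v - J u) {u..v}"
      using integrable_integral[OF intJ[OF that]] by simp
    then show ?thesis
      by (rule has_integral_eq[rotated]) (use VX that in auto)
  qed
  have "Z t = Z 0"
  proof (rule quadratic_increments_constant[OF t])
    fix u v assume uv: "0 \<le> u" "u \<le> v" "v \<le> t"
    have sub: "r \<in> {0..t}" if "r \<in> {u..v}" for r using that uv by auto
    \<comment> \<open>The increment of \<open>Z\<close> over \<open>{u..v}\<close> written as one
      integral, with \<open>F\<close> frozen at \<open>v\<close> and \<open>V\<close> frozen at
      \<open>u\<close> as in the discrete product rule.\<close>
    let ?h = "\<lambda>r. F v *v (Q *v X r) + (F r ** Q) *v V u - (F r ** Q) *v (V r + X r)"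
    have "((\<lambda>r. F v *v (Q *v X r)) has_integral F v *v (V v - V u)) {u..v}"
      using has_integral_linear[OF Vi[OF uv(1,2)] matrix_vector_mul_bounded_linear[of "F v"]] by (simp add: o_def)
    then have "(?h has_integral (F v *v (V v - V u) + (F v - F u) *v V u - (J v - J u))) {u..v}"
      by (intro has_integral_diff has_integral_add Fx Ji uv)
    moreover have "F v *v (V v - V u) + (F v - F u) *v V u - (J v - J u) = Z v - Z u"
      by (simp add: Z_def matrix_vector_mult_diff_distrib matrix_vector_mult_diff_rdistrib)
    ultimately have hi: "(?h has_integral (Z v - Z u)) {u..v}" by simp
    have Vlip: "norm (V u - V r) \<le> B1 * (v - u)" if r: "r \<in> {u..v}" for r
    proof -
      have ur: "u \<le> r" "r \<le> v" using r by auto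
      have "norm (V r - V u) \<le> B1 * measure lborel {u..r}"
        using B1 sub r by (intro has_integral_bound_real[OF B10 _ Vi[OF uv(1) ur(1)], of "{}"]) auto
      also have "\<dots> \<le> B1 * (v - u)" using ur B10 by (simp add: mult_left_mono)
      finally show ?thesis by (simp add: norm_minus_commute)
    qed
    have Flip: "norm (F v - F r) \<le> C * (v - u)" if r: "r \<in> {u..v}" for r
    proof -
      have ur: "u \<le> r" "r \<le> v" using r by auto
      have "norm (F v - F r) \<le> C * (v - r)"
        using C sub r by (intro lipschitz_from_derivative[OF F ur(2) _ C0]) auto
      also have "\<dots> \<le> C * (v - u)" using ur C0 by (simp add: mult_left_mono)
      finally show ?thesis .
    qed
    have "norm (?h r) \<le> 2 * K * C * B1 * (v - u)" if r: "r \<in> {u..v}" for r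
    proof -
      \<comment> \<open>The zeroth-order terms cancel. What remains has a factor of order
        \<open>v - u\<close>, and integration over the interval supplies the second one.\<close>
      have "?h r = (F v - F r) *v (Q *v X r) + (F r ** Q) *v (V u - V r)"
        by (simp add: matrix_vector_mult_diff_distrib matrix_vector_mult_diff_rdistrib
            matrix_vector_right_distrib flip: matrix_vector_mul_assoc)
      also have "norm \<dots> \<le> norm ((F v - F r) *v (Q *v X r)) + norm ((F r ** Q) *v (V u - V r))"
        by (rule norm_triangle_ineq)
      also have "\<dots> \<le> K * ((C * (v - u)) * B1) + K * (C * (B1 * (v - u)))"
      proof (rule add_mono)
        show "norm ((F v - F r) *v (Q *v X r)) \<le> K * ((C * (v - u)) * B1)"
          by (rule order_trans[OF K(2)])
             (use K(1) C0 uv Flip[OF r] B1[OF sub[OF r]] in \<open>intro mult_left_mono mult_mono; simp\<close>)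
        show "norm ((F r ** Q) *v (V u - V r)) \<le> K * (C * (B1 * (v - u)))"
          by (rule order_trans[OF K(2)])
             (use K(1) C0 Vlip[OF r] C[OF sub[OF r]] in \<open>intro mult_left_mono mult_mono; simp\<close>)
      qed
      finally show ?thesis by (simp add: algebra_simps)
    qed
    then have "norm (Z v - Z u) \<le> (2 * K * C * B1 * (v - u)) * measure lborel {u..v}"
      using K(1) C0 B10 uv by (intro has_integral_bound_real[OF _ _ hi, of _ "{}"]) auto
    then show "norm (Z v - Z u) \<le> (2 * K * C * B1) * (v - u)\<^sup>2"
      using uv by (simp add: power2_eq_square mult.assoc)
  qed
  also have "Z 0 = 0" by (simp add: Z_def V_def J_def)
  finally have "F t *v V t = J t" by (simp add: Z_def)
  moreover have "J t = (F t - F 0) *v x0 + c *\<^sub>R integral {0..t} (\<lambda>s. (F s ** Q) *v \<xi> s)"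
    unfolding J_def matrix_vector_right_distrib matrix_vector_mult_scaleR
    by (intro integral_unique has_integral_add has_integral_cmul integrable_integral int\<xi> Fx t) simp
  moreover have "X t = x0 + c *\<^sub>R \<xi> t - V t" using VX[OF t] by (simp add: algebra_simps)
  ultimately show ?thesis
    by (simp add: matrix_vector_right_distrib matrix_vector_mult_diff_distrib
        matrix_vector_mult_diff_rdistrib matrix_vector_mult_scaleR scaleR_right_diff_distrib)
qed

lemma mexp_kernel_derivative:
  "((\<lambda>s. mexp (- (t - s) *\<^sub>R Q)) has_vector_derivative mexp (- (t - s) *\<^sub>R Q) ** Q) (at s)"
proof -
  have "((\<lambda>s. s - t) has_vector_derivative 1) (at s)"
    by (auto intro!: derivative_eq_intros)
  from vector_diff_chain_at[OF this mexp_has_vector_derivative[of Q "s - t" UNIV]]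
  show ?thesis by (simp add: o_def)
qed

lemma cadlag_diff_linear:
  fixes g :: "real \<Rightarrow> 'a::real_normed_vector"
  assumes "cadlag g"
  shows "cadlag (\<lambda>s. g s - s *\<^sub>R a)"
  unfolding cadlag_def
proof (intro conjI allI impI)
  fix t :: real assume "0 \<le> t"
  then show "continuous (at_right t) (\<lambda>s. g s - s *\<^sub>R a)"
    using assms by (intro continuous_intros) (auto simp: cadlag_def)
next
  fix t :: real assume "0 < t"
  then obtain y where "(g \<longlongrightarrow> y) (at_left t)" using assms by (auto simp: cadlag_def)
  then have "((\<lambda>s. g s - s *\<^sub>R a) \<longlongrightarrow> y - t *\<^sub>R a) (at_left t)" by (intro tendsto_intros)
  then show "\<exists>y. ((\<lambda>s. g s - s *\<^sub>R a) \<longlongrightarrow> y) (at_left t)" by blast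
qed

text \<open>Integration by parts gives existence and value together, so the definite description in
  \<open>I_nat\<close> denotes the integral. The term with \<open>\<xi> 0 \<omega>\<close> remains
  because the path starts at 0 only almost surely.\<close>

lemma I_nat_has_stieltjes_integral:
  fixes Q :: "real ^ 'n ^ 'n"
  assumes t: "0 \<le> t" and \<xi>: "cadlag (\<lambda>s. \<xi> s \<omega>)"
  shows "has_stieltjes_integral (\<lambda>s. mexp (- (t - s) *\<^sub>R Q)) (\<lambda>s. \<xi> s \<omega> - s *\<^sub>R a) 0 t (I_nat \<xi> a Q t \<omega>)"
    and "I_nat \<xi> a Q t \<omega> = \<xi> t \<omega> - t *\<^sub>R a - mexp (- t *\<^sub>R Q) *v \<xi> 0 \<omega>
      - integral {0..t} (\<lambda>s. (mexp (- (t - s) *\<^sub>R Q) ** Q) *v (\<xi> s \<omega> - s *\<^sub>R a))"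
proof -
  let ?F = "\<lambda>s. mexp (- (t - s) *\<^sub>R Q)"
  have c: "continuous_on UNIV (\<lambda>s. ?F s ** Q)"
    by (intro bounded_bilinear.continuous_on[OF bounded_bilinear_matrix_matrix_mult] continuous_on_const
        continuous_on_derivative[OF mexp_kernel_derivative])
  note S = stieltjes_by_parts[OF t cadlag_diff_linear[OF \<xi>, of a] mexp_kernel_derivative c]
  note I = stieltjes_integral_eqI[OF S]
  show "has_stieltjes_integral ?F (\<lambda>s. \<xi> s \<omega> - s *\<^sub>R a) 0 t (I_nat \<xi> a Q t \<omega>)"
    unfolding I_nat_def I by (rule S)
  show "I_nat \<xi> a Q t \<omega> = \<xi> t \<omega> - t *\<^sub>R a - mexp (- t *\<^sub>R Q) *v \<xi> 0 \<omega>
      - integral {0..t} (\<lambda>s. (mexp (- (t - s) *\<^sub>R Q) ** Q) *v (\<xi> s \<omega> - s *\<^sub>R a))"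
    unfolding I_nat_def I by simp
qed

text \<open>The integral of the kernel against \<open>a\<close>, in the form that integration by
  parts gives it, so that it combines directly with the formula for \<open>I_nat\<close>.\<close>

definition drift_part :: "real ^ 'n \<Rightarrow> real ^ 'n ^ 'n \<Rightarrow> real \<Rightarrow> real ^ 'n" where
  "drift_part a Q t = t *\<^sub>R a - integral {0..t} (\<lambda>s. (mexp (- (t - s) *\<^sub>R Q) ** Q) *v (s *\<^sub>R a))"

lemma ou_path_representation:
  fixes Q :: "real ^ 'n ^ 'n"
  assumes t: "0 \<le> t" and X: "cadlag X" and \<xi>: "cadlag (\<lambda>s. \<xi> s \<omega>)" and \<xi>0: "\<xi> 0 \<omega> = 0"
    and eq: "\<And>s. 0 \<le> s \<Longrightarrow> X s = x0 - integral {0..s} (\<lambda>r. Q *v X r) + c *\<^sub>R \<xi> s \<omega>"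
  shows "X t = mexp (- t *\<^sub>R Q) *v x0 + c *\<^sub>R (drift_part a Q t + I_nat \<xi> a Q t \<omega>)"
proof -
  let ?F = "\<lambda>s. mexp (- (t - s) *\<^sub>R Q)"
  have c: "continuous_on UNIV (\<lambda>s. ?F s ** Q)"
    by (intro bounded_bilinear.continuous_on[OF bounded_bilinear_matrix_matrix_mult] continuous_on_const
        continuous_on_derivative[OF mexp_kernel_derivative])
  have "cadlag (\<lambda>s. s *\<^sub>R a)"
    unfolding cadlag_def by (auto intro!: continuous_intros exI tendsto_intros)
  then have ia: "(\<lambda>s. (?F s ** Q) *v (s *\<^sub>R a)) integrable_on {0..t}"
    by (rule cadlag_mult_integrable[OF _ c order_refl])
  have i\<xi>: "(\<lambda>s. (?F s ** Q) *v \<xi> s \<omega>) integrable_on {0..t}"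
    by (rule cadlag_mult_integrable[OF \<xi> c order_refl])
  have "integral {0..t} (\<lambda>s. (?F s ** Q) *v (\<xi> s \<omega> - s *\<^sub>R a))
      = integral {0..t} (\<lambda>s. (?F s ** Q) *v \<xi> s \<omega>) - integral {0..t} (\<lambda>s. (?F s ** Q) *v (s *\<^sub>R a))"
    unfolding matrix_vector_mult_diff_distrib
    by (rule Henstock_Kurzweil_Integration.integral_diff[OF i\<xi> ia])
  then have "drift_part a Q t + I_nat \<xi> a Q t \<omega> = \<xi> t \<omega> - integral {0..t} (\<lambda>s. (?F s ** Q) *v \<xi> s \<omega>)"
    unfolding I_nat_has_stieltjes_integral(2)[where \<xi>=\<xi>, OF t \<xi>] drift_part_def by (simp add: \<xi>0)
  then show ?thesis
    using variation_of_constants[OF t X \<xi> mexp_kernel_derivative[where t=t and Q=Q] eq] by simp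
qed

text \<open>The approximating sums use the same divisions for all \<open>\<omega>\<close>, so they
  are finite linear images of increments of \<open>\<xi>\<close>, and their limit is
  measurable.\<close>

lemma (in prob_space) measurable_I_nat:
  fixes Q :: "real ^ 'n ^ 'n"
  assumes t: "0 \<le> t" and meas: "\<And>s. 0 \<le> s \<Longrightarrow> random_variable borel (\<xi> s)"
    and cad: "\<And>\<omega>. \<omega> \<in> space M \<Longrightarrow> cadlag (\<lambda>s. \<xi> s \<omega>)"
  shows "random_variable borel (I_nat \<xi> a Q t)"
proof -
  obtain p where "\<forall>n. p n tagged_division_of {0..t} \<and> (\<lambda>s. ball s (1 / Suc n)) fine p n"
    using fine_tagged_divisions[of t] by blast
  then have p: "\<And>n. p n tagged_division_of {0..t}" "\<And>n. (\<lambda>s. ball s (1 / Suc n)) fine p n" by auto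
  show ?thesis
  proof (rule borel_measurable_LIMSEQ_metric)
    fix \<omega> assume "\<omega> \<in> space M"
    then show "(\<lambda>n. \<Sum>(s, K)\<in>p n. mexp (- (t - s) *\<^sub>R Q) *v ((\<xi> (Sup K) \<omega> - Sup K *\<^sub>R a) - (\<xi> (Inf K) \<omega> - Inf K *\<^sub>R a)))
        \<longlonglongrightarrow> I_nat \<xi> a Q t \<omega>"
      by (intro has_stieltjes_integral_sequentially[OF I_nat_has_stieltjes_integral(1)[where \<xi>=\<xi>, OF t cad] p])
  next
    fix n
    show "(\<lambda>\<omega>. \<Sum>(s, K)\<in>p n. mexp (- (t - s) *\<^sub>R Q) *v ((\<xi> (Sup K) \<omega> - Sup K *\<^sub>R a) - (\<xi> (Inf K) \<omega> - Inf K *\<^sub>R a)))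
        \<in> borel_measurable M"
      unfolding split_def
    proof (rule borel_measurable_sum)
      fix sK assume "sK \<in> p n"
      then have sK: "(fst sK, snd sK) \<in> p n" by simp
      obtain u v where K: "snd sK = {u..v}" using tagged_division_ofD(4)[OF p(1) sK] by (auto simp: box_real)
      have "fst sK \<in> snd sK" "snd sK \<subseteq> {0..t}" using tagged_division_ofD(2,3)[OF p(1) sK] by auto
      \<comment> \<open>The endpoints must be nonnegative, as \<open>\<xi>\<close> is known to be
        measurable only at such times.\<close>
      then have "0 \<le> u" "u \<le> v" using K by auto
      then have "Inf (snd sK) = u" "Sup (snd sK) = v" "0 \<le> u" "0 \<le> v" using K by auto
      then have "(\<lambda>\<omega>. (\<xi> (Sup (snd sK)) \<omega> - Sup (snd sK) *\<^sub>R a) - (\<xi> (Inf (snd sK)) \<omega> - Inf (snd sK) *\<^sub>R a)) \<in> borel_measurable M"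
        using meas[of u] meas[of v] by simp
      then show "(\<lambda>\<omega>. mexp (- (t - fst sK) *\<^sub>R Q) *v ((\<xi> (Sup (snd sK)) \<omega> - Sup (snd sK) *\<^sub>R a) - (\<xi> (Inf (snd sK)) \<omega> - Inf (snd sK) *\<^sub>R a)))
          \<in> borel_measurable M"
        by (rule borel_measurable_continuous_on[OF linear_continuous_on[OF matrix_vector_mul_bounded_linear]])
    qed
  qed
qed

section \<open>Distance to equilibrium as distance between translates\<close>

lemma cf_Re_Im:
  fixes P :: "(real ^ 'n) measure"
  assumes P: "prob_space P" "sets P = sets borel"
  shows "cf P z = of_real (\<integral>x. cos (z \<bullet> x) \<partial>P) + \<i> * of_real (\<integral>x. sin (z \<bullet> x) \<partial>P)"
proof -
  have "integrable P (\<lambda>x. complex_of_real (cos (z \<bullet> x)))" "integrable P (\<lambda>x. complex_of_real (sin (z \<bullet> x)))"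
    by (rule integrable_prob_borel[OF P, where B=1]; simp)+
  moreover have "exp (\<i> * of_real (z \<bullet> x)) = complex_of_real (cos (z \<bullet> x)) + \<i> * complex_of_real (sin (z \<bullet> x))" for x
    by (simp add: exp_Euler cos_of_real sin_of_real)
  ultimately show ?thesis
    unfolding cf_def by simp
qed

text \<open>Convergence in law is tested by real functions, hence the split into cosine and sine,
  both continuous and bounded by 1.\<close>

lemma limit_law_cf:
  fixes P :: "real \<Rightarrow> (real ^ 'n) measure"
  assumes L: "limit_law P L" and P: "\<And>t. t > 0 \<Longrightarrow> prob_space (P t)" "\<And>t. t > 0 \<Longrightarrow> sets (P t) = sets borel"
  shows "((\<lambda>t. cf (P t) z) \<longlongrightarrow> cf L z) at_top"
proof -
  have *: "((\<lambda>t. \<integral>x. f x \<partial>P t) \<longlongrightarrow> (\<integral>x. f x \<partial>L)) at_top"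
    if "continuous_on UNIV f" "\<And>x. \<bar>f x\<bar> \<le> 1" for f :: "real ^ 'n \<Rightarrow> real"
    using L that unfolding limit_law_def bounded_iff by auto
  have "((\<lambda>t. of_real (\<integral>x. cos (z \<bullet> x) \<partial>P t) + \<i> * of_real (\<integral>x. sin (z \<bullet> x) \<partial>P t))
     \<longlongrightarrow> complex_of_real (\<integral>x. cos (z \<bullet> x) \<partial>L) + \<i> * of_real (\<integral>x. sin (z \<bullet> x) \<partial>L)) at_top"
    by (intro tendsto_intros *) (auto intro!: continuous_intros)
  moreover have "\<forall>\<^sub>F t in at_top. of_real (\<integral>x. cos (z \<bullet> x) \<partial>P t) + \<i> * of_real (\<integral>x. sin (z \<bullet> x) \<partial>P t) = cf (P t) z"
    using eventually_gt_at_top[of 0] by eventually_elim (simp add: cf_Re_Im P)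
  ultimately have "((\<lambda>t. cf (P t) z) \<longlongrightarrow> complex_of_real (\<integral>x. cos (z \<bullet> x) \<partial>L) + \<i> * of_real (\<integral>x. sin (z \<bullet> x) \<partial>L)) at_top"
    by (rule Lim_transform_eventually)
  then show ?thesis
    using L by (simp add: cf_Re_Im limit_law_def)
qed

lemma measurable_affine: "(\<lambda>x. b + s *\<^sub>R x) \<in> borel \<rightarrow>\<^sub>M (borel :: 'a::euclidean_space measure)"
  by (intro borel_measurable_continuous_onI continuous_intros)

lemma cf_affine:
  fixes P :: "(real ^ 'n) measure"
  assumes P: "sets P = sets borel"
  shows "cf (distr P borel (\<lambda>x. b + s *\<^sub>R x)) z = exp (\<i> * of_real (z \<bullet> b)) * cf P (s *\<^sub>R z)"
proof -
  have m: "(\<lambda>x. b + s *\<^sub>R x) \<in> P \<rightarrow>\<^sub>M borel"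
    unfolding measurable_cong_sets[OF P refl] by (rule measurable_affine)
  have "cf (distr P borel (\<lambda>x. b + s *\<^sub>R x)) z = (\<integral>x. exp (\<i> * of_real (z \<bullet> (b + s *\<^sub>R x))) \<partial>P)"
    unfolding cf_def by (rule integral_distr[OF m]) measurable
  also have "\<dots> = (\<integral>x. exp (\<i> * of_real (z \<bullet> b)) * exp (\<i> * of_real (s *\<^sub>R z \<bullet> x)) \<partial>P)"
    by (simp add: inner_add_right distrib_left exp_add)
  finally show ?thesis unfolding cf_def by simp
qed

lemma prob_space_affine:
  fixes P :: "'a::euclidean_space measure"
  assumes "prob_space P" "sets P = sets borel"
  shows "prob_space (distr P borel (\<lambda>x. b + s *\<^sub>R x))"
proof -
  have "(\<lambda>x. b + s *\<^sub>R x) \<in> P \<rightarrow>\<^sub>M borel"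
    unfolding measurable_cong_sets[OF assms(2) refl] by (rule measurable_affine)
  then show ?thesis by (rule prob_space.prob_space_distr[OF assms(1)])
qed

lemma distr_affine_shift:
  fixes P :: "'a::euclidean_space measure"
  assumes P: "sets P = sets borel"
  shows "distr (distr P borel ((+) y)) borel (\<lambda>x. b + s *\<^sub>R x) = distr P borel (\<lambda>x. (b + s *\<^sub>R y) + s *\<^sub>R x)"
proof -
  have "(+) y \<in> P \<rightarrow>\<^sub>M borel"
    unfolding measurable_cong_sets[OF P refl] by (rule measurable_shift)
  then show ?thesis
    by (subst distr_distr[OF measurable_affine]) (simp_all add: o_def scaleR_add_right add.assoc)
qed

text \<open>A deterministic shift of both arguments cancels in the total variation distance; hence the
  distances of \<open>y + J\<close> to \<open>J\<close> and of \<open>y + I\<close> to \<open>I\<close> agree when \<open>J\<close> is a translate of \<open>I\<close>, and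
  neither the drift nor its limit enters the final error.\<close>

lemma tv_dist_shift_error:
  fixes I I' J' :: "'a::euclidean_space measure"
  assumes I: "prob_space I" "sets I = sets borel" and I': "prob_space I'" "sets I' = sets borel"
    and J': "prob_space J'" and J: "J = distr I borel ((+) d)"
  shows "\<bar>tv_dist (distr J borel ((+) y)) J' - tv_dist (distr I' borel ((+) y)) I'\<bar>
           \<le> tv_dist J J' + 2 * tv_dist I I'"
proof -
  have pJ: "prob_space J" "sets J = sets borel" using prob_space_shift[OF I] J by auto
  note ps = I(1) I'(1) J' pJ(1) prob_space_shift[OF I] prob_space_shift[OF I'] prob_space_shift[OF pJ]
  have m: "(+) c \<in> I \<rightarrow>\<^sub>M borel" for c
    unfolding measurable_cong_sets[OF I(2) refl] by (rule measurable_shift)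
  have "distr J borel ((+) y) = distr (distr I borel ((+) y)) borel ((+) d)"
    unfolding J distr_distr[OF measurable_shift m] by (simp add: o_def add.left_commute)
  then have 1: "tv_dist (distr J borel ((+) y)) J = tv_dist (distr I borel ((+) y)) I"
    unfolding J by (simp only:)
      (rule tv_dist_distr_eq[OF prob_space_shift[OF I] sets_distr I measurable_shift measurable_shift[of "- d"]], simp)
  have 2: "tv_dist (distr I borel ((+) y)) (distr I' borel ((+) y)) = tv_dist I I'"
    by (rule tv_dist_distr_eq[OF I I' measurable_shift measurable_shift[of "- y"]]) simp
  have "tv_dist (distr J borel ((+) y)) J' \<le> tv_dist (distr J borel ((+) y)) J + tv_dist J J'"
    "tv_dist (distr J borel ((+) y)) J \<le> tv_dist (distr J borel ((+) y)) J' + tv_dist J J'"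
    "tv_dist (distr I borel ((+) y)) I \<le> tv_dist (distr I borel ((+) y)) (distr I' borel ((+) y)) + tv_dist (distr I' borel ((+) y)) I"
    "tv_dist (distr I' borel ((+) y)) I \<le> tv_dist (distr I' borel ((+) y)) I' + tv_dist I I'"
    "tv_dist (distr I' borel ((+) y)) I' \<le> tv_dist (distr I borel ((+) y)) (distr I' borel ((+) y)) + tv_dist (distr I borel ((+) y)) I'"
    "tv_dist (distr I borel ((+) y)) I' \<le> tv_dist (distr I borel ((+) y)) I + tv_dist I I'"
    using tv_dist_triangle[of "distr J borel ((+) y)" J J'] tv_dist_triangle[of "distr J borel ((+) y)" J' J]
      tv_dist_triangle[of "distr I borel ((+) y)" "distr I' borel ((+) y)" I]
      tv_dist_triangle[of "distr I' borel ((+) y)" I' I]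
      tv_dist_triangle[of "distr I' borel ((+) y)" "distr I borel ((+) y)" I']
      tv_dist_triangle[of "distr I borel ((+) y)" I I']
      tv_dist_commute[of J' J] tv_dist_commute[of I' I]
      tv_dist_commute[of "distr I' borel ((+) y)" "distr I borel ((+) y)"] ps
    by simp_all
  then show ?thesis using 1 2 by linarith
qed

text \<open>The processes for all \<open>\<epsilon>\<close> and the equilibria are images under
  multiplication by \<open>sqrt \<epsilon>\<close>, which leaves total variation unchanged. The
  error therefore depends on \<open>t\<close> alone, and only the shift by
  \<open>1 / sqrt \<epsilon>\<close> times the flow remembers \<open>\<epsilon>\<close>.\<close>

theorem ou_tv_dist_approximation:
  fixes Q :: "real ^ 'n ^ 'n" and Iinf :: "(real ^ 'n) measure"
  assumes M: "prob_space M"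
    and levy: "prob_space.levy_process M \<xi> a S \<nu>"
    and H: "condition_H (\<lambda>t. distr M borel (I_nat \<xi> a Q t))"
    and Iinf: "limit_law (\<lambda>t. distr M borel (I_nat \<xi> a Q t)) Iinf"
    and X: "\<And>\<epsilon>. \<epsilon> > 0 \<Longrightarrow> prob_space.ou_process M \<xi> Q x0 \<epsilon> (X \<epsilon>)"
    and Xinf: "\<And>\<epsilon>. \<epsilon> > 0 \<Longrightarrow> limit_law (\<lambda>t. distr M borel (X \<epsilon> t)) (Xinf \<epsilon>)"
    and h: "((\<lambda>t. mexp ((- t) *\<^sub>R Q) *v x0) \<longlongrightarrow> 0) at_top"
  obtains err where "(err \<longlongrightarrow> 0) at_top"
    "\<And>\<epsilon> t. \<epsilon> > 0 \<Longrightarrow> t > 0 \<Longrightarrow>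
       \<bar>tv_dist (distr M borel (X \<epsilon> t)) (Xinf \<epsilon>)
         - tv_dist (distr Iinf borel ((+) ((1 / sqrt \<epsilon>) *\<^sub>R (mexp ((- t) *\<^sub>R Q) *v x0)))) Iinf\<bar> \<le> err t"
    "integrable lborel (cf Iinf)"
proof -
  interpret prob_space M by fact
  define I where "I t = distr M borel (I_nat \<xi> a Q t)" for t
  define J where "J t = distr (I t) borel ((+) (drift_part a Q t))" for t
  define h where "h t = mexp ((- t) *\<^sub>R Q) *v x0" for t
  have meas: "random_variable borel (\<xi> s)" if "0 \<le> s" for s
    using levy that by (auto simp: levy_process_def)
  have cad: "cadlag (\<lambda>t. \<xi> t \<omega>)" if "\<omega> \<in> space M" for \<omega>
    using levy that by (auto simp: levy_process_def)
  have \<xi>0: "AE \<omega> in M. \<xi> 0 \<omega> = 0" using levy by (auto simp: levy_process_def)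
  have mI: "random_variable borel (I_nat \<xi> a Q t)" if "t > 0" for t
    using that by (intro measurable_I_nat meas cad) auto
  have I: "prob_space (I t)" "sets (I t) = sets borel" if "t > 0" for t
    using prob_space_distr[OF mI[OF that]] by (auto simp: I_def)
  have J: "prob_space (J t)" "sets (J t) = sets borel" if "t > 0" for t
    using prob_space_shift[OF I[OF that]] by (auto simp: J_def)
  have lawX: "distr M borel (X \<epsilon> t) = distr (J t) borel (\<lambda>x. h t + sqrt \<epsilon> *\<^sub>R x)"
    if e: "\<epsilon> > 0" and t: "t > 0" for \<epsilon> t
  proof -
    have mX: "random_variable borel (X \<epsilon> t)" using X[OF e] t by (auto simp: ou_process_def)
    have AE: "AE \<omega> in M. X \<epsilon> t \<omega> = h t + sqrt \<epsilon> *\<^sub>R (drift_part a Q t + I_nat \<xi> a Q t \<omega>)"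
    proof -
      have "AE \<omega> in M. cadlag (\<lambda>t. X \<epsilon> t \<omega>) \<and>
        (\<forall>t\<ge>0. X \<epsilon> t \<omega> = x0 - integral {0..t} (\<lambda>s. Q *v X \<epsilon> s \<omega>) + sqrt \<epsilon> *\<^sub>R \<xi> t \<omega>)"
        using X[OF e] by (auto simp: ou_process_def)
      with \<xi>0 AE_space show ?thesis
      proof eventually_elim
        case (elim \<omega>)
        then show ?case
          unfolding h_def
          by (intro ou_path_representation[where X="\<lambda>t. X \<epsilon> t \<omega>" and \<xi>=\<xi> and \<omega>=\<omega> and c="sqrt \<epsilon>",
                OF less_imp_le[OF t]] cad) auto
      qed
    qed
    have "distr M borel (X \<epsilon> t) = distr M borel (\<lambda>\<omega>. h t + sqrt \<epsilon> *\<^sub>R (drift_part a Q t + I_nat \<xi> a Q t \<omega>))"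
      by (rule distr_cong_AE[OF refl refl AE mX]) (use mI[OF t] in measurable)
    also have "\<dots> = distr (J t) borel (\<lambda>x. h t + sqrt \<epsilon> *\<^sub>R x)"
      unfolding J_def I_def distr_distr[OF measurable_shift mI[OF t]]
      using measurable_compose[OF mI[OF t] measurable_shift]
      by (subst distr_distr[OF measurable_affine]) (simp_all add: o_def)
    finally show ?thesis .
  qed
  have cfI: "((\<lambda>t. cf (I t) z) \<longlongrightarrow> cf Iinf z) at_top" for z
    using limit_law_cf[OF Iinf[folded I_def] I] .
  have h0: "((\<lambda>t. exp (\<i> * of_real (z \<bullet> h t))) \<longlongrightarrow> 1) at_top" "((\<lambda>t. exp (- \<i> * of_real (z \<bullet> h t))) \<longlongrightarrow> 1) at_top" for z
    using tendsto_exp[OF tendsto_mult[OF tendsto_const tendsto_of_real[OF tendsto_inner[OF tendsto_const h]]], of "\<i>" z]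
      tendsto_exp[OF tendsto_mult[OF tendsto_const tendsto_of_real[OF tendsto_inner[OF tendsto_const h]]], of "- \<i>" z]
    by (simp_all add: h_def)
  have X1: "prob_space (distr M borel (X \<epsilon> t))" "sets (distr M borel (X \<epsilon> t)) = sets borel" if "\<epsilon> > 0" "t > 0" for \<epsilon> t
    using X[OF that(1)] that(2) by (auto simp: ou_process_def intro!: prob_space_distr)
  have cfX: "cf (distr M borel (X \<epsilon> t)) z = exp (\<i> * of_real (z \<bullet> h t)) * cf (J t) (sqrt \<epsilon> *\<^sub>R z)"
    if "\<epsilon> > 0" "t > 0" for \<epsilon> t z
    unfolding lawX[OF that] by (rule cf_affine[OF J(2)[OF that(2)]])
  have Xl: "prob_space (Xinf \<epsilon>)" "sets (Xinf \<epsilon>) = sets borel" if "\<epsilon> > 0" for \<epsilon>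
    using Xinf[OF that] by (auto simp: limit_law_def)
  have Il: "prob_space Iinf" "sets Iinf = sets borel" using Iinf by (auto simp: limit_law_def)
  have cfXl: "((\<lambda>t. cf (distr M borel (X \<epsilon> t)) z) \<longlongrightarrow> cf (Xinf \<epsilon>) z) at_top" if "\<epsilon> > 0" for \<epsilon> z
    by (rule limit_law_cf[OF Xinf[OF that] X1[OF that]])
  \<comment> \<open>For \<open>\<epsilon> = 1\<close> the process at time \<open>t\<close> is
    \<open>J t\<close> shifted by \<open>h t\<close>. The shift vanishes in the limit, so
    \<open>J t\<close> has the limiting characteristic function of \<open>Xinf 1\<close>.\<close>
  have cfJ: "((\<lambda>t. cf (J t) z) \<longlongrightarrow> cf (Xinf 1) z) at_top" for z
  proof -
    have "((\<lambda>t. exp (- \<i> * of_real (z \<bullet> h t)) * cf (distr M borel (X 1 t)) z) \<longlongrightarrow> 1 * cf (Xinf 1) z) at_top"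
      by (intro tendsto_mult h0 cfXl) simp
    moreover have "\<forall>\<^sub>F t in at_top. exp (- \<i> * of_real (z \<bullet> h t)) * cf (distr M borel (X 1 t)) z = cf (J t) z"
      using eventually_gt_at_top[of 0]
    proof eventually_elim
      case (elim t)
      have "exp (- \<i> * of_real (z \<bullet> h t)) * exp (\<i> * of_real (z \<bullet> h t)) = 1"
        by (simp flip: exp_add)
      then show ?case using cfX[of 1 t z] elim by (simp flip: mult.assoc)
    qed
    ultimately show ?thesis by (auto intro: Lim_transform_eventually)
  qed
  \<comment> \<open>Both sides have the same characteristic function, obtained as a limit of those
    of \<open>X \<epsilon> t\<close>; \<open>cf_unique\<close> upgrades this to equality of
    laws.\<close>
  have Xscale: "Xinf \<epsilon> = distr (Xinf 1) borel (\<lambda>x. 0 + sqrt \<epsilon> *\<^sub>R x)" if e: "\<epsilon> > 0" for \<epsilon>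
  proof (rule cf_unique[OF Xl[OF e] prob_space_affine[OF Xl] sets_distr])
    show "cf (Xinf \<epsilon>) = cf (distr (Xinf 1) borel (\<lambda>x. 0 + sqrt \<epsilon> *\<^sub>R x))"
    proof
      fix z
      have "((\<lambda>t. exp (\<i> * of_real (z \<bullet> h t)) * cf (J t) (sqrt \<epsilon> *\<^sub>R z)) \<longlongrightarrow> 1 * cf (Xinf 1) (sqrt \<epsilon> *\<^sub>R z)) at_top"
        by (intro tendsto_mult h0 cfJ)
      moreover have "\<forall>\<^sub>F t in at_top. exp (\<i> * of_real (z \<bullet> h t)) * cf (J t) (sqrt \<epsilon> *\<^sub>R z) = cf (distr M borel (X \<epsilon> t)) z"
        using eventually_gt_at_top[of 0] by eventually_elim (simp add: cfX[OF e])
      ultimately have "((\<lambda>t. cf (distr M borel (X \<epsilon> t)) z) \<longlongrightarrow> 1 * cf (Xinf 1) (sqrt \<epsilon> *\<^sub>R z)) at_top"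
        by (rule Lim_transform_eventually)
      from tendsto_unique[OF _ cfXl[OF e] this] show "cf (Xinf \<epsilon>) z = cf (distr (Xinf 1) borel (\<lambda>x. 0 + sqrt \<epsilon> *\<^sub>R x)) z"
        by (subst cf_affine) (simp_all add: Xl)
    qed
  qed simp_all
  have HJ: "condition_H J"
  proof (rule condition_H_norm_eq[OF H[folded I_def] J])
    fix t z assume t: "(t::real) > 0"
    have "J t = distr (I t) borel (\<lambda>x. drift_part a Q t + 1 *\<^sub>R x)" by (simp add: J_def)
    then have "cf (J t) z = exp (\<i> * of_real (z \<bullet> drift_part a Q t)) * cf (I t) (1 *\<^sub>R z)"
      by (simp only: cf_affine[OF I(2)[OF t]])
    then show "norm (cf (J t) z) = norm (cf (I t) z)" by (simp add: norm_mult)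
  qed
  have tI: "integrable lborel (cf Iinf)" "((\<lambda>t. tv_dist (I t) Iinf) \<longlongrightarrow> 0) at_top"
    by (rule tv_dist_tendsto_limit[OF I Il H[folded I_def] cfI]; assumption)+
  have tJ: "((\<lambda>t. tv_dist (J t) (Xinf 1)) \<longlongrightarrow> 0) at_top"
    by (rule tv_dist_tendsto_limit(2)[OF J Xl HJ cfJ]; simp)
  have bound: "\<bar>tv_dist (distr M borel (X \<epsilon> t)) (Xinf \<epsilon>)
         - tv_dist (distr Iinf borel ((+) ((1 / sqrt \<epsilon>) *\<^sub>R h t))) Iinf\<bar> \<le> tv_dist (J t) (Xinf 1) + 2 * tv_dist (I t) Iinf"
    if e: "\<epsilon> > 0" and t: "t > 0" for \<epsilon> t
  proof -
    \<comment> \<open>Factoring \<open>sqrt \<epsilon>\<close> out of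
      \<open>h t + sqrt \<epsilon> * x\<close> turns the decaying initial condition into this shift
      of \<open>J t\<close>.\<close>
    let ?y = "(1 / sqrt \<epsilon>) *\<^sub>R h t"
    have "distr M borel (X \<epsilon> t) = distr (distr (J t) borel ((+) ?y)) borel (\<lambda>x. 0 + sqrt \<epsilon> *\<^sub>R x)"
      unfolding lawX[OF e t] distr_affine_shift[OF J(2)[OF t]] using e by simp
    then have "tv_dist (distr M borel (X \<epsilon> t)) (Xinf \<epsilon>) = tv_dist (distr (J t) borel ((+) ?y)) (Xinf 1)"
      unfolding Xscale[OF e] using e
      by (simp only:) (rule tv_dist_distr_eq[OF prob_space_shift[OF J[OF t]] sets_distr Xl measurable_affine
            measurable_affine[of 0 "1 / sqrt \<epsilon>"]], simp_all)
    then show ?thesis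
      using tv_dist_shift_error[OF I[OF t] Il Xl(1) J_def, of 1 ?y] by simp
  qed
  show ?thesis
  proof (rule that[where err="\<lambda>t. tv_dist (J t) (Xinf 1) + 2 * tv_dist (I t) Iinf"])
    have "((\<lambda>t. tv_dist (J t) (Xinf 1) + 2 * tv_dist (I t) Iinf) \<longlongrightarrow> 0 + 2 * 0) at_top"
      by (intro tendsto_intros tI tJ)
    then show "((\<lambda>t. tv_dist (J t) (Xinf 1) + 2 * tv_dist (I t) Iinf) \<longlongrightarrow> 0) at_top" by simp
  qed (use bound tI in \<open>auto simp: h_def\<close>)
qed

section \<open>Asymptotics at the cut-off time\<close>

lemma norm_cvec [simp]: "norm (cvec x) = norm x"
  by (simp add: cvec_def norm_vec_def)

lemma norm_vector_smult: "norm (c *s x) = norm c * norm x" for x :: "complex ^ 'n"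
  by (simp add: norm_vec_def norm_mult L2_set_right_distrib)

lemma cvec_scaleR: "cvec (c *\<^sub>R x) = c *\<^sub>R cvec x"
  by (simp add: cvec_def vec_eq_iff scaleR_conv_of_real[where 'a=complex])

text \<open>By independence \<open>v 1\<close> lies outside the span of the other vectors, which is
  closed, so it has a positive distance from it. Dividing a combination by \<open>u 1\<close>, of
  modulus one, makes its norm the distance from \<open>v 1\<close> to a point of that span; the
  bound is uniform in the phases.\<close>

lemma unimodular_combination_lower_bound:
  fixes v :: "nat \<Rightarrow> complex ^ 'n"
  assumes ind: "vec.independent (v ` {1..m})" and inj: "inj_on v {1..m}" and m: "m \<ge> 1"
  obtains \<kappa> where "\<kappa> > 0" "\<And>u. (\<And>k. norm (u k) = 1) \<Longrightarrow> \<kappa> \<le> norm (\<Sum>k = 1..m. u k *s v k)"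
proof -
  let ?W = "vec.span (v ` {2..m})"
  \<comment> \<open>Closedness is available for real subspaces, so the complex span is viewed as
    one.\<close>
  have "subspace ?W"
    unfolding subspace_def
  proof (intro conjI ballI allI)
    fix c :: real and x assume "x \<in> ?W"
    then have "of_real c *s x \<in> ?W" by (rule vec.span_scale)
    moreover have "of_real c *s x = c *\<^sub>R x" by (simp add: vec_eq_iff scaleR_conv_of_real[where 'a=complex])
    ultimately show "c *\<^sub>R x \<in> ?W" by simp
  qed (auto intro: vec.span_zero vec.span_add)
  then have cl: "closed ?W" by (rule closed_subspace)
  have "{2..m} = {1..m} - {1}" by auto
  then have "v ` {2..m} = v ` {1..m} - {v 1}"
    using inj_on_image_set_diff[OF inj, of "{1..m}" "{1}"] m by simp
  moreover have "v 1 \<in> v ` {1..m}" using m by auto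
  ultimately have "v 1 \<notin> ?W" using ind by (auto simp: vec.dependent_def)
  then obtain \<kappa> where \<kappa>: "\<kappa> > 0" "ball (v 1) \<kappa> \<subseteq> - ?W"
    using open_contains_ball[of "- ?W"] cl by (auto simp: open_Compl)
  show ?thesis
  proof (rule that[OF \<kappa>(1)])
    fix u :: "nat \<Rightarrow> complex" assume u: "\<And>k. norm (u k) = 1"
    define w where "w = (\<Sum>k = 2..m. (- (u k / u 1)) *s v k)"
    have "w \<in> ?W" unfolding w_def by (intro vec.span_sum vec.span_scale vec.span_base) auto
    then have "\<kappa> \<le> dist (v 1) w" using \<kappa>(2) by force
    also have "\<dots> = norm (u 1 *s (v 1 - w))" by (simp only: norm_vector_smult u dist_norm mult_1)
    also have "u 1 *s (v 1 - w) = (\<Sum>k = 1..m. u k *s v k)"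
    proof -
      have u1: "u 1 \<noteq> 0" using u[of 1] by auto
      have "u 1 *s (v 1 - w) = u 1 *s v 1 + (\<Sum>k = 2..m. u k *s v k)"
        using u1 by (simp add: w_def vec_eq_iff sum_distrib_left sum_negf algebra_simps)
      also have "\<dots> = (\<Sum>k = 1..m. u k *s v k)"
        using m by (simp add: sum.atLeast_Suc_atMost numeral_2_eq_2)
      finally show ?thesis .
    qed
    finally show "\<kappa> \<le> norm (\<Sum>k = 1..m. u k *s v k)" .
  qed
qed

text \<open>The flow with its decay rate removed: the real vector whose complexification approaches
  the trigonometric sum of the asymptotic data. It stays bounded and away from 0.\<close>

definition amplitude :: "real ^ 'n ^ 'n \<Rightarrow> real ^ 'n \<Rightarrow> real \<Rightarrow> nat \<Rightarrow> real \<Rightarrow> real ^ 'n" where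
  "amplitude Q x0 \<gamma> l t = (exp (\<gamma> * t) / t ^ (l - 1)) *\<^sub>R (mexp ((- t) *\<^sub>R Q) *v x0)"

lemma flow_eq_amplitude:
  assumes "t > 0"
  shows "mexp ((- t) *\<^sub>R Q) *v x0 = (t ^ (l - 1) * exp (- (\<gamma> * t))) *\<^sub>R amplitude Q x0 \<gamma> l t"
  using assms by (simp add: amplitude_def exp_minus)

lemma amplitude_bounds:
  fixes v :: "nat \<Rightarrow> complex ^ 'n"
  assumes "asymptotic_data Q x0 \<gamma> l m \<theta> v"
  obtains \<kappa> U where "\<kappa> > 0" "U > 0"
    "\<forall>\<^sub>F t in at_top. \<kappa> \<le> norm (amplitude Q x0 \<gamma> l t) \<and> norm (amplitude Q x0 \<gamma> l t) \<le> U"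
proof -
  let ?V = "\<lambda>t. \<Sum>k = 1..m. exp (\<i> * of_real (t * \<theta> k)) *s v k"
  have lim: "((\<lambda>t. norm (cvec (amplitude Q x0 \<gamma> l t) - ?V t)) \<longlongrightarrow> 0) at_top"
    and ind: "vec.independent (v ` {1..m})" "inj_on v {1..m}" "m \<ge> 1"
    using assms by (auto simp: asymptotic_data_def amplitude_def cvec_scaleR)
  obtain \<kappa> where \<kappa>: "\<kappa> > 0" "\<And>u. (\<And>k. norm (u k) = 1) \<Longrightarrow> \<kappa> \<le> norm (\<Sum>k = 1..m. u k *s v k)"
    using unimodular_combination_lower_bound[OF ind] by blast
  \<comment> \<open>A deviation below \<open>\<kappa> / 2\<close> keeps half of the lower bound
    \<open>\<kappa>\<close> for the trigonometric sum.\<close>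
  have "\<forall>\<^sub>F t in at_top. norm (cvec (amplitude Q x0 \<gamma> l t) - ?V t) < \<kappa> / 2"
    using lim \<kappa>(1) by (intro order_tendstoD) auto
  then have "\<forall>\<^sub>F t in at_top. \<kappa> / 2 \<le> norm (amplitude Q x0 \<gamma> l t) \<and>
      norm (amplitude Q x0 \<gamma> l t) \<le> (\<Sum>k = 1..m. norm (v k)) + \<kappa>"
  proof eventually_elim
    case (elim t)
    have "\<kappa> \<le> norm (?V t)" by (rule \<kappa>(2)) simp
    moreover have "norm (?V t) \<le> (\<Sum>k = 1..m. norm (v k))"
      by (rule order_trans[OF norm_sum]) (simp add: norm_vector_smult)
    ultimately show ?case
      using elim norm_triangle_ineq2[of "?V t" "cvec (amplitude Q x0 \<gamma> l t)"]
        norm_triangle_ineq2[of "cvec (amplitude Q x0 \<gamma> l t)" "?V t"] \<kappa>(1)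
      unfolding norm_cvec norm_minus_commute[of "?V t"] by linarith
  qed
  moreover have "(\<Sum>k = 1..m. norm (v k)) + \<kappa> > 0" using \<kappa>(1) by (simp add: add_nonneg_pos sum_nonneg)
  ultimately show ?thesis using that[of "\<kappa> / 2"] \<kappa>(1) by auto
qed

text \<open>With trivial phases the trigonometric sum is constant, so the amplitude converges; its
  lower bound passes to the limit and excludes 0.\<close>

lemma amplitude_tendsto_v_sum:
  fixes v :: "nat \<Rightarrow> complex ^ 'n"
  assumes d: "asymptotic_data Q x0 \<gamma> l m \<theta> v" and \<theta>: "\<forall>k\<in>{1..m}. \<theta> k = 0"
  shows "(amplitude Q x0 \<gamma> l \<longlongrightarrow> v_sum m v) at_top" "v_sum m v \<noteq> 0"
proof -
  let ?V = "\<lambda>t. \<Sum>k = 1..m. exp (\<i> * of_real (t * \<theta> k)) *s v k"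
  have V: "?V t = (\<Sum>k = 1..m. v k)" for t using \<theta> by (intro sum.cong) auto
  have "((\<lambda>t. norm (cvec (amplitude Q x0 \<gamma> l t) - ?V t)) \<longlongrightarrow> 0) at_top"
    using d by (auto simp: asymptotic_data_def amplitude_def cvec_scaleR)
  then have lim: "((\<lambda>t. cvec (amplitude Q x0 \<gamma> l t)) \<longlongrightarrow> (\<Sum>k = 1..m. v k)) at_top"
    unfolding V by (rule LIM_zero_cancel[OF tendsto_norm_zero_cancel])
  show A: "(amplitude Q x0 \<gamma> l \<longlongrightarrow> v_sum m v) at_top"
  proof (rule vec_tendstoI)
    fix i
    have "((\<lambda>t. Re (cvec (amplitude Q x0 \<gamma> l t) $ i)) \<longlongrightarrow> Re ((\<Sum>k = 1..m. v k) $ i)) at_top"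
      by (intro tendsto_Re tendsto_vec_nth lim)
    then show "((\<lambda>t. amplitude Q x0 \<gamma> l t $ i) \<longlongrightarrow> v_sum m v $ i) at_top"
      by (simp add: cvec_def v_sum_def)
  qed
  obtain \<kappa> U where \<kappa>: "\<kappa> > 0"
    "\<forall>\<^sub>F t in at_top. \<kappa> \<le> norm (amplitude Q x0 \<gamma> l t) \<and> norm (amplitude Q x0 \<gamma> l t) \<le> U"
    using amplitude_bounds[OF d] by metis
  have "\<kappa> \<le> norm (v_sum m v)"
    by (rule tendsto_lowerbound[OF tendsto_norm[OF A]]) (use \<kappa>(2) in \<open>auto elim: eventually_mono\<close>)
  then show "v_sum m v \<noteq> 0" using \<kappa>(1) by auto
qed

lemma flow_tendsto_0:
  assumes d: "asymptotic_data Q x0 \<gamma> l m \<theta> v"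
  shows "((\<lambda>t. mexp ((- t) *\<^sub>R Q) *v x0) \<longlongrightarrow> 0) at_top"
proof -
  have \<gamma>: "\<gamma> > 0" using d by (simp add: asymptotic_data_def)
  obtain \<kappa> U where U: "U > 0"
    "\<forall>\<^sub>F t in at_top. \<kappa> \<le> norm (amplitude Q x0 \<gamma> l t) \<and> norm (amplitude Q x0 \<gamma> l t) \<le> U"
    using amplitude_bounds[OF d] by metis
  have "filterlim (\<lambda>t. \<gamma> * t) at_top at_top"
    using \<gamma> by (intro filterlim_tendsto_pos_mult_at_top[OF tendsto_const _ filterlim_ident])
  from filterlim_compose[OF tendsto_power_div_exp_0[of "l - 1"] this]
  have "((\<lambda>t. U / \<gamma> ^ (l - 1) * ((\<gamma> * t) ^ (l - 1) / exp (\<gamma> * t))) \<longlongrightarrow> U / \<gamma> ^ (l - 1) * 0) at_top"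
    by (intro tendsto_mult tendsto_const)
  then have "((\<lambda>t. U / \<gamma> ^ (l - 1) * ((\<gamma> * t) ^ (l - 1) / exp (\<gamma> * t))) \<longlongrightarrow> 0) at_top" by simp
  then show ?thesis
  proof (rule Lim_null_comparison[rotated])
    show "\<forall>\<^sub>F t in at_top. norm (mexp ((- t) *\<^sub>R Q) *v x0) \<le> U / \<gamma> ^ (l - 1) * ((\<gamma> * t) ^ (l - 1) / exp (\<gamma> * t))"
      using U(2) eventually_gt_at_top[of 0]
    proof eventually_elim
      case (elim t)
      have "norm (mexp ((- t) *\<^sub>R Q) *v x0) = (t ^ (l - 1) * exp (- (\<gamma> * t))) * norm (amplitude Q x0 \<gamma> l t)"
        using elim by (subst flow_eq_amplitude[where \<gamma>=\<gamma> and l=l]) auto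
      also have "\<dots> \<le> (t ^ (l - 1) * exp (- (\<gamma> * t))) * U"
        using elim by (intro mult_left_mono) auto
      also have "\<dots> = U / \<gamma> ^ (l - 1) * ((\<gamma> * t) ^ (l - 1) / exp (\<gamma> * t))"
        using \<gamma> by (simp add: power_mult_distrib exp_minus field_simps)
      finally show ?case .
    qed
  qed
qed

section \<open>Logarithmic asymptotics of the cut-off time\<close>

lemma ln_inverse_at_right_0: "filterlim (\<lambda>\<epsilon>::real. ln (1 / \<epsilon>)) at_top (at_right 0)"
proof -
  have "filterlim (\<lambda>\<epsilon>::real. 1 / \<epsilon>) at_top (at_right 0)"
    using filterlim_inverse_at_top_right by (simp add: inverse_eq_divide)
  then show ?thesis by (rule filterlim_compose[OF ln_at_top])
qed

text \<open>The double logarithm and the bounded window are negligible against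
  \<open>ln (1 / \<epsilon>)\<close>. The limit \<open>1 / (2 * \<gamma>)\<close> is the origin of
  the power of \<open>2 * \<gamma>\<close> in the profile.\<close>

lemma cut_time_ratio:
  assumes w: "(w \<longlongrightarrow> w0) (at_right 0)"
  shows "((\<lambda>\<epsilon>. (t_cut \<gamma> l \<epsilon> + c * w \<epsilon>) / ln (1 / \<epsilon>)) \<longlongrightarrow> 1 / (2 * \<gamma>)) (at_right 0)"
proof -
  let ?L = "\<lambda>\<epsilon>::real. ln (1 / \<epsilon>)"
  have 1: "((\<lambda>\<epsilon>. ln (?L \<epsilon>) / ?L \<epsilon>) \<longlongrightarrow> 0) (at_right 0)"
    by (rule filterlim_compose[OF ln_x_over_x_tendsto_0 ln_inverse_at_right_0])
  have 2: "((\<lambda>\<epsilon>. 1 / ?L \<epsilon>) \<longlongrightarrow> 0) (at_right 0)"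
    using tendsto_inverse_0_at_top[OF ln_inverse_at_right_0] by (simp add: inverse_eq_divide)
  have "((\<lambda>\<epsilon>. 1 / (2 * \<gamma>) + (real l - 1) / \<gamma> * (ln (?L \<epsilon>) / ?L \<epsilon>) + c * w \<epsilon> * (1 / ?L \<epsilon>))
     \<longlongrightarrow> 1 / (2 * \<gamma>) + (real l - 1) / \<gamma> * 0 + c * w0 * 0) (at_right 0)"
    by (intro tendsto_intros 1 2 w)
  then have *: "((\<lambda>\<epsilon>. 1 / (2 * \<gamma>) + (real l - 1) / \<gamma> * (ln (?L \<epsilon>) / ?L \<epsilon>) + c * w \<epsilon> * (1 / ?L \<epsilon>))
     \<longlongrightarrow> 1 / (2 * \<gamma>)) (at_right 0)" by simp
  have "\<forall>\<^sub>F \<epsilon> in at_right 0. ?L \<epsilon> > 0"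
    using ln_inverse_at_right_0 unfolding filterlim_at_top_dense by blast
  then have "\<forall>\<^sub>F \<epsilon> in at_right 0. 1 / (2 * \<gamma>) + (real l - 1) / \<gamma> * (ln (?L \<epsilon>) / ?L \<epsilon>) + c * w \<epsilon> * (1 / ?L \<epsilon>)
      = (t_cut \<gamma> l \<epsilon> + c * w \<epsilon>) / ?L \<epsilon>"
  proof eventually_elim
    case (elim \<epsilon>)
    then have "1 / (2 * \<gamma>) = 1 / (2 * \<gamma>) * ?L \<epsilon> / ?L \<epsilon>" by simp
    then show ?case unfolding t_cut_def add_divide_distrib by (simp del: times_divide_eq_left)
  qed
  with * show ?thesis by (rule Lim_transform_eventually)
qed

lemma cut_time_at_top:
  assumes \<gamma>: "\<gamma> > 0" and w: "(w \<longlongrightarrow> w0) (at_right 0)"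
  shows "filterlim (\<lambda>\<epsilon>. t_cut \<gamma> l \<epsilon> + c * w \<epsilon>) at_top (at_right 0)"
proof -
  let ?L = "\<lambda>\<epsilon>::real. ln (1 / \<epsilon>)"
  have "filterlim (\<lambda>\<epsilon>. (t_cut \<gamma> l \<epsilon> + c * w \<epsilon>) / ?L \<epsilon> * ?L \<epsilon>) at_top (at_right 0)"
    using \<gamma> by (intro filterlim_tendsto_pos_mult_at_top[OF cut_time_ratio[OF w] _ ln_inverse_at_right_0]) simp
  moreover have "\<forall>\<^sub>F \<epsilon> in at_right 0. ?L \<epsilon> > 0"
    using ln_inverse_at_right_0 unfolding filterlim_at_top_dense by blast
  then have "\<forall>\<^sub>F \<epsilon> in at_right 0. (t_cut \<gamma> l \<epsilon> + c * w \<epsilon>) / ?L \<epsilon> * ?L \<epsilon> = t_cut \<gamma> l \<epsilon> + c * w \<epsilon>"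
    by eventually_elim simp
  ultimately show ?thesis by (simp add: filterlim_cong)
qed

text \<open>The limit of the factor that relates the shift at the cut-off time to the amplitude,
  established in \<open>cut_time_scale\<close>.\<close>

definition profile_scale :: "real \<Rightarrow> nat \<Rightarrow> real \<Rightarrow> real" where
  "profile_scale \<gamma> l c = (2 * \<gamma>) powi (1 - int l) * exp (- c)"

lemma cut_time_scale:
  assumes \<gamma>: "\<gamma> > 0" and l: "l \<ge> 1" and w: "(w \<longlongrightarrow> 1 / \<gamma>) (at_right 0)"
  defines "T \<equiv> \<lambda>c \<epsilon>. t_cut \<gamma> l \<epsilon> + c * w \<epsilon>"
  shows "((\<lambda>\<epsilon>. T c \<epsilon> ^ (l - 1) * exp (- (\<gamma> * T c \<epsilon>)) / sqrt \<epsilon>) \<longlongrightarrow> profile_scale \<gamma> l c) (at_right 0)"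
proof -
  let ?L = "\<lambda>\<epsilon>::real. ln (1 / \<epsilon>)"
  have "((\<lambda>\<epsilon>. (T c \<epsilon> / ?L \<epsilon>) ^ (l - 1) * exp (- (c * (\<gamma> * w \<epsilon>)))) \<longlongrightarrow>
      (1 / (2 * \<gamma>)) ^ (l - 1) * exp (- (c * (\<gamma> * (1 / \<gamma>))))) (at_right 0)"
    unfolding T_def
    by (intro tendsto_mult tendsto_power tendsto_exp tendsto_minus tendsto_const cut_time_ratio[OF w] w)
  also have "(1 / (2 * \<gamma>)) ^ (l - 1) * exp (- (c * (\<gamma> * (1 / \<gamma>)))) = profile_scale \<gamma> l c"
  proof -
    \<comment> \<open>The assumption \<open>l \<ge> 1\<close> reconciles the integer exponent with
      the truncated natural number \<open>l - 1\<close>.\<close>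
    have "1 - int l = - int (l - 1)" using l by simp
    then have "(2 * \<gamma>) powi (1 - int l) = (1 / (2 * \<gamma>)) ^ (l - 1)"
      by (simp only: power_int_minus power_int_of_nat inverse_eq_divide power_one_over)
    then show ?thesis using \<gamma> by (simp add: profile_scale_def)
  qed
  finally have lim: "((\<lambda>\<epsilon>. (T c \<epsilon> / ?L \<epsilon>) ^ (l - 1) * exp (- (c * (\<gamma> * w \<epsilon>)))) \<longlongrightarrow> profile_scale \<gamma> l c) (at_right 0)" .
  have "\<forall>\<^sub>F \<epsilon> in at_right 0. ?L \<epsilon> > 0"
    using ln_inverse_at_right_0 unfolding filterlim_at_top_dense by blast
  moreover have "\<forall>\<^sub>F \<epsilon>::real in at_right 0. \<epsilon> > 0" by (simp add: eventually_at_right_less)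
  ultimately have "\<forall>\<^sub>F \<epsilon> in at_right 0. (T c \<epsilon> / ?L \<epsilon>) ^ (l - 1) * exp (- (c * (\<gamma> * w \<epsilon>)))
      = T c \<epsilon> ^ (l - 1) * exp (- (\<gamma> * T c \<epsilon>)) / sqrt \<epsilon>"
  proof eventually_elim
    case (elim \<epsilon>)
    \<comment> \<open>The three summands exponentiate to \<open>sqrt \<epsilon>\<close>, to the
      reciprocal of \<open>?L \<epsilon> ^ (l - 1)\<close>, and to a factor tending to
      \<open>exp (- c)\<close>.\<close>
    have "- (\<gamma> * T c \<epsilon>) = - (?L \<epsilon> / 2) + - (real (l - 1) * ln (?L \<epsilon>)) + - (c * (\<gamma> * w \<epsilon>))"
      using \<gamma> l by (simp add: T_def t_cut_def field_simps of_nat_diff)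
    moreover have "exp (- (?L \<epsilon> / 2)) = sqrt \<epsilon>"
    proof (rule real_sqrt_unique[symmetric])
      have "(exp (- (?L \<epsilon> / 2)))\<^sup>2 = exp (- ?L \<epsilon>)" by (simp flip: exp_double)
      also have "\<dots> = \<epsilon>" using elim by (simp add: ln_div)
      finally show "(exp (- (?L \<epsilon> / 2)))\<^sup>2 = \<epsilon>" .
    qed simp
    moreover have "exp (- (real (l - 1) * ln (?L \<epsilon>))) = 1 / ?L \<epsilon> ^ (l - 1)"
      using elim by (simp add: exp_minus exp_of_nat_mult inverse_eq_divide)
    ultimately have "exp (- (\<gamma> * T c \<epsilon>)) = sqrt \<epsilon> * (1 / ?L \<epsilon> ^ (l - 1)) * exp (- (c * (\<gamma> * w \<epsilon>)))"
      by (simp only: exp_add)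
    then show ?case using elim by (simp add: power_divide)
  qed
  with lim show ?thesis by (rule Lim_transform_eventually)
qed

lemma cutoff_scale_t_cut:
  assumes \<gamma>: "\<gamma> > 0" and w: "(w \<longlongrightarrow> w0) (at_right 0)"
  shows "cutoff_scale (t_cut \<gamma> l) w"
proof -
  have t: "filterlim (t_cut \<gamma> l) at_top (at_right 0)"
    using cut_time_at_top[OF \<gamma> w, of l 0] by simp
  have "((\<lambda>\<epsilon>. w \<epsilon> * inverse (t_cut \<gamma> l \<epsilon>)) \<longlongrightarrow> w0 * 0) (at_right 0)"
    by (intro tendsto_mult w tendsto_inverse_0_at_top t)
  then have "((\<lambda>\<epsilon>. w \<epsilon> / t_cut \<gamma> l \<epsilon>) \<longlongrightarrow> 0) (at_right 0)"
    by (simp add: divide_inverse)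
  moreover have "\<forall>\<^sub>F \<epsilon> in at_right 0. t_cut \<gamma> l \<epsilon> > 0"
    using t unfolding filterlim_at_top_dense by blast
  then have "\<forall>\<^sub>F \<epsilon> in at_right 0. t_cut \<gamma> l \<epsilon> \<noteq> 0" by eventually_elim simp
  ultimately have "w \<in> o[at_right 0](t_cut \<gamma> l)" by (intro smalloI_tendsto)
  with t show ?thesis by (simp add: cutoff_scale_def)
qed

lemma profile_scale_pos: "\<gamma> > 0 \<Longrightarrow> profile_scale \<gamma> l c > 0"
  by (simp add: profile_scale_def zero_less_power_int)

lemma profile_scale_at_top:
  shows "((\<lambda>c. profile_scale \<gamma> l c) \<longlongrightarrow> 0) at_top"
proof -
  have "((\<lambda>c::real. exp (- c)) \<longlongrightarrow> 0) at_top"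
    by (rule filterlim_compose[OF exp_at_bot filterlim_uminus_at_bot_at_top])
  then have "((\<lambda>c. profile_scale \<gamma> l c) \<longlongrightarrow> (2 * \<gamma>) powi (1 - int l) * 0) at_top"
    unfolding profile_scale_def by (intro tendsto_mult tendsto_const)
  then show ?thesis by simp
qed

lemma profile_scale_at_bot:
  assumes "\<gamma> > 0"
  shows "filterlim (profile_scale \<gamma> l) at_top at_bot"
proof -
  have "filterlim (\<lambda>c::real. exp (- c)) at_top at_bot"
    by (rule filterlim_compose[OF exp_at_top filterlim_uminus_at_top_at_bot])
  then show ?thesis
    unfolding profile_scale_def
    using assms by (intro filterlim_tendsto_pos_mult_at_top[OF tendsto_const]) (simp add: zero_less_power_int)
qed

section \<open>Cut-off\<close>

lemma tendsto_ereal_oneI: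
  fixes f :: "real \<Rightarrow> ereal"
  assumes "\<And>c. f c \<le> 1" and lower: "\<And>\<eta>. \<eta> > 0 \<Longrightarrow> \<forall>\<^sub>F c in F. ereal (1 - \<eta>) \<le> f c"
  shows "(f \<longlongrightarrow> 1) F"
proof (rule order_tendstoI)
  fix a :: ereal assume "a < 1"
  then obtain r where r: "a < ereal r" "ereal r < 1" using ereal_dense2 by blast
  then have "1 - r > 0" by (simp add: one_ereal_def)
  from lower[OF this] show "\<forall>\<^sub>F c in F. a < f c"
    by eventually_elim (use r in \<open>auto intro: less_le_trans\<close>)
next
  fix a :: ereal assume "1 < a"
  then show "\<forall>\<^sub>F c in F. f c < a"
    using assms(1) by (auto intro!: always_eventually intro: le_less_trans)
qed

lemma tendsto_ereal_zeroI:
  fixes f :: "real \<Rightarrow> ereal"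
  assumes "\<And>c. 0 \<le> f c" and upper: "\<And>\<eta>. \<eta> > 0 \<Longrightarrow> \<forall>\<^sub>F c in F. f c \<le> ereal \<eta>"
  shows "(f \<longlongrightarrow> 0) F"
proof (rule order_tendstoI)
  fix a :: ereal assume "0 < a"
  then obtain r where r: "0 < ereal r" "ereal r < a" using ereal_dense2 by blast
  then have "r > 0" by simp
  from upper[OF this] show "\<forall>\<^sub>F c in F. f c < a"
    by eventually_elim (use r in \<open>auto intro: le_less_trans\<close>)
next
  fix a :: ereal assume "a < 0"
  then show "\<forall>\<^sub>F c in F. a < f c"
    using assms(1) by (auto intro!: always_eventually intro: less_le_trans)
qed

text \<open>What the cut-off argument needs from probability: \<open>\<Phi>\<close> stands for the
  distance between the limit law and its translate, \<open>Y\<close> for the shift at the observed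
  time. The comparison is only eventual, since small \<open>\<epsilon>\<close> is needed to make the
  time positive.\<close>

context
  fixes D :: "real \<Rightarrow> real \<Rightarrow> real" and \<Phi> :: "'a::euclidean_space \<Rightarrow> real"
    and Y :: "real \<Rightarrow> real \<Rightarrow> 'a" and tc w err :: "real \<Rightarrow> real"
  assumes \<Phi>: "continuous_on UNIV \<Phi>" "\<Phi> 0 = 0" "(\<Phi> \<longlongrightarrow> 1) at_infinity"
    and approx: "\<And>c. \<forall>\<^sub>F \<epsilon> in at_right 0. \<bar>D \<epsilon> (tc \<epsilon> + c * w \<epsilon>) - \<Phi> (Y c \<epsilon>)\<bar> \<le> err (tc \<epsilon> + c * w \<epsilon>)"
    and err: "\<And>c. ((\<lambda>\<epsilon>. err (tc \<epsilon> + c * w \<epsilon>)) \<longlongrightarrow> 0) (at_right 0)"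
    and scale: "cutoff_scale tc w"
begin

lemma profile_cutoffI:
  fixes \<rho> :: "real \<Rightarrow> real"
  assumes Y: "\<And>c. ((\<lambda>\<epsilon>. Y c \<epsilon>) \<longlongrightarrow> \<rho> c *\<^sub>R u) (at_right 0)" and u: "u \<noteq> 0"
    and \<rho>: "filterlim \<rho> at_top at_bot" "(\<rho> \<longlongrightarrow> 0) at_top"
  shows "profile_cutoff D tc w (\<lambda>c. \<Phi> (\<rho> c *\<^sub>R u))"
  unfolding profile_cutoff_def
proof (intro conjI allI scale)
  have cont: "isCont \<Phi> x" for x using \<Phi>(1) by (simp add: continuous_on_eq_continuous_at)
  fix c
  have "((\<lambda>\<epsilon>. D \<epsilon> (tc \<epsilon> + c * w \<epsilon>) - \<Phi> (Y c \<epsilon>)) \<longlongrightarrow> 0) (at_right 0)"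
    by (rule Lim_null_comparison[OF _ err[of c]]) (use approx[of c] in simp)
  moreover have "((\<lambda>\<epsilon>. \<Phi> (Y c \<epsilon>)) \<longlongrightarrow> \<Phi> (\<rho> c *\<^sub>R u)) (at_right 0)"
    by (rule isCont_tendsto_compose[OF cont Y])
  ultimately have "((\<lambda>\<epsilon>. (D \<epsilon> (tc \<epsilon> + c * w \<epsilon>) - \<Phi> (Y c \<epsilon>)) + \<Phi> (Y c \<epsilon>)) \<longlongrightarrow> 0 + \<Phi> (\<rho> c *\<^sub>R u)) (at_right 0)"
    by (rule tendsto_add)
  then show "((\<lambda>\<epsilon>. D \<epsilon> (tc \<epsilon> + c * w \<epsilon>)) \<longlongrightarrow> \<Phi> (\<rho> c *\<^sub>R u)) (at_right 0)"
    by simp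
next
  \<comment> \<open>Since \<open>u\<close> is nonzero, growth of \<open>\<rho>\<close> sends the
    shift to infinity, where \<open>\<Phi>\<close> tends to 1.\<close>
  have "filterlim (\<lambda>c. \<rho> c *\<^sub>R u) at_infinity at_bot"
    unfolding filterlim_at_infinity_conv_norm_at_top
  proof -
    have "filterlim (\<lambda>c. norm (\<rho> c) * norm u) at_top at_bot"
      using u \<rho>(1)[THEN filterlim_at_top_imp_at_infinity]
      by (intro filterlim_at_top_mult_tendsto_pos[OF tendsto_const]) (auto simp: filterlim_at_infinity_conv_norm_at_top)
    then show "filterlim (\<lambda>c. norm (\<rho> c *\<^sub>R u)) at_top at_bot" by simp
  qed
  then show "((\<lambda>c. \<Phi> (\<rho> c *\<^sub>R u)) \<longlongrightarrow> 1) at_bot" by (rule filterlim_compose[OF \<Phi>(3)])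
  have "((\<lambda>c. \<rho> c *\<^sub>R u) \<longlongrightarrow> 0 *\<^sub>R u) at_top" by (intro tendsto_intros \<rho>)
  then have "((\<lambda>c. \<Phi> (\<rho> c *\<^sub>R u)) \<longlongrightarrow> \<Phi> (0 *\<^sub>R u)) at_top"
    using \<Phi>(1) by (intro isCont_tendsto_compose[of _ \<Phi>]) (simp_all add: continuous_on_eq_continuous_at)
  then show "((\<lambda>c. \<Phi> (\<rho> c *\<^sub>R u)) \<longlongrightarrow> 0) at_top" using \<Phi>(2) by simp
qed

text \<open>The direction of the shift may keep rotating, so \<open>\<Phi>\<close> along it may have
  no limit. Two-sided bounds on its length suffice, since \<open>\<Phi>\<close> is close to 1 far
  out and close to 0 near the origin, uniformly in the direction.\<close>

lemma window_cutoffI: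
  assumes Y: "\<And>c. \<forall>\<^sub>F \<epsilon> in at_right 0. \<rho> c * \<kappa> \<le> norm (Y c \<epsilon>) \<and> norm (Y c \<epsilon>) \<le> \<rho> c * U"
    and \<kappa>: "\<kappa> > 0" and \<rho>: "filterlim \<rho> at_top at_bot" "(\<rho> \<longlongrightarrow> 0) at_top"
    and D: "\<And>c. \<forall>\<^sub>F \<epsilon> in at_right 0. D \<epsilon> (tc \<epsilon> + c * w \<epsilon>) \<in> {0..1}"
  shows "window_cutoff D tc w"
  unfolding window_cutoff_def
proof (intro conjI scale)
  show "((\<lambda>c. Liminf (at_right 0) (\<lambda>\<epsilon>. ereal (D \<epsilon> (tc \<epsilon> + c * w \<epsilon>)))) \<longlongrightarrow> 1) at_bot"
  proof (rule tendsto_ereal_oneI)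
    fix c
    have "Liminf (at_right 0) (\<lambda>\<epsilon>. ereal (D \<epsilon> (tc \<epsilon> + c * w \<epsilon>)))
        \<le> Limsup (at_right 0) (\<lambda>\<epsilon>. ereal (D \<epsilon> (tc \<epsilon> + c * w \<epsilon>)))"
      by (rule Liminf_le_Limsup) simp
    also have "\<dots> \<le> 1"
      by (rule Limsup_bounded) (use D[of c] in \<open>auto elim: eventually_mono\<close>)
    finally show "Liminf (at_right 0) (\<lambda>\<epsilon>. ereal (D \<epsilon> (tc \<epsilon> + c * w \<epsilon>))) \<le> 1" .
  next
    fix \<eta> :: real assume \<eta>: "\<eta> > 0"
    have "\<forall>\<^sub>F x in at_infinity. \<Phi> x > 1 - \<eta> / 2"
      using \<Phi>(3) \<eta> by (intro order_tendstoD) auto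
    then obtain R where R: "\<And>x. norm x \<ge> R \<Longrightarrow> \<Phi> x > 1 - \<eta> / 2"
      unfolding eventually_at_infinity by blast
    \<comment> \<open>Beyond this threshold the lower bound \<open>\<rho> c * \<kappa>\<close> on
      the length of the shift is at least \<open>R\<close>.\<close>
    have "\<forall>\<^sub>F c in at_bot. \<rho> c \<ge> R / \<kappa>" using \<rho>(1) unfolding filterlim_at_top by blast
    then show "\<forall>\<^sub>F c in at_bot. ereal (1 - \<eta>) \<le> Liminf (at_right 0) (\<lambda>\<epsilon>. ereal (D \<epsilon> (tc \<epsilon> + c * w \<epsilon>)))"
    proof eventually_elim
      case (elim c)
      then have Rc: "R \<le> \<rho> c * \<kappa>" using \<kappa> by (simp add: divide_le_eq)
      have "\<forall>\<^sub>F \<epsilon> in at_right 0. err (tc \<epsilon> + c * w \<epsilon>) < \<eta> / 2"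
        using err[of c] \<eta> by (intro order_tendstoD) auto
      then have "\<forall>\<^sub>F \<epsilon> in at_right 0. ereal (1 - \<eta>) \<le> ereal (D \<epsilon> (tc \<epsilon> + c * w \<epsilon>))"
        using approx[of c] Y[of c]
      proof eventually_elim
        case (elim \<epsilon>)
        have "\<Phi> (Y c \<epsilon>) > 1 - \<eta> / 2" using elim Rc by (intro R) auto
        then have "1 - \<eta> \<le> D \<epsilon> (tc \<epsilon> + c * w \<epsilon>)" using elim by linarith
        then show ?case by simp
      qed
      then show ?case by (rule Liminf_bounded)
    qed
  qed
  show "((\<lambda>c. Limsup (at_right 0) (\<lambda>\<epsilon>. ereal (D \<epsilon> (tc \<epsilon> + c * w \<epsilon>)))) \<longlongrightarrow> 0) at_top"
  proof (rule tendsto_ereal_zeroI)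
    fix c
    have "0 \<le> Liminf (at_right 0) (\<lambda>\<epsilon>. ereal (D \<epsilon> (tc \<epsilon> + c * w \<epsilon>)))"
      by (rule Liminf_bounded) (use D[of c] in \<open>auto elim: eventually_mono\<close>)
    also have "\<dots> \<le> Limsup (at_right 0) (\<lambda>\<epsilon>. ereal (D \<epsilon> (tc \<epsilon> + c * w \<epsilon>)))"
      by (rule Liminf_le_Limsup) simp
    finally show "0 \<le> Limsup (at_right 0) (\<lambda>\<epsilon>. ereal (D \<epsilon> (tc \<epsilon> + c * w \<epsilon>)))" .
  next
    fix \<eta> :: real assume \<eta>: "\<eta> > 0"
    have "isCont \<Phi> 0" using \<Phi>(1) by (simp add: continuous_on_eq_continuous_at)
    then obtain \<delta> where \<delta>: "\<delta> > 0" "\<And>x. norm x < \<delta> \<Longrightarrow> \<bar>\<Phi> x\<bar> < \<eta> / 2"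
      using \<eta> \<Phi>(2) unfolding continuous_at_eps_delta by (force simp: dist_norm dest: spec[of _ "\<eta> / 2"])
    have "((\<lambda>c. \<rho> c * U) \<longlongrightarrow> 0 * U) at_top" by (intro tendsto_intros \<rho>)
    then have "\<forall>\<^sub>F c in at_top. \<rho> c * U < \<delta>" using \<delta>(1) by (intro order_tendstoD) auto
    then show "\<forall>\<^sub>F c in at_top. Limsup (at_right 0) (\<lambda>\<epsilon>. ereal (D \<epsilon> (tc \<epsilon> + c * w \<epsilon>))) \<le> ereal \<eta>"
    proof eventually_elim
      case (elim c)
      note small = elim
      have "\<forall>\<^sub>F \<epsilon> in at_right 0. err (tc \<epsilon> + c * w \<epsilon>) < \<eta> / 2"
        using err[of c] \<eta> by (intro order_tendstoD) auto
      then have "\<forall>\<^sub>F \<epsilon> in at_right 0. ereal (D \<epsilon> (tc \<epsilon> + c * w \<epsilon>)) \<le> ereal \<eta>"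
        using approx[of c] Y[of c]
      proof eventually_elim
        case (elim \<epsilon>)
        have "\<bar>\<Phi> (Y c \<epsilon>)\<bar> < \<eta> / 2" using elim small by (intro \<delta>(2)) auto
        then have "D \<epsilon> (tc \<epsilon> + c * w \<epsilon>) \<le> \<eta>" using elim by linarith
        then show ?case by simp
      qed
      then show ?case by (rule Limsup_bounded)
    qed
  qed
qed

end

theorem theorem2p3:
  fixes Q :: "real ^ 'n ^ 'n" and x0 :: "real ^ 'n"
    and \<gamma> :: real and l m :: nat and \<theta> :: "nat \<Rightarrow> real" and v :: "nat \<Rightarrow> complex ^ 'n"
    and M :: "'w measure" and \<xi> :: "real \<Rightarrow> 'w \<Rightarrow> real ^ 'n"
    and a :: "real ^ 'n" and S :: "real ^ 'n ^ 'n" and \<nu> :: "(real ^ 'n) measure"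
    and X :: "real \<Rightarrow> real \<Rightarrow> 'w \<Rightarrow> real ^ 'n" and Xinf :: "real \<Rightarrow> (real ^ 'n) measure"
    and Iinf :: "(real ^ 'n) measure" and r w :: "real \<Rightarrow> real" and D :: "real \<Rightarrow> real \<Rightarrow> real"
  assumes "Q \<in> Mplus" and "x0 \<noteq> 0"
    and "asymptotic_data Q x0 \<gamma> l m \<theta> v"
    and "prob_space M"
    and "prob_space.levy_process M \<xi> a S \<nu>"
    and "integrable M (\<lambda>\<omega>. ln (max 1 (norm (\<xi> 1 \<omega>))))"
    and "condition_H (\<lambda>t. distr M borel (I_nat \<xi> a Q t))"
    and "limit_law (\<lambda>t. distr M borel (I_nat \<xi> a Q t)) Iinf"
    and "\<And>\<epsilon>. \<epsilon> > 0 \<Longrightarrow> prob_space.ou_process M \<xi> Q x0 \<epsilon> (X \<epsilon>)"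
    and "\<And>\<epsilon>. \<epsilon> > 0 \<Longrightarrow> limit_law (\<lambda>t. distr M borel (X \<epsilon> t)) (Xinf \<epsilon>)"
    and "(r \<longlongrightarrow> 0) (at_right 0)"
  defines "w \<equiv> \<lambda>\<epsilon>. 1 / \<gamma> + r \<epsilon>"
    and "D \<equiv> \<lambda>\<epsilon> t. tv_dist (distr M borel (X \<epsilon> t)) (Xinf \<epsilon>)"
  shows "((\<forall>k\<in>{1..m}. \<theta> k = 0) \<longrightarrow>
            profile_cutoff D (t_cut \<gamma> l) w (profile_fun \<gamma> l (v_sum m v) Iinf) \<and>
            (\<forall>c. profile_fun \<gamma> l (v_sum m v) Iinf c \<in> {0..1})) \<and>
         ((\<exists>k\<in>{1..m}. \<theta> k \<noteq> 0) \<longrightarrow> window_cutoff D (t_cut \<gamma> l) w)"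
proof -
  note data = assms(3)
  have \<gamma>: "\<gamma> > 0" and l: "l \<ge> 1" using data by (auto simp: asymptotic_data_def)
  have w: "(w \<longlongrightarrow> 1 / \<gamma>) (at_right 0)"
    unfolding w_def using tendsto_add[OF tendsto_const assms(11), of "1 / \<gamma>"] by simp
  define T where "T c \<epsilon> = t_cut \<gamma> l \<epsilon> + c * w \<epsilon>" for c \<epsilon>
  have T: "filterlim (T c) at_top (at_right 0)" for c
    unfolding T_def by (rule cut_time_at_top[OF \<gamma> w])
  have Tpos: "\<forall>\<^sub>F \<epsilon> in at_right 0. \<epsilon> > 0 \<and> T c \<epsilon> > 0" for c
    using T[of c] unfolding filterlim_at_top_dense
    by (intro eventually_conj) (auto simp: eventually_at_right_less)
  define \<Phi> where "\<Phi> u = tv_dist (distr Iinf borel ((+) u)) Iinf" for u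
  define Y where "Y c \<epsilon> = (1 / sqrt \<epsilon>) *\<^sub>R (mexp ((- T c \<epsilon>) *\<^sub>R Q) *v x0)" for c \<epsilon>
  have Iinf: "prob_space Iinf" "sets Iinf = sets borel" using assms(8) by (auto simp: limit_law_def)
  obtain err where err: "(err \<longlongrightarrow> 0) at_top"
    "\<And>\<epsilon> t. \<epsilon> > 0 \<Longrightarrow> t > 0 \<Longrightarrow> \<bar>D \<epsilon> t - \<Phi> ((1 / sqrt \<epsilon>) *\<^sub>R (mexp ((- t) *\<^sub>R Q) *v x0))\<bar> \<le> err t"
    and int: "integrable lborel (cf Iinf)"
    unfolding D_def \<Phi>_def
    using ou_tv_dist_approximation[OF assms(4,5,7,8,9,10) flow_tendsto_0[OF data]] by metis
  have \<Phi>: "continuous_on UNIV \<Phi>" "(\<Phi> \<longlongrightarrow> 1) at_infinity" "\<Phi> 0 = 0"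
  proof -
    show "continuous_on UNIV \<Phi>" "(\<Phi> \<longlongrightarrow> 1) at_infinity"
      unfolding \<Phi>_def by (rule tv_dist_shift_continuous[OF Iinf int], rule tv_dist_shift_at_infinity[OF Iinf])
    have "(+) 0 = (\<lambda>x :: real ^ 'n. x)" by (simp add: fun_eq_iff)
    then have "distr Iinf borel ((+) 0) = Iinf"
      using distr_id2[OF Iinf(2)[symmetric]] by simp
    then show "\<Phi> 0 = 0" by (simp add: \<Phi>_def tv_dist_self)
  qed
  have approx: "\<forall>\<^sub>F \<epsilon> in at_right 0. \<bar>D \<epsilon> (t_cut \<gamma> l \<epsilon> + c * w \<epsilon>) - \<Phi> (Y c \<epsilon>)\<bar> \<le> err (t_cut \<gamma> l \<epsilon> + c * w \<epsilon>)" for c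
    using Tpos[of c]
  proof eventually_elim
    case (elim \<epsilon>)
    then show ?case using err(2)[of \<epsilon> "T c \<epsilon>"] by (simp add: Y_def T_def)
  qed
  have errT: "((\<lambda>\<epsilon>. err (t_cut \<gamma> l \<epsilon> + c * w \<epsilon>)) \<longlongrightarrow> 0) (at_right 0)" for c
    using filterlim_compose[OF err(1) T[of c]] by (simp add: T_def)
  note scale = cutoff_scale_t_cut[OF \<gamma> w, of l]
  note \<rho> = profile_scale_at_bot[OF \<gamma>, of l] profile_scale_at_top[of \<gamma> l]
  define s where "s c \<epsilon> = T c \<epsilon> ^ (l - 1) * exp (- (\<gamma> * T c \<epsilon>)) / sqrt \<epsilon>" for c \<epsilon>
  have s: "(s c \<longlongrightarrow> profile_scale \<gamma> l c) (at_right 0)" for c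
    unfolding s_def T_def by (rule cut_time_scale[OF \<gamma> l w])
  have Ys: "\<forall>\<^sub>F \<epsilon> in at_right 0. s c \<epsilon> *\<^sub>R amplitude Q x0 \<gamma> l (T c \<epsilon>) = Y c \<epsilon>" for c
    using Tpos[of c]
  proof eventually_elim
    case (elim \<epsilon>)
    then show ?case
      unfolding Y_def by (subst flow_eq_amplitude[where \<gamma>=\<gamma> and l=l]) (simp_all add: s_def)
  qed
  have pf: "profile_fun \<gamma> l u Iinf c = \<Phi> (profile_scale \<gamma> l c *\<^sub>R u)" for u c
    by (simp add: profile_fun_def \<Phi>_def profile_scale_def)
  have profile: "profile_cutoff D (t_cut \<gamma> l) w (profile_fun \<gamma> l (v_sum m v) Iinf)"
    if \<theta>: "\<forall>k\<in>{1..m}. \<theta> k = 0"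
    unfolding pf
  proof (rule profile_cutoffI[OF \<Phi>(1,3,2) approx errT scale _ amplitude_tendsto_v_sum(2)[OF data \<theta>] \<rho>])
    fix c
    have "((\<lambda>\<epsilon>. s c \<epsilon> *\<^sub>R amplitude Q x0 \<gamma> l (T c \<epsilon>)) \<longlongrightarrow> profile_scale \<gamma> l c *\<^sub>R v_sum m v) (at_right 0)"
      by (intro tendsto_scaleR s filterlim_compose[OF amplitude_tendsto_v_sum(1)[OF data \<theta>] T])
    then show "(Y c \<longlongrightarrow> profile_scale \<gamma> l c *\<^sub>R v_sum m v) (at_right 0)"
      by (rule Lim_transform_eventually[OF _ Ys])
  qed
  have range: "profile_fun \<gamma> l u Iinf c \<in> {0..1}" for u c
    unfolding pf \<Phi>_def
    using tv_dist_nonneg[OF prob_space_shift[OF Iinf] Iinf(1)] tv_dist_le_1[OF prob_space_shift[OF Iinf] Iinf(1)] by simp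
  have window: "window_cutoff D (t_cut \<gamma> l) w"
  proof -
    obtain \<kappa> U where \<kappa>: "\<kappa> > 0" "U > 0"
      "\<forall>\<^sub>F t in at_top. \<kappa> \<le> norm (amplitude Q x0 \<gamma> l t) \<and> norm (amplitude Q x0 \<gamma> l t) \<le> U"
      using amplitude_bounds[OF data] by metis
    show ?thesis
    proof (rule window_cutoffI[OF \<Phi>(1,3,2) approx errT scale _ _ \<rho>])
      fix c
      let ?\<rho> = "profile_scale \<gamma> l c"
      have \<rho>0: "?\<rho> > 0" by (rule profile_scale_pos[OF \<gamma>])
      \<comment> \<open>The positive limit confines \<open>s c \<epsilon>\<close> between half and
        twice its value, which accounts for the constants \<open>\<kappa> / 2\<close> and
        \<open>2 * U\<close> below.\<close>
      have "\<forall>\<^sub>F \<epsilon> in at_right 0. ?\<rho> / 2 < s c \<epsilon>" "\<forall>\<^sub>F \<epsilon> in at_right 0. s c \<epsilon> < 2 * ?\<rho>"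
        by (rule order_tendstoD[OF s[of c]], use \<rho>0 in linarith)+
      moreover have "\<forall>\<^sub>F \<epsilon> in at_right 0. \<kappa> \<le> norm (amplitude Q x0 \<gamma> l (T c \<epsilon>)) \<and> norm (amplitude Q x0 \<gamma> l (T c \<epsilon>)) \<le> U"
        by (rule eventually_compose_filterlim[OF \<kappa>(3) T])
      ultimately show "\<forall>\<^sub>F \<epsilon> in at_right 0. ?\<rho> * (\<kappa> / 2) \<le> norm (Y c \<epsilon>) \<and> norm (Y c \<epsilon>) \<le> ?\<rho> * (2 * U)"
        using Ys[of c]
      proof eventually_elim
        case (elim \<epsilon>)
        have "s c \<epsilon> > 0" using elim(1) \<rho>0 by linarith
        then have n: "norm (Y c \<epsilon>) = s c \<epsilon> * norm (amplitude Q x0 \<gamma> l (T c \<epsilon>))"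
          unfolding elim(4)[symmetric] by simp
        have "(?\<rho> / 2) * \<kappa> \<le> norm (Y c \<epsilon>)" "norm (Y c \<epsilon>) \<le> (2 * ?\<rho>) * U"
          unfolding n using elim \<rho>0 \<kappa>(1,2) by (intro mult_mono; simp)+
        then show ?case by (simp add: mult_ac)
      qed
    next
      show "\<kappa> / 2 > 0" using \<kappa>(1) by simp
    next
      fix c
      show "\<forall>\<^sub>F \<epsilon> in at_right 0. D \<epsilon> (t_cut \<gamma> l \<epsilon> + c * w \<epsilon>) \<in> {0..1}"
        using Tpos[of c]
      proof eventually_elim
        case (elim \<epsilon>)
        interpret prob_space M by fact
        have "prob_space (distr M borel (X \<epsilon> (T c \<epsilon>)))"
          using assms(9)[of \<epsilon>] elim by (intro prob_space_distr) (auto simp: ou_process_def)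
        moreover have "prob_space (Xinf \<epsilon>)" using assms(10)[of \<epsilon>] elim by (auto simp: limit_law_def)
        ultimately show ?case
          unfolding D_def T_def using tv_dist_nonneg tv_dist_le_1 by auto
      qed
    qed
  qed
  from profile range window show ?thesis by blast
qed

end
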